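(* Let $n$ take values only in an infinite set of odd square-free integers greater than $1$ such that \[ \frac{n^{1/3}}{p_n}\to 0 \quad\text{as } n\to\infty, \] where $p_n$ is the smallest prime factor of $n$, and let $r$ be real. Let $J(z)=\sum_{j=1}^{n-1}\left(\frac{j}{n}\right)z^j$ be the character polynomial of degree $n-1$. Then \[ \lim_{n\to\infty}\,\max_{V\in\mathcal{V}_n}\,F(J_r+V_r)=\lim_{n\to\infty}\,\min_{V\in\mathcal{V}_n}\,F(J_r+V_r)=f(r). \]
   Context: For real $\alpha\ge1$ and $A\in\mathbb{C}[z]$, $\|A\|_\alpha=\left(\frac{1}{2\pi}\int_0^{2\pi}|A(e^{i\theta})|^\alpha d\theta\right)^{1/\alpha}$. The merit factor of $A$ is $F(A)=\frac{\|A\|_2^4}{\|A\|_4^4-\|A\|_2^4}$. For a polynomial $A$ of degree at most $n-1$ and real $r$, the rotation is $A_r(z)=z^{-\lfloor nr\rfloor}A(z)\bmod (z^n-1)$. $\left(\frac{\cdot}{n}\right)$ denotes the Jacobi symbol. $\mathcal{V}_n$ is the set of polynomials $\sum_{j=0}^{n-1}v_jz^j$ with $v_j\in\{0,-1,+1\}$ and $v_j=0$ if and only if $\gcd(j,n)=1$. The function $f$ is $1$-periodic with $f(r)=\dfrac{1}{\frac16+8\left(|r|-\frac14\right)^2}$ for $-\frac12<r\le\frac12$. *)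

theory Defs
  imports "HOL-Analysis.Analysis" "HOL-Number_Theory.Number_Theory"
    "HOL-Computational_Algebra.Computational_Algebra"
begin

definition Jacobi :: "int \<Rightarrow> nat \<Rightarrow> int" where
  "Jacobi a n = (\<Prod>p\<in>#prime_factorization n. Legendre a (int p))"

definition Lnorm :: "real \<Rightarrow> complex poly \<Rightarrow> real" where
  "Lnorm \<alpha> A = ((1 / (2*pi)) * integral {0..2*pi} (\<lambda>\<theta>. cmod (poly A (cis \<theta>)) powr \<alpha>)) powr (1/\<alpha>)"

definition merit_factor :: "complex poly \<Rightarrow> real" where
  "merit_factor A = Lnorm 2 A ^ 4 / (Lnorm 4 A ^ 4 - Lnorm 2 A ^ 4)"

text \<open>Rotation A_r(z) = z^(-floor(n r)) A(z) mod (z^n - 1), for A of degree at most n-1: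
  coefficient j (j < n) of A_r is coefficient ((j + floor(n r)) mod n) of A.\<close>
definition rotation :: "nat \<Rightarrow> real \<Rightarrow> complex poly \<Rightarrow> complex poly" where
  "rotation n r A = (\<Sum>j<n. Polynomial.monom (Polynomial.coeff A (nat ((int j + \<lfloor>real n * r\<rfloor>) mod int n))) j)"

definition char_poly :: "nat \<Rightarrow> complex poly" where
  "char_poly n = (\<Sum>j=1..n-1. Polynomial.monom (of_int (Jacobi (int j) n)) j)"

definition V_set :: "nat \<Rightarrow> complex poly set" where
  "V_set n = {V. (\<forall>j\<ge>n. Polynomial.coeff V j = 0) \<and>
      (\<forall>j<n. Polynomial.coeff V j \<in> {0, -1, 1} \<and> (Polynomial.coeff V j = 0 \<longleftrightarrow> coprime j n))}"

text \<open>1-periodic function f; r - ceil(r - 1/2) is the representative of r in (-1/2, 1/2].\<close>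
definition f_lim :: "real \<Rightarrow> real" where
  "f_lim r = (let s = r - of_int \<lceil>r - 1/2\<rceil> in 1 / (1/6 + 8 * (\<bar>s\<bar> - 1/4)^2))"

definition smallest_prime_factor :: "nat \<Rightarrow> nat" where
  "smallest_prime_factor n = Min (prime_factors n)"

end

theory Submission
  imports Defs "HOL-Real_Asymp.Real_Asymp"
begin

text \<open>
  Let $A$ be the rotated character polynomial and $\chi$ the Jacobi symbol modulo $n$. Since $A^2$ has degree
  less than $2n$, $\|A\|_4^4$ is the mean of $|A|^4$ over the $2n$-th roots of unity. At the $n$-th roots
  of unity the Gauss sum gives $|A|^2 = n$ or $0$; at the other points interpolation gives
  $|A|^2 = n\,|\sum_u w_u \chi(u-m)|^2$ with weights $w_u$ decaying like $1/u$.
  Expanding the fourth power produces the correlations of four shifts of $\chi$. Shifts that coincide in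
  pairs give the main term $7/6 + 8(|r|-1/4)^2$; the remaining correlations have a power saving
  as long as no two distinct shifts collide modulo a prime factor of $n$, and the colliding shifts carry total
  weight $O(\log^4 n / p_n)$.

  The power saving $O(p^{3/4})$ for quartic character sums is elementary: the sum reduces to a cubic one, and
  the fourth moment over all cubics modulo $p$ is at most $3p^6$, while each cubic shares its
  absolute value with about $p^3$ others.

  Finally $V$ has at most $2n/p_n$ nonzero coefficients, so $\|V\|_4^4 \le (2n/p_n)^3 = o(n^2)$.
\<close>

section \<open>Sums over residues and the Legendre symbol\<close>

text \<open>The weights have absolute sum O(log n), so four of them cost only log^4 n. Any fixed
  power saving in the correlations is therefore enough, and it may be taken from a single prime
  factor of n with the trivial bound on the cofactor. This is why a moment argument can stand in for
  the Weil bound. The hypothesis on p_n acts twice. It makes n < p_n^3 eventually, so that n has at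
  most two prime factors and each error term is a negative power of n times logarithms. Its full
  strength is used for V, whose signs are arbitrary: after division by n^2 the bound for V becomes 8
  (n^(1/3)/p_n)^3. The constant 7/6 is 1/2 from the n-th roots of unity plus half of 2 - 2/3. Here 2
  comes from the two pairings that match a weight with a conjugate weight, and 2/3 corrects the
  overlap of the pairings when all four shifts agree. The third pairing, which matches the two
  unconjugated weights, is the only one that sees the rotation.\<close>

lemma bij_betw_affine_mod:
  fixes N a b :: int
  assumes "N > 0" "coprime a N"
  shows "bij_betw (\<lambda>x. (a * x + b) mod N) {0..<N} {0..<N}"
proof -
  have inj: "inj_on (\<lambda>x. (a * x + b) mod N) {0..<N}"
  proof (rule inj_onI)
    fix x y assume xy: "x \<in> {0..<N}" "y \<in> {0..<N}" "(a * x + b) mod N = (a * y + b) mod N"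
    then have "[a * x + b = a * y + b] (mod N)" by (simp add: cong_def)
    then have "[a * x = a * y] (mod N)" by (simp add: cong_add_rcancel)
    then have "[x = y] (mod N)" using assms(2) by (simp add: cong_mult_lcancel)
    then show "x = y" using xy by (simp add: cong_def)
  qed
  moreover have "(\<lambda>x. (a * x + b) mod N) ` {0..<N} \<subseteq> {0..<N}" using assms(1) by auto
  ultimately show ?thesis
    unfolding bij_betw_def using endo_inj_surj[of "{0..<N}"] by simp
qed

lemma sum_periodic_affine:
  fixes N a b :: int and F :: "int \<Rightarrow> 'a::comm_monoid_add"
  assumes "N > 0" "coprime a N" and per: "\<And>x. F (x mod N) = F x"
  shows "(\<Sum>x\<in>{0..<N}. F (a * x + b)) = (\<Sum>x\<in>{0..<N}. F x)"
proof -
  have "(\<Sum>x\<in>{0..<N}. F (a * x + b)) = (\<Sum>x\<in>{0..<N}. F ((a * x + b) mod N))"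
    by (simp add: per)
  also have "\<dots> = (\<Sum>x\<in>{0..<N}. F x)"
    by (rule sum.reindex_bij_betw[OF bij_betw_affine_mod[OF assms(1,2)]])
  finally show ?thesis .
qed

lemma sum_periodic_shift:
  fixes N b :: int and F :: "int \<Rightarrow> 'a::comm_monoid_add"
  assumes "N > 0" and per: "\<And>x. F (x mod N) = F x"
  shows "(\<Sum>x\<in>{0..<N}. F (x + b)) = (\<Sum>x\<in>{0..<N}. F x)"
  using sum_periodic_affine[of N 1 F b] assms by simp

text \<open>Chinese remaindering: reduction modulo both factors is injective on a full period, and
  equal cardinalities make it a bijection. This later splits one prime off a complete sum of Jacobi
  symbols.\<close>

lemma sum_periodic_crt:
  fixes P m :: int and F G :: "int \<Rightarrow> 'a::comm_semiring_0"
  assumes "P > 0" "m > 0" "coprime P m"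
    and F: "\<And>x. F (x mod P) = F x" and G: "\<And>x. G (x mod m) = G x"
  shows "(\<Sum>x\<in>{0..<P*m}. F x * G x) = (\<Sum>x\<in>{0..<P}. F x) * (\<Sum>x\<in>{0..<m}. G x)"
proof -
  have inj: "inj_on (\<lambda>x. (x mod P, x mod m)) {0..<P*m}"
  proof (rule inj_onI)
    fix x y assume xy: "x \<in> {0..<P*m}" "y \<in> {0..<P*m}" "(x mod P, x mod m) = (y mod P, y mod m)"
    then have "[x = y] (mod P)" "[x = y] (mod m)" by (simp_all add: cong_def)
    then have "[x = y] (mod (P*m))" using assms(3) by (rule coprime_cong_mult)
    then show "x = y" using xy by (simp add: cong_def)
  qed
  have sub: "(\<lambda>x. (x mod P, x mod m)) ` {0..<P*m} \<subseteq> {0..<P} \<times> {0..<m}" using assms by auto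
  have card: "card ((\<lambda>x. (x mod P, x mod m)) ` {0..<P*m}) = card ({0..<P} \<times> {0..<m})"
    using assms by (simp add: card_image[OF inj] nat_mult_distrib)
  have bij: "bij_betw (\<lambda>x. (x mod P, x mod m)) {0..<P*m} ({0..<P} \<times> {0..<m})"
    unfolding bij_betw_def using inj card_subset_eq[OF _ sub card] by simp
  have "(\<Sum>x\<in>{0..<P*m}. F x * G x) = (\<Sum>x\<in>{0..<P*m}. (\<lambda>(u,v). F u * G v) (x mod P, x mod m))"
    by (simp add: F G)
  also have "\<dots> = (\<Sum>(u,v)\<in>{0..<P} \<times> {0..<m}. F u * G v)"
    by (rule sum.reindex_bij_betw[OF bij])
  also have "\<dots> = (\<Sum>x\<in>{0..<P}. F x) * (\<Sum>x\<in>{0..<m}. G x)"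
    by (simp add: sum_product sum.cartesian_product)
  finally show ?thesis .
qed

lemma sum_int_interval: "(\<Sum>x\<in>{0..<int n}. F x) = (\<Sum>j<n. F (int j))"
  by (rule sum.reindex_bij_witness[of _ int nat]) auto

section \<open>The Legendre symbol\<close>

lemma Legendre_mod: "Legendre (x mod int p) p = Legendre x p"
  by (simp add: Legendre_def QuadRes_def cong_def)

lemma Legendre_values: "Legendre x p \<in> {-1, 0, 1}"
  by (simp add: Legendre_def)

lemma Legendre_abs_le_1: "\<bar>Legendre x p\<bar> \<le> 1"
  by (simp add: Legendre_def)

lemma Legendre_eq_0_iff: "Legendre x p = 0 \<longleftrightarrow> p dvd x"
  by (simp add: Legendre_def cong_0_iff)

text \<open>Euler's criterion gives the identity modulo p. The two sides differ by at most 2 in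
  absolute value, and p > 2, so the congruence is an equality.\<close>

lemma Legendre_mult:
  fixes p :: nat
  assumes "prime p" "p > 2"
  shows "Legendre (x * y) (int p) = Legendre x (int p) * Legendre y (int p)"
proof -
  let ?e = "(p - 1) div 2"
  have "[Legendre (x * y) p = (x * y) ^ ?e] (mod p)"
    by (rule euler_criterion[OF assms])
  moreover have "[Legendre x p * Legendre y p = x ^ ?e * y ^ ?e] (mod p)"
    by (rule cong_mult; rule euler_criterion[OF assms])
  ultimately have c: "[Legendre (x * y) p = Legendre x p * Legendre y p] (mod p)"
    by (metis cong_sym cong_trans power_mult_distrib)
  have "\<bar>Legendre (x * y) p - Legendre x p * Legendre y p\<bar> \<le> 2"
    using Legendre_values[of "x*y" "int p"] Legendre_values[of x "int p"] Legendre_values[of y "int p"] by auto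
  moreover have "int p dvd Legendre (x * y) p - Legendre x p * Legendre y p"
    using c by (simp add: cong_iff_dvd_diff)
  ultimately show ?thesis using assms(2) zdvd_imp_le[of "int p" "\<bar>Legendre (x * y) p - Legendre x p * Legendre y p\<bar>"]
    by (cases "Legendre (x * y) p - Legendre x p * Legendre y p = 0") auto
qed

text \<open>Without nonresidues squaring would be onto the residues, hence injective by finiteness;
  but 1 and p - 1 are distinct and have the same square.\<close>

lemma ex_quadratic_nonresidue:
  fixes p :: nat
  assumes "prime p" "p > 2"
  shows "\<exists>x. Legendre x (int p) = -1"
proof (rule ccontr)
  assume no: "\<nexists>x. Legendre x (int p) = -1"
  let ?R = "{0..<int p}"
  have "?R \<subseteq> (\<lambda>x. x\<^sup>2 mod int p) ` ?R"
  proof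
    fix a assume a: "a \<in> ?R"
    have "QuadRes (int p) a"
    proof (cases "[a = 0] (mod int p)")
      case True
      then have "[0\<^sup>2 = a] (mod int p)" by (simp add: cong_sym)
      then show ?thesis unfolding QuadRes_def by blast
    next
      case False
      then show ?thesis using no Legendre_def[of a "int p"] by metis
    qed
    then obtain y where "[y\<^sup>2 = a] (mod int p)" unfolding QuadRes_def by blast
    then have "a = (y mod int p)\<^sup>2 mod int p" using a by (simp add: cong_def power_mod)
    moreover have "y mod int p \<in> ?R" using assms(2) by simp
    ultimately show "a \<in> (\<lambda>x. x\<^sup>2 mod int p) ` ?R" by blast
  qed
  then have "inj_on (\<lambda>x. x\<^sup>2 mod int p) ?R"
    by (meson eq_card_imp_inj_on card_image_le card_mono finite_atLeastLessThan_int finite_imageI order_antisym)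
  moreover have "(int p - 1)\<^sup>2 mod int p = 1\<^sup>2 mod int p"
    by (simp add: power2_eq_square algebra_simps mod_eq_dvd_iff)
  moreover have "int p - 1 \<in> ?R" "1 \<in> ?R" using assms(2) by auto
  ultimately have "int p - 1 = 1" by (rule inj_onD)
  then show False using assms(2) by simp
qed

section \<open>Quartic character sums modulo an odd prime\<close>

locale odd_prime =
  fixes p :: nat
  assumes prime_p: "prime p" and gt_2: "p > 2"
begin

definition chi :: "int \<Rightarrow> real" where "chi x = real_of_int (Legendre x (int p))"

abbreviation "Res \<equiv> {0..<int p}"

lemma chi_mod: "chi (x mod int p) = chi x"
  by (simp add: chi_def Legendre_mod)

lemma chi_cong: "[x = y] (mod int p) \<Longrightarrow> chi x = chi y"
  by (metis chi_mod cong_def)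

lemma chi_mult: "chi (x * y) = chi x * chi y"
  by (simp add: chi_def Legendre_mult[OF prime_p gt_2])

lemma chi_eq_0_iff: "chi x = 0 \<longleftrightarrow> int p dvd x"
  by (simp add: chi_def Legendre_eq_0_iff)

lemma chi_abs_le_1: "\<bar>chi x\<bar> \<le> 1"
  unfolding chi_def using Legendre_abs_le_1[of x "int p"] by linarith

lemma chi_square: "\<not> int p dvd x \<Longrightarrow> chi x * chi x = 1"
  using Legendre_values[of x "int p"] Legendre_eq_0_iff[of x "int p"] by (auto simp: chi_def)

lemma prime_int: "prime (int p)"
  using prime_p by simp

lemma coprime_iff: "coprime a (int p) \<longleftrightarrow> \<not> int p dvd a"
  by (metis coprime_commute prime_imp_coprime prime_int coprime_absorb_left not_prime_unit)

text \<open>Multiplication by a nonresidue permutes the residues and changes the sign of every term,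
  so the full sum equals its own negative.\<close>

lemma sum_chi_affine:
  assumes "\<not> int p dvd a"
  shows "(\<Sum>x\<in>Res. chi (a * x + b)) = 0"
proof -
  obtain v where v: "chi v = -1"
    using ex_quadratic_nonresidue[OF prime_p gt_2] unfolding chi_def by (metis of_int_1 of_int_minus)
  then have "\<not> int p dvd v" using chi_eq_0_iff[of v] by auto
  then have "(\<Sum>x\<in>Res. chi (v * x + 0)) = (\<Sum>x\<in>Res. chi x)"
    using gt_2 by (intro sum_periodic_affine) (auto simp: coprime_iff chi_mod)
  then have "(\<Sum>x\<in>Res. chi x) = 0"
    by (simp add: chi_mult v sum_negf)
  moreover have "(\<Sum>x\<in>Res. chi (a * x + b)) = (\<Sum>x\<in>Res. chi x)"
    using gt_2 assms by (intro sum_periodic_affine) (auto simp: coprime_iff chi_mod)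
  ultimately show ?thesis by simp
qed

text \<open>The leading coefficient may vanish modulo p. Polynomials of lower degree are kept so
  that the coefficient vectors form a full group, on which translation is a bijection.\<close>

definition cubic :: "int \<times> int \<times> int \<times> int \<Rightarrow> int \<Rightarrow> int" where
  "cubic = (\<lambda>(c0, c1, c2, c3) x. c0 + c1 * x + c2 * x^2 + c3 * x^3)"

abbreviation "Coeffs \<equiv> Res \<times> Res \<times> Res \<times> Res"

lemma sum_Coeffs_translate:
  fixes F :: "int \<times> int \<times> int \<times> int \<Rightarrow> real"
  assumes per: "\<And>c0 c1 c2 c3. F (c0 mod int p, c1 mod int p, c2 mod int p, c3 mod int p) = F (c0, c1, c2, c3)"
  shows "(\<Sum>(c0,c1,c2,c3)\<in>Coeffs. F (c0 + l0, c1 + l1, c2 + l2, c3 + l3)) = (\<Sum>c\<in>Coeffs. F c)"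
proof -
  have p0: "int p > 0" using gt_2 by simp
  have F1: "F (x mod int p, b, c, d) = F (x, b, c, d)" for x b c d
    using per[of x b c d] per[of "x mod int p" b c d] by simp
  have F2: "F (b, x mod int p, c, d) = F (b, x, c, d)" for x b c d
    using per[of b x c d] per[of b "x mod int p" c d] by simp
  have F3: "F (b, c, x mod int p, d) = F (b, c, x, d)" for x b c d
    using per[of b c x d] per[of b c "x mod int p" d] by simp
  have F4: "F (b, c, d, x mod int p) = F (b, c, d, x)" for x b c d
    using per[of b c d x] per[of b c d "x mod int p"] by simp
  have "(\<Sum>(c0,c1,c2,c3)\<in>Coeffs. F (c0 + l0, c1 + l1, c2 + l2, c3 + l3))
      = (\<Sum>c0\<in>Res. \<Sum>c1\<in>Res. \<Sum>c2\<in>Res. \<Sum>c3\<in>Res. F (c0 + l0, c1 + l1, c2 + l2, c3 + l3))"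
    by (simp add: sum.cartesian_product)
  also have "\<dots> = (\<Sum>c0\<in>Res. \<Sum>c1\<in>Res. \<Sum>c2\<in>Res. \<Sum>c3\<in>Res. F (c0 + l0, c1 + l1, c2 + l2, c3))"
    by (intro sum.cong refl sum_periodic_shift[OF p0]) (rule F4)
  also have "\<dots> = (\<Sum>c0\<in>Res. \<Sum>c1\<in>Res. \<Sum>c2\<in>Res. \<Sum>c3\<in>Res. F (c0 + l0, c1 + l1, c2, c3))"
    by (intro sum.cong refl sum_periodic_shift[OF p0, where F = "\<lambda>x. \<Sum>c3\<in>Res. F (_, _, x, c3)"]) (simp add: F3)
  also have "\<dots> = (\<Sum>c0\<in>Res. \<Sum>c1\<in>Res. \<Sum>c2\<in>Res. \<Sum>c3\<in>Res. F (c0 + l0, c1, c2, c3))"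
    by (intro sum.cong refl sum_periodic_shift[OF p0, where F = "\<lambda>x. \<Sum>c2\<in>Res. \<Sum>c3\<in>Res. F (_, x, c2, c3)"]) (simp add: F2)
  also have "\<dots> = (\<Sum>c0\<in>Res. \<Sum>c1\<in>Res. \<Sum>c2\<in>Res. \<Sum>c3\<in>Res. F (c0, c1, c2, c3))"
    by (intro sum_periodic_shift[OF p0, where F = "\<lambda>x. \<Sum>c1\<in>Res. \<Sum>c2\<in>Res. \<Sum>c3\<in>Res. F (x, c1, c2, c3)"]) (simp add: F1)
  also have "\<dots> = (\<Sum>c\<in>Coeffs. F c)"
    by (simp add: sum.cartesian_product)
  finally show ?thesis .
qed

lemma cubic_mod:
  "[cubic (c0 mod int p, c1 mod int p, c2 mod int p, c3 mod int p) x = cubic (c0, c1, c2, c3) x] (mod int p)"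
  unfolding cubic_def prod.case by (intro cong_add cong_mult) (auto simp: cong_def)

text \<open>Translating the cubic by multiples of $(x-x_2)(x-x_3)(x-x_4)$ changes only its value at $x_1$.\<close>
lemma sum_chi_cub_eq_0:
  assumes x: "x1 \<in> Res" "x2 \<in> Res" "x3 \<in> Res" "x4 \<in> Res" and ne: "x1 \<noteq> x2" "x1 \<noteq> x3" "x1 \<noteq> x4"
  shows "(\<Sum>c\<in>Coeffs. chi (cubic c x1) * chi (cubic c x2) * chi (cubic c x3) * chi (cubic c x4)) = 0"
proof -
  define L where "L = (\<lambda>x. (x - x2) * (x - x3) * (x - x4))"
  define l0 l1 l2 where "l0 = - (x2*x3*x4)" and "l1 = x2*x3 + x2*x4 + x3*x4" and "l2 = - (x2+x3+x4)"
  have L: "cubic (c0 + t*l0, c1 + t*l1, c2 + t*l2, c3 + t*1) x = cubic (c0,c1,c2,c3) x + t * L x" for c0 c1 c2 c3 t x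
    unfolding cubic_def L_def l0_def l1_def l2_def prod.case by (simp add: algebra_simps power2_eq_square power3_eq_cube)
  have nd: "\<not> int p dvd x1 - y" if "y \<in> Res" "x1 \<noteq> y" for y
  proof
    assume "int p dvd x1 - y"
    then have "[x1 = y] (mod int p)" by (simp add: cong_iff_dvd_diff)
    then show False using that x(1) by (simp add: cong_def)
  qed
  have L1: "\<not> int p dvd L x1"
    unfolding L_def using nd x ne prime_dvd_mult_iff[OF prime_int] by blast
  define F where "F = (\<lambda>c. chi (cubic c x1) * chi (cubic c x2) * chi (cubic c x3) * chi (cubic c x4))"
  have F: "F (c0 mod int p, c1 mod int p, c2 mod int p, c3 mod int p) = F (c0, c1, c2, c3)" for c0 c1 c2 c3
    unfolding F_def by (simp add: chi_cong[OF cubic_mod])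
  \<comment> \<open>Averaging over p translates leaves the sum unchanged. In the average only the
    factor at \<open>x1\<close> depends on t, and it does so through an affine function with slope
    \<open>L x1\<close>, which is nonzero modulo p; the sum over t therefore vanishes.\<close>
  have "real p * sum F Coeffs = (\<Sum>t\<in>Res. sum F Coeffs)" by simp
  also have "\<dots> = (\<Sum>t\<in>Res. \<Sum>(c0,c1,c2,c3)\<in>Coeffs. F (c0 + t*l0, c1 + t*l1, c2 + t*l2, c3 + t*1))"
    by (subst sum_Coeffs_translate) (auto simp: F)
  also have "\<dots> = (\<Sum>t\<in>Res. \<Sum>c\<in>Coeffs. chi (L x1 * t + cubic c x1) * (chi (cubic c x2) * chi (cubic c x3) * chi (cubic c x4)))"
  proof (intro sum.cong refl)
    fix t and c :: "int \<times> int \<times> int \<times> int"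
    obtain c0 c1 c2 c3 where c: "c = (c0,c1,c2,c3)" by (cases c)
    have z: "L x2 = 0" "L x3 = 0" "L x4 = 0" by (simp_all add: L_def)
    show "(case c of (c0,c1,c2,c3) \<Rightarrow> F (c0 + t*l0, c1 + t*l1, c2 + t*l2, c3 + t*1)) =
      chi (L x1 * t + cubic c x1) * (chi (cubic c x2) * chi (cubic c x3) * chi (cubic c x4))"
      unfolding c prod.case F_def L z by (simp add: algebra_simps)
  qed
  also have "\<dots> = (\<Sum>c\<in>Coeffs. \<Sum>t\<in>Res. chi (L x1 * t + cubic c x1) * (chi (cubic c x2) * chi (cubic c x3) * chi (cubic c x4)))"
    by (rule sum.swap)
  also have "\<dots> = 0"
    by (simp add: sum_distrib_right[symmetric] sum_chi_affine[OF L1])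
  finally show ?thesis using gt_2 unfolding F_def by simp
qed

text \<open>Expanding the fourth power gives a sum over quadruples of points. A quadruple with a
  point different from the other three contributes zero by \<open>sum_chi_cub_eq_0\<close>. What
  remains are the paired quadruples, at most 3p^2 of them, each contributing at most p^4.\<close>

lemma sum_chi_cub_fourth_power_le:
  "(\<Sum>c\<in>Coeffs. (\<Sum>x\<in>Res. chi (cubic c x)) ^ 4) \<le> 3 * real p ^ 6"
proof -
  define F where "F = (\<lambda>(x1,x2,x3,x4) c. chi (cubic c x1) * chi (cubic c x2) * chi (cubic c x3) * chi (cubic c x4))"
  define Q where "Q = {x \<in> Coeffs. case x of (x1,x2,x3,x4) \<Rightarrow>
      x1 = x2 \<and> x3 = x4 \<or> x1 = x3 \<and> x2 = x4 \<or> x1 = x4 \<and> x2 = x3}"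
  have Qsub: "Q \<subseteq> Coeffs" by (auto simp: Q_def)
  have zero: "(\<Sum>c\<in>Coeffs. F x c) = 0" if x: "x \<in> Coeffs - Q" for x
  proof -
    obtain x1 x2 x3 x4 where xeq: "x = (x1,x2,x3,x4)" by (cases x)
    have R: "x1 \<in> Res" "x2 \<in> Res" "x3 \<in> Res" "x4 \<in> Res" using x xeq by auto
    have "(x1, x2, x3, x4) \<in> Q" if "x1 = x2 \<and> x3 = x4 \<or> x1 = x3 \<and> x2 = x4 \<or> x1 = x4 \<and> x2 = x3"
      using that R unfolding Q_def by simp
    with x xeq have "\<not> (x1 = x2 \<and> x3 = x4 \<or> x1 = x3 \<and> x2 = x4 \<or> x1 = x4 \<and> x2 = x3)" by blast
    \<comment> \<open>If no entry were isolated, each would have an equal partner among the other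
      three, and the quadruple would split into equal pairs.\<close>
    then have "(x1 \<noteq> x2 \<and> x1 \<noteq> x3 \<and> x1 \<noteq> x4) \<or> (x2 \<noteq> x1 \<and> x2 \<noteq> x3 \<and> x2 \<noteq> x4) \<or>
      (x3 \<noteq> x1 \<and> x3 \<noteq> x2 \<and> x3 \<noteq> x4) \<or> (x4 \<noteq> x1 \<and> x4 \<noteq> x2 \<and> x4 \<noteq> x3)"
      by metis
    then show ?thesis
    proof (elim disjE conjE)
      assume "x1 \<noteq> x2" "x1 \<noteq> x3" "x1 \<noteq> x4"
      with sum_chi_cub_eq_0[of x1 x2 x3 x4] R show ?thesis by (simp add: F_def xeq)
    next
      assume "x2 \<noteq> x1" "x2 \<noteq> x3" "x2 \<noteq> x4"
      from sum_chi_cub_eq_0[OF R(2) R(1) R(3) R(4) this] show ?thesis unfolding F_def xeq prod.case by (simp only: mult_ac)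
    next
      assume "x3 \<noteq> x1" "x3 \<noteq> x2" "x3 \<noteq> x4"
      from sum_chi_cub_eq_0[OF R(3) R(1) R(2) R(4) this] show ?thesis unfolding F_def xeq prod.case by (simp only: mult_ac)
    next
      assume "x4 \<noteq> x1" "x4 \<noteq> x2" "x4 \<noteq> x3"
      from sum_chi_cub_eq_0[OF R(4) R(1) R(2) R(3) this] show ?thesis unfolding F_def xeq prod.case by (simp only: mult_ac)
    qed
  qed
  have Fle: "\<bar>F x c\<bar> \<le> 1" for x c
  proof -
    obtain x1 x2 x3 x4 where [simp]: "x = (x1,x2,x3,x4)" by (cases x)
    show ?thesis unfolding F_def
      using chi_abs_le_1 by (simp add: abs_mult mult_le_one)
  qed
  have cardQ: "card Q \<le> 3 * p\<^sup>2"
  proof -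
    define Q1 where "Q1 = (\<lambda>(x,y). (x,x,y,y)) ` (Res \<times> Res)"
    define Q2 where "Q2 = (\<lambda>(x,y). (x,y,x,y)) ` (Res \<times> Res)"
    define Q3 where "Q3 = (\<lambda>(x,y). (x,y,y,x)) ` (Res \<times> Res)"
    have "Q \<subseteq> Q1 \<union> Q2 \<union> Q3" by (auto simp: Q_def Q1_def Q2_def Q3_def)
    moreover have "finite (Q1 \<union> Q2 \<union> Q3)" by (simp add: Q1_def Q2_def Q3_def)
    ultimately have "card Q \<le> card (Q1 \<union> Q2 \<union> Q3)" by (rule card_mono[rotated])
    also have "\<dots> \<le> card Q1 + card Q2 + card Q3"
      by (meson add_right_mono card_Un_le order_trans)
    also have "\<dots> \<le> p\<^sup>2 + p\<^sup>2 + p\<^sup>2"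
      unfolding Q1_def Q2_def Q3_def
      by (intro add_mono; rule order_trans[OF card_image_le]; simp add: power2_eq_square)
    finally show ?thesis by simp
  qed
  have "(\<Sum>x\<in>Res. chi (cubic c x)) ^ 4 = (\<Sum>x\<in>Coeffs. F x c)" for c
  proof -
    have "(\<Sum>x\<in>Res. chi (cubic c x)) ^ 4 = (\<Sum>x\<in>Res. chi (cubic c x)) * ((\<Sum>x\<in>Res. chi (cubic c x)) * ((\<Sum>x\<in>Res. chi (cubic c x)) * (\<Sum>x\<in>Res. chi (cubic c x))))"
      by (simp add: power4_eq_xxxx mult.assoc)
    also have "\<dots> = (\<Sum>x\<in>Coeffs. F x c)"
      unfolding sum_product sum.cartesian_product F_def by (intro sum.cong) (auto simp: mult.assoc)
    finally show ?thesis .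
  qed
  then have "(\<Sum>c\<in>Coeffs. (\<Sum>x\<in>Res. chi (cubic c x)) ^ 4) = (\<Sum>c\<in>Coeffs. \<Sum>x\<in>Coeffs. F x c)" by simp
  also have "\<dots> = (\<Sum>x\<in>Coeffs. \<Sum>c\<in>Coeffs. F x c)" by (rule sum.swap)
  also have "\<dots> = (\<Sum>x\<in>Q. \<Sum>c\<in>Coeffs. F x c)"
    by (rule sum.mono_neutral_right) (use Qsub zero in auto)
  also have "\<dots> \<le> (\<Sum>x\<in>Q. \<Sum>c\<in>Coeffs. 1)"
    by (intro sum_mono) (meson Fle abs_le_D1)
  also have "\<dots> = real (card Q) * real p ^ 4" by (simp add: power4_eq_xxxx)
  also have "\<dots> \<le> real (3 * p\<^sup>2) * real p ^ 4"
    by (intro mult_right_mono) (use cardQ in \<open>auto simp del: of_nat_mult of_nat_power\<close>)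
  also have "\<dots> = 3 * real p ^ 6" by (simp flip: power_add)
  finally show ?thesis .
qed

lemma Res_eqI: "x \<in> Res \<Longrightarrow> y \<in> Res \<Longrightarrow> int p dvd x - y \<Longrightarrow> x = y"
  by (metis atLeastLessThan_iff mod_eq_dvd_iff mod_pos_pos_trivial)

text \<open>The affine changes of variable and scalings of a cubic with two distinct roots form a family of
  about $p^3$ cubics whose character sums have the same absolute value, and each cubic arises at most nine times.\<close>
lemma sum_chi_cubic_distinct:
  assumes ab: "\<not> int p dvd a - b"
  shows "(\<Sum>x\<in>Res. chi ((x - a) * (x - b) * (x - c))) ^ 4 \<le> 108 * real p ^ 3"
proof -
  define T where "T = (\<Sum>x\<in>Res. chi ((x - a) * (x - b) * (x - c)))"
  have p0: "int p > 0" using gt_2 by simp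
  obtain i where i: "[(b - a) * i = 1] (mod int p)"
    using ab cong_solve_coprime_int[of "b - a" "int p"] coprime_iff dvd_minus_iff[of "int p" "a - b"] by auto
  \<comment> \<open>Here \<open>i\<close> inverts b - a modulo p, and \<open>l\<close> is the
    coordinate of c on the line where a is 0 and b is 1. So \<open>w\<close> gives the third root at
    the same ratio relative to u and v: the image of c under the affine map that sends a to u and b
    to v.\<close>
  define l where "l = i * (c - a)"
  define w where "w = (\<lambda>(g::int,u,v). u + l * (v - u))"
  \<comment> \<open>By Vieta, these are the coefficients of g (x - u)(x - v)(x - w), reduced modulo
    p.\<close>
  define \<Phi> where "\<Phi> = (\<lambda>(g,u,v). ((-(g * u * v * w (g,u,v))) mod int p,
     (g * (u * v + u * w (g,u,v) + v * w (g,u,v))) mod int p, (-(g * (u + v + w (g,u,v)))) mod int p, g mod int p))"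
  define Par where "Par = {(g,u,v) | g u v. g \<in> {1..<int p} \<and> u \<in> Res \<and> v \<in> Res \<and> u \<noteq> v}"
  have Psub: "Par \<subseteq> Res \<times> Res \<times> Res" by (auto simp: Par_def)
  then have finP: "finite Par" by (rule finite_subset) simp
  have cubPhi: "[cubic (\<Phi> (g,u,v)) x = g * (x - u) * (x - v) * (x - w (g,u,v))] (mod int p)" for g u v x
  proof -
    have "[cubic (\<Phi> (g,u,v)) x = cubic (-(g * u * v * w (g,u,v)), g * (u * v + u * w (g,u,v) + v * w (g,u,v)),
        -(g * (u + v + w (g,u,v))), g) x] (mod int p)"
      unfolding \<Phi>_def prod.case by (rule cubic_mod)
    also have "cubic (-(g * u * v * w (g,u,v)), g * (u * v + u * w (g,u,v) + v * w (g,u,v)),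
        -(g * (u + v + w (g,u,v))), g) x = g * (x - u) * (x - v) * (x - w (g,u,v))"
      unfolding cubic_def prod.case by (simp add: algebra_simps power2_eq_square power3_eq_cube)
    finally show ?thesis .
  qed
  have TPhi: "\<bar>\<Sum>x\<in>Res. chi (cubic (\<Phi> q) x)\<bar> = \<bar>T\<bar>" if qP: "q \<in> Par" for q
  proof -
    obtain g u v where q: "q = (g,u,v)" "g \<in> {1..<int p}" "u \<in> Res" "v \<in> Res" "u \<noteq> v"
      using qP unfolding Par_def by blast
    have g: "\<not> int p dvd g" using q(2) zdvd_imp_le[of "int p" g] by auto
    have uv: "\<not> int p dvd v - u" using Res_eqI[of v u] q by auto
    \<comment> \<open>The slope of the affine map taking a to u and b to v. Substituting this map
      turns the cubic with roots u, v, w into the original one, up to the constant factor g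
      \<alpha>^3, whose character value is 1 or -1.\<close>
    define \<alpha> where "\<alpha> = i * (v - u)"
    have i0: "\<not> int p dvd i"
    proof
      assume "int p dvd i"
      then have "[(b - a) * i = 0] (mod int p)" by (simp add: cong_0_iff)
      then have "[1 = 0] (mod int p)" using i cong_sym cong_trans by blast
      then show False using gt_2 by (simp add: cong_def)
    qed
    have \<alpha>: "\<not> int p dvd \<alpha>" unfolding \<alpha>_def using i0 uv prime_dvd_mult_iff[OF prime_int] by blast
    have e: "[\<alpha> * x + (u - \<alpha> * a) - v = \<alpha> * (x - b)] (mod int p)" for x
    proof -
      have "\<alpha> * x + (u - \<alpha> * a) - v - \<alpha> * (x - b) = (v - u) * ((b - a) * i - 1)"
        unfolding \<alpha>_def by (simp add: algebra_simps)
      then show ?thesis using i unfolding cong_iff_dvd_diff by simp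
    qed
    have e2: "\<alpha> * x + (u - \<alpha> * a) - w (g,u,v) = \<alpha> * (x - c)" for x
      unfolding \<alpha>_def w_def l_def by (simp add: algebra_simps)
    have e1: "\<alpha> * x + (u - \<alpha> * a) - u = \<alpha> * (x - a)" for x by (simp add: algebra_simps)
    have "(\<Sum>x\<in>Res. chi (cubic (\<Phi> q) x)) = (\<Sum>x\<in>Res. chi (g * (x - u) * (x - v) * (x - w (g,u,v))))"
      unfolding q(1) using chi_cong[OF cubPhi] by simp
    also have "\<dots> = (\<Sum>x\<in>Res. chi (g * ((\<alpha> * x + (u - \<alpha> * a)) - u) * ((\<alpha> * x + (u - \<alpha> * a)) - v) * ((\<alpha> * x + (u - \<alpha> * a)) - w (g,u,v))))"
    proof (rule sum_periodic_affine[symmetric, OF p0])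
      show "coprime \<alpha> (int p)" using \<alpha> coprime_iff by simp
      show "chi (g * (x mod int p - u) * (x mod int p - v) * (x mod int p - w (g, u, v))) =
         chi (g * (x - u) * (x - v) * (x - w (g, u, v)))" for x
        by (intro chi_cong cong_mult cong_diff) (auto simp: cong_def)
    qed
    also have "\<dots> = (\<Sum>x\<in>Res. chi (g * (\<alpha> * (x - a)) * (\<alpha> * (x - b)) * (\<alpha> * (x - c))))"
      unfolding e1 e2 by (intro sum.cong refl chi_cong cong_mult e) auto
    also have "\<dots> = (\<Sum>x\<in>Res. chi (g * \<alpha> * \<alpha> * \<alpha>) * chi ((x - a) * (x - b) * (x - c)))"
      by (simp add: chi_mult mult_ac)
    also have "\<dots> = chi (g * \<alpha> * \<alpha> * \<alpha>) * T"
      unfolding T_def by (simp add: sum_distrib_left)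
    finally have eq: "(\<Sum>x\<in>Res. chi (cubic (\<Phi> q) x)) = chi (g * \<alpha> * \<alpha> * \<alpha>) * T" .
    have "\<not> int p dvd g * \<alpha> * \<alpha> * \<alpha>" using g \<alpha> prime_dvd_mult_iff[OF prime_int] by blast
    from chi_square[OF this] have "\<bar>chi (g * \<alpha> * \<alpha> * \<alpha>)\<bar> = 1"
      by (simp add: abs_square_eq_1[symmetric] power2_eq_square)
    then show ?thesis unfolding eq by (simp add: abs_mult)
  qed
  \<comment> \<open>The leading coefficient determines g. The two remaining parameters must be roots
    modulo p of the same cubic, which leaves at most three choices for each.\<close>
  have fibre: "card {q \<in> Par. \<Phi> q = y} \<le> 9" for y
  proof (cases "{q \<in> Par. \<Phi> q = y} = {}")
    case False
    then obtain g u v where q: "(g,u,v) \<in> Par" "\<Phi> (g,u,v) = y" by auto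
    define Rt where "Rt = {u, v, w (g,u,v) mod int p}"
    have "{q \<in> Par. \<Phi> q = y} \<subseteq> {g} \<times> Rt \<times> Rt"
    proof
      fix q' assume q': "q' \<in> {q \<in> Par. \<Phi> q = y}"
      obtain g' u' v' where q'': "q' = (g',u',v')" by (cases q')
      have q3: "(g',u',v') \<in> Par" "\<Phi> (g',u',v') = y" using q' unfolding q'' by blast+
      have P': "g' \<in> {1..<int p}" "u' \<in> Res" "v' \<in> Res" using q3(1) unfolding Par_def by blast+
      have P'4: "\<Phi> (g',u',v') = \<Phi> (g,u,v)" using q3(2) q(2) by (rule trans[OF _ sym])
      have P: "g \<in> {1..<int p}" "u \<in> Res" "v \<in> Res" using q(1) unfolding Par_def by blast+
      have "g' mod int p = g mod int p" using P'4 by (simp add: \<Phi>_def)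
      then have gg: "g' = g" using P' P by simp
      have mem: "z \<in> Rt" if z: "z \<in> Res" "z = u' \<or> z = v'" for z
      proof -
        have "[g * (z - u) * (z - v) * (z - w (g,u,v)) = g' * (z - u') * (z - v') * (z - w (g',u',v'))] (mod int p)"
          by (rule cong_trans[OF cong_sym[OF cubPhi[of g u v z]] cubPhi[of g' u' v' z, unfolded P'4]])
        then have "[g * (z - u) * (z - v) * (z - w (g,u,v)) = 0] (mod int p)" using z(2) by auto
        then have "int p dvd g * (z - u) * (z - v) * (z - w (g,u,v))" by (simp add: cong_0_iff)
        moreover have "\<not> int p dvd g" using P(1) zdvd_imp_le[of "int p" g] by auto
        ultimately consider "int p dvd z - u" | "int p dvd z - v" | "int p dvd z - w (g,u,v)"
          using prime_dvd_mult_iff[OF prime_int] by blast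
        then show ?thesis
        proof cases
          case 3
          then have "z mod int p = w (g,u,v) mod int p" by (simp add: mod_eq_dvd_iff)
          then show ?thesis using z(1) by (simp add: Rt_def)
        qed (use Res_eqI z P in \<open>auto simp: Rt_def\<close>)
      qed
      show "q' \<in> {g} \<times> Rt \<times> Rt" using mem P' gg q'' by auto
    qed
    then have "card {q \<in> Par. \<Phi> q = y} \<le> card ({g} \<times> Rt \<times> Rt)"
      by (rule card_mono[rotated]) (simp add: Rt_def)
    also have "\<dots> = card Rt * card Rt" by (simp add: card_cartesian_product)
    also have "\<dots> \<le> 3 * 3"
      unfolding Rt_def by (intro mult_mono) (auto simp: card_insert_if)
    finally show ?thesis by simp
  next
    case True
    then have "card {q \<in> Par. \<Phi> q = y} = 0" by (simp only: card.empty)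
    then show ?thesis by simp
  qed
  \<comment> \<open>Pairs of distinct residues are parametrised by the first one and a nonzero
    difference.\<close>
  have cardP: "card Par \<ge> p * (p - 1)\<^sup>2"
  proof -
    have "inj_on (\<lambda>(g,u,v). (g, u, (u + v) mod int p)) ({1..<int p} \<times> Res \<times> {1..<int p})"
    proof (rule inj_onI, clarsimp)
      fix u v v' :: int assume *: "1 \<le> v" "v < int p" "1 \<le> v'" "v' < int p" "(u + v) mod int p = (u + v') mod int p"
      then have "int p dvd v - v'" by (simp add: mod_eq_dvd_iff)
      then show "v = v'" using Res_eqI * by auto
    qed
    moreover have "(\<lambda>(g,u,v). (g, u, (u + v) mod int p)) ` ({1..<int p} \<times> Res \<times> {1..<int p}) \<subseteq> Par"
    proof clarsimp
      fix g u v :: int assume *: "1 \<le> g" "g < int p" "0 \<le> u" "u < int p" "1 \<le> v" "v < int p"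
      have "u \<noteq> (u + v) mod int p"
      proof
        assume "u = (u + v) mod int p"
        then have "u mod int p = (u + v) mod int p" using * by simp
        then have "int p dvd v" by (simp add: mod_eq_dvd_iff)
        then show False using * zdvd_imp_le[of "int p" v] by auto
      qed
      then show "(g, u, (u + v) mod int p) \<in> Par" using * by (auto simp: Par_def)
    qed
    ultimately have "card ({1..<int p} \<times> Res \<times> {1..<int p}) \<le> card Par"
      using card_inj_on_le finP by blast
    moreover have "card {1..<int p} = p - 1" using gt_2 by (simp add: nat_diff_distrib)
    moreover have "card Res = p" by simp
    ultimately show ?thesis
      by (simp add: card_cartesian_product power2_eq_square mult_ac del: card_atLeastLessThan_int)
  qed
  have "real (card Par) * T ^ 4 = (\<Sum>q\<in>Par. (\<Sum>x\<in>Res. chi (cubic (\<Phi> q) x)) ^ 4)"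
  proof -
    have "(\<Sum>x\<in>Res. chi (cubic (\<Phi> q) x)) ^ 4 = T ^ 4" if "q \<in> Par" for q
      using TPhi[OF that] by (metis even_numeral power_even_abs)
    then show ?thesis by simp
  qed
  also have "\<dots> = (\<Sum>y\<in>Coeffs. \<Sum>q\<in>{q \<in> Par. \<Phi> q = y}. (\<Sum>x\<in>Res. chi (cubic (\<Phi> q) x)) ^ 4)"
    by (rule sum.group[symmetric]) (use finP p0 in \<open>auto simp: \<Phi>_def\<close>)
  also have "\<dots> = (\<Sum>y\<in>Coeffs. real (card {q \<in> Par. \<Phi> q = y}) * (\<Sum>x\<in>Res. chi (cubic y x)) ^ 4)"
    by (intro sum.cong refl) simp
  also have "\<dots> \<le> (\<Sum>y\<in>Coeffs. 9 * (\<Sum>x\<in>Res. chi (cubic y x)) ^ 4)"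
    by (intro sum_mono mult_right_mono) (use fibre in auto)
  also have "\<dots> \<le> 9 * (3 * real p ^ 6)"
    unfolding sum_distrib_left[symmetric] using sum_chi_cub_fourth_power_le by simp
  finally have 1: "real (card Par) * T ^ 4 \<le> 27 * real p ^ 6" by simp
  \<comment> \<open>Replacing p - 1 by p/2 costs a factor 4 in the size of the family. Together with
    fibres of size 9 and the moment 3 p^6 this gives 4 * 9 * 3 = 108.\<close>
  have "real p * (real p / 2)\<^sup>2 \<le> real p * (real p - 1)\<^sup>2"
    using gt_2 by (intro mult_left_mono power_mono) auto
  also have "\<dots> = real (p * (p - 1)\<^sup>2)" using gt_2 by (simp add: of_nat_diff)
  also have "\<dots> \<le> real (card Par)" using cardP by (simp only: of_nat_le_iff)
  finally have "real p * (real p / 2)\<^sup>2 * T ^ 4 \<le> real (card Par) * T ^ 4"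
    by (rule mult_right_mono) simp
  with 1 have "real p * (real p / 2)\<^sup>2 * T ^ 4 \<le> 27 * real p ^ 6" by linarith
  moreover have "real p * (real p / 2)\<^sup>2 = real p ^ 3 / 4" by (simp add: power2_eq_square power3_eq_cube)
  moreover have "real p ^ 6 = real p ^ 3 * real p ^ 3" by (simp flip: power_add)
  ultimately have "real p ^ 3 / 4 * T ^ 4 \<le> 27 * (real p ^ 3 * real p ^ 3)" by (simp only:)
  then have "real p ^ 3 * T ^ 4 \<le> real p ^ 3 * (108 * real p ^ 3)" by linarith
  moreover have "real p ^ 3 > 0" using gt_2 by simp
  ultimately have "T ^ 4 \<le> 108 * real p ^ 3" by (rule mult_left_le_imp_le)
  then show ?thesis unfolding T_def .
qed

text \<open>Two incongruent roots can be moved to the first two places. If all three roots agree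
  modulo p, the cubic is a cube, its character is that of a linear polynomial, and the sum is
  zero.\<close>

lemma sum_chi_cubic:
  "(\<Sum>x\<in>Res. chi ((x - a) * (x - b) * (x - c))) ^ 4 \<le> 108 * real p ^ 3"
proof -
  consider "\<not> int p dvd a - b" | "\<not> int p dvd a - c" | "int p dvd a - b" "int p dvd a - c" by blast
  then show ?thesis
  proof cases
    case 2
    then show ?thesis using sum_chi_cubic_distinct[of a c b] by (simp add: mult_ac)
  next
    case 3
    have "chi ((x - a) * (x - b) * (x - c)) = chi (1 * x + (- a))" for x
    proof -
      have "[(x - a) * (x - b) * (x - c) = (x - a) * (x - a) * (x - a)] (mod int p)"
        using 3 by (intro cong_mult cong_diff) (auto simp: cong_iff_dvd_diff dvd_diff_commute)
      then have "chi ((x - a) * (x - b) * (x - c)) = chi (x - a) * chi (x - a) * chi (x - a)"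
        by (metis chi_cong chi_mult)
      also have "\<dots> = chi (x - a)"
        using chi_square[of "x - a"] chi_eq_0_iff[of "x - a"] by (cases "int p dvd x - a") auto
      finally show ?thesis by simp
    qed
    moreover have "\<not> int p dvd 1" using gt_2 by simp
    ultimately have "(\<Sum>x\<in>Res. chi ((x - a) * (x - b) * (x - c))) = 0"
      using sum_chi_affine[of 1 "-a"] by simp
    then show ?thesis by simp
  qed (rule sum_chi_cubic_distinct)
qed

lemma chi_1: "chi 1 = 1"
  using chi_square[of 1] chi_mult[of 1 1] gt_2 by simp

text \<open>The substitution $x = d + 1/y$ turns the quartic into a cubic.\<close>
lemma sum_chi_quartic_distinct:
  assumes d: "\<not> int p dvd d - a" "\<not> int p dvd d - b" "\<not> int p dvd d - c"
  shows "\<bar>\<Sum>x\<in>Res. chi ((x - a) * (x - b) * (x - c) * (x - d))\<bar> \<le> 5 * real p powr (3/4)"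
proof -
  have p0: "int p > 0" using gt_2 by simp
  \<comment> \<open>An inverse modulo p, specified only for arguments not divisible by p and
    arbitrary elsewhere; every use below is at such an argument.\<close>
  define rcp where "rcp = (\<lambda>h::int. SOME k. [h * k = 1] (mod int p))"
  have rcp: "[h * rcp h = 1] (mod int p)" if "\<not> int p dvd h" for h
  proof -
    have "coprime h (int p)" using that coprime_iff by simp
    then have "\<exists>k. [h * k = 1] (mod int p)" by (rule cong_solve_coprime_int)
    then show ?thesis unfolding rcp_def by (rule someI_ex)
  qed
  have rcp0: "\<not> int p dvd rcp h" if "\<not> int p dvd h" for h
  proof
    assume "int p dvd rcp h"
    then have "[h * rcp h = 0] (mod int p)" by (simp add: cong_0_iff)
    then have "[1 = 0] (mod int p)" using rcp[OF that] cong_sym cong_trans by blast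
    then show False using gt_2 by (simp add: cong_def)
  qed
  let ?R' = "{1..<int p}"
  have R': "\<not> int p dvd h" if "h \<in> ?R'" for h using that zdvd_imp_le[of "int p" h] by auto
  have bij: "bij_betw (\<lambda>h. rcp h mod int p) ?R' ?R'"
  proof -
    have sub: "(\<lambda>h. rcp h mod int p) ` ?R' \<subseteq> ?R'"
    proof
      fix y assume "y \<in> (\<lambda>h. rcp h mod int p) ` ?R'"
      then obtain h where h: "h \<in> ?R'" "y = rcp h mod int p" by blast
      have "y \<noteq> 0" using h rcp0[OF R'[OF h(1)]] by (simp add: dvd_eq_mod_eq_0)
      moreover have "0 \<le> y" "y < int p" using h p0 by auto
      ultimately show "y \<in> ?R'" by auto
    qed
    have "inj_on (\<lambda>h. rcp h mod int p) ?R'"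
    proof (rule inj_onI)
      fix h k assume hk: "h \<in> ?R'" "k \<in> ?R'" "rcp h mod int p = rcp k mod int p"
      then have c: "[rcp h = rcp k] (mod int p)" by (simp add: cong_def)
      have "[k * (h * rcp h) = k * 1] (mod int p)" by (intro cong_mult rcp R' hk) simp
      moreover have "[h * (k * rcp k) = h * 1] (mod int p)" by (intro cong_mult rcp R' hk) simp
      moreover have "[k * (h * rcp h) = h * (k * rcp k)] (mod int p)"
        using cong_mult[OF cong_refl[of "h*k"] c] by (simp add: mult_ac)
      ultimately have "[h = k] (mod int p)" by (metis cong_sym cong_trans mult_1_right)
      then show "h = k" using hk by (simp add: cong_def)
    qed
    then show ?thesis unfolding bij_betw_def using endo_inj_surj[OF _ sub] by simp
  qed
  define e where "e = (\<lambda>a. rcp (d - a))"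
  define C where "C = (d - a) * (d - b) * (d - c)"
  define T where "T = (\<Sum>y\<in>Res. chi ((y - (- e a)) * (y - (- e b)) * (y - (- e c))))"
  have "(\<Sum>x\<in>Res. chi ((x - a) * (x - b) * (x - c) * (x - d)))
      = (\<Sum>x\<in>Res. chi (((x + d) - a) * ((x + d) - b) * ((x + d) - c) * ((x + d) - d)))"
    by (rule sum_periodic_shift[OF p0, symmetric])
       (intro chi_cong cong_mult cong_diff, auto simp: cong_def)
  \<comment> \<open>After the shift the root d sits at 0, so the term that has no inverse vanishes
    by itself.\<close>
  also have "\<dots> = (\<Sum>x\<in>?R'. chi (((x + d) - a) * ((x + d) - b) * ((x + d) - c) * ((x + d) - d)))"
  proof (rule sum.mono_neutral_right)
    show "\<forall>x\<in>Res - ?R'. chi (((x + d) - a) * ((x + d) - b) * ((x + d) - c) * ((x + d) - d)) = 0"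
    proof
      fix x assume "x \<in> Res - ?R'"
      then have "x = 0" by auto
      then show "chi (((x + d) - a) * ((x + d) - b) * ((x + d) - c) * ((x + d) - d)) = 0"
        by (simp add: chi_eq_0_iff)
    qed
  qed auto
  also have "\<dots> = (\<Sum>x\<in>?R'. chi C * chi ((rcp x mod int p - (- e a)) * (rcp x mod int p - (- e b)) * (rcp x mod int p - (- e c))))"
  proof (intro sum.cong refl)
    fix x assume x: "x \<in> ?R'"
    define y where "y = rcp x mod int p"
    have xy: "[x * y = 1] (mod int p)"
      using rcp[OF R'[OF x]] unfolding y_def by (metis cong_def mod_mult_right_eq)
    have "y \<in> ?R'" using bij_betwE[OF bij] x unfolding y_def by blast
    then have y1: "chi y * chi y = 1" using chi_square R' by blast
    have *: "[(x + d - a) * y = (d - a) * (y - (- e a))] (mod int p)" if "\<not> int p dvd d - a" for a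
    proof -
      have "[x * y + (d - a) * y = (d - a) * e a + (d - a) * y] (mod int p)"
        using rcp[OF that] xy unfolding e_def by (intro cong_add) (metis cong_sym cong_trans, simp)
      then show ?thesis by (simp add: algebra_simps)
    qed
    \<comment> \<open>Since chi y is 1 or -1, four factors chi y can be inserted freely, one for
      each root. The factor for d becomes x y, which is 1 modulo p, and the other three become
      linear in y.\<close>
    have "chi (((x + d) - a) * ((x + d) - b) * ((x + d) - c) * ((x + d) - d))
       = (chi y * chi y) * (chi y * chi y) * chi (((x + d) - a) * ((x + d) - b) * ((x + d) - c) * ((x + d) - d))"
      by (simp add: y1)
    also have "\<dots> = chi (((x + d - a) * y) * ((x + d - b) * y) * ((x + d - c) * y) * (x * y))"
      by (simp add: chi_mult mult_ac)
    also have "\<dots> = chi (((d - a) * (y - (- e a))) * ((d - b) * (y - (- e b))) * ((d - c) * (y - (- e c))) * 1)"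
      by (intro chi_cong cong_mult * d xy)
    also have "\<dots> = chi C * chi ((y - (- e a)) * (y - (- e b)) * (y - (- e c)))"
      unfolding C_def by (simp add: chi_mult chi_1 mult_ac)
    finally show "chi (((x + d) - a) * ((x + d) - b) * ((x + d) - c) * ((x + d) - d)) =
        chi C * chi ((rcp x mod int p - (- e a)) * (rcp x mod int p - (- e b)) * (rcp x mod int p - (- e c)))"
      unfolding y_def .
  qed
  also have "\<dots> = chi C * (\<Sum>y\<in>?R'. chi ((y - (- e a)) * (y - (- e b)) * (y - (- e c))))"
    unfolding sum_distrib_left by (rule sum.reindex_bij_betw[OF bij])
  \<comment> \<open>The cubic sum needs y = 0 as well, and adding that term changes the value by at
    most 1.\<close>
  also have "(\<Sum>y\<in>?R'. chi ((y - (- e a)) * (y - (- e b)) * (y - (- e c)))) = T - chi (e a * e b * e c)"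
  proof -
    have "Res = insert 0 ?R'" using p0 by auto
    then show ?thesis unfolding T_def by simp
  qed
  finally have eq: "\<bar>\<Sum>x\<in>Res. chi ((x - a) * (x - b) * (x - c) * (x - d))\<bar> = \<bar>chi C\<bar> * \<bar>T - chi (e a * e b * e c)\<bar>"
    by (simp add: abs_mult)
  also have "\<dots> \<le> 1 * (\<bar>T\<bar> + 1)"
    using chi_abs_le_1[of C] chi_abs_le_1[of "e a * e b * e c"] by (intro mult_mono) auto
  finally have 1: "\<bar>\<Sum>x\<in>Res. chi ((x - a) * (x - b) * (x - c) * (x - d))\<bar> \<le> \<bar>T\<bar> + 1" by simp
  have "T ^ 4 \<le> 108 * real p ^ 3" unfolding T_def by (rule sum_chi_cubic)
  \<comment> \<open>Rounding 108 up to 4^4 makes the fourth root explicit. The extra 1 is at most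
    p^(3/4), which accounts for the constant 5.\<close>
  also have "\<dots> \<le> 256 * real p ^ 3" by simp
  also have "\<dots> = (4 * real p powr (3/4)) ^ 4"
    using gt_2 by (simp add: power_mult_distrib powr_power)
  finally have "\<bar>T\<bar> ^ 4 \<le> (4 * real p powr (3/4)) ^ 4" by simp
  then have "\<bar>T\<bar> \<le> 4 * real p powr (3/4)" by (rule power_le_imp_le_base[where n = 3, simplified]) simp
  moreover have "1 \<le> real p powr (3/4)" using gt_2 by (simp add: ge_one_powr_ge_zero)
  ultimately show ?thesis using 1 by linarith
qed

text \<open>If the four shifts do not pair up modulo p, one of them is incongruent to the other
  three. By symmetry that one can play the part of d.\<close>

lemma sum_chi_quartic:
  assumes "\<not> ([a = b] (mod int p) \<and> [c = d] (mod int p) \<or> [a = c] (mod int p) \<and> [b = d] (mod int p) \<or>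
              [a = d] (mod int p) \<and> [b = c] (mod int p))"
  shows "\<bar>\<Sum>x\<in>Res. chi ((x - a) * (x - b) * (x - c) * (x - d))\<bar> \<le> 5 * real p powr (3/4)"
proof -
  define N where "N = (\<lambda>x y. \<not> int p dvd x - y)"
  have sym: "N x y \<longleftrightarrow> N y x" for x y by (simp add: N_def dvd_diff_commute)
  have tr: "N x y \<Longrightarrow> N x z \<or> N z y" for x y z
    unfolding N_def by (metis cong_iff_dvd_diff cong_trans)
  have cN: "[x = y] (mod int p) \<longleftrightarrow> \<not> N x y" for x y by (simp add: N_def cong_iff_dvd_diff)
  consider "N d a" "N d b" "N d c" | "N c a" "N c b" "N c d" | "N b a" "N b c" "N b d" | "N a b" "N a c" "N a d"
    using assms sym tr unfolding cN by metis
  then show ?thesis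
  proof cases
    case 1 then show ?thesis using sum_chi_quartic_distinct[of d a b c] by (simp add: N_def)
  next
    case 2 then show ?thesis using sum_chi_quartic_distinct[of c a b d] by (simp add: N_def mult_ac)
  next
    case 3 then show ?thesis using sum_chi_quartic_distinct[of b a c d] by (simp add: N_def mult_ac)
  next
    case 4 then show ?thesis using sum_chi_quartic_distinct[of a b c d] by (simp add: N_def mult_ac)
  qed
qed

end

section \<open>The Jacobi symbol\<close>

lemma Jacobi_prime_mult:
  assumes "prime p" "m > 0"
  shows "Jacobi x (p * m) = Legendre x (int p) * Jacobi x m"
  using assms by (simp add: Jacobi_def prime_factorization_mult prime_factorization_prime)

lemma Jacobi_mod: "Jacobi (x mod int n) n = Jacobi x n"
proof -
  have "Legendre (x mod int n) (int p) = Legendre x (int p)" if "p \<in># prime_factorization n" for p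
  proof -
    have "int p dvd int n" using that by (simp add: in_prime_factors_imp_dvd)
    then have "x mod int n mod int p = x mod int p" by (rule mod_mod_cancel)
    then show ?thesis by (metis Legendre_mod)
  qed
  then show ?thesis unfolding Jacobi_def by (auto intro: arg_cong[where f = prod_mset] image_mset_cong)
qed

lemma Jacobi_mult:
  assumes "odd n"
  shows "Jacobi (x * y) n = Jacobi x n * Jacobi y n"
proof -
  have "Legendre (x * y) (int p) = Legendre x (int p) * Legendre y (int p)" if "p \<in># prime_factorization n" for p
  proof (rule Legendre_mult)
    show p: "prime p" using that by auto
    have "p dvd n" using that by (simp add: in_prime_factors_imp_dvd)
    then have "odd p" using assms by auto
    then show "p > 2" using p prime_ge_2_nat[of p] by (cases "p = 2") auto
  qed
  then have "Jacobi (x * y) n = (\<Prod>p\<in>#prime_factorization n. Legendre x (int p) * Legendre y (int p))"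
    unfolding Jacobi_def by (auto intro: arg_cong[where f = prod_mset] image_mset_cong)
  also have "\<dots> = Jacobi x n * Jacobi y n" unfolding Jacobi_def by (rule prod_mset.distrib)
  finally show ?thesis .
qed

lemma Jacobi_values: "Jacobi x n \<in> {-1, 0, 1}"
proof -
  have "(\<Prod>p\<in>#M. Legendre x (int p)) \<in> {-1, 0, 1}" for M
  proof (induction M)
    case (add q M)
    then show ?case using Legendre_values[of x "int q"] by auto
  qed simp
  then show ?thesis unfolding Jacobi_def .
qed

lemma Jacobi_eq_0_iff:
  assumes "n > 0"
  shows "Jacobi x n = 0 \<longleftrightarrow> \<not> coprime x (int n)"
proof -
  have "Jacobi x n = 0 \<longleftrightarrow> (\<exists>p\<in>prime_factors n. int p dvd x)"
    unfolding Jacobi_def by (auto simp: prod_mset_zero_iff Legendre_eq_0_iff image_iff)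
  also have "\<dots> \<longleftrightarrow> \<not> coprime x (int n)"
  proof
    assume "\<exists>p\<in>prime_factors n. int p dvd x"
    then obtain p where p: "prime p" "p dvd n" "int p dvd x" by (auto simp: in_prime_factors_iff)
    then have "\<not> is_unit (int p)" "int p dvd int n" by (auto simp: not_prime_unit)
    then show "\<not> coprime x (int n)" using p(3) not_coprimeI by blast
  next
    assume "\<not> coprime x (int n)"
    then have "gcd x (int n) \<noteq> 1" by (simp add: coprime_iff_gcd_eq_1)
    then have "nat (gcd x (int n)) \<noteq> 1" by auto
    then obtain p where p: "prime p" "p dvd nat (gcd x (int n))" using prime_factor_nat by blast
    then have "int p dvd gcd x (int n)" by (metis gcd_ge_0_int int_dvd_int_iff nat_0_le)
    then show "\<exists>p\<in>prime_factors n. int p dvd x"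
      using p assms by (auto simp: in_prime_factors_iff)
  qed
  finally show ?thesis .
qed

section \<open>Roots of unity, Parseval and Gauss sums\<close>

definition zeta :: "nat \<Rightarrow> int \<Rightarrow> complex" where
  "zeta N x = cis (2 * pi * of_int x / of_nat N)"

lemma zeta_add: "zeta N (x + y) = zeta N x * zeta N y"
  by (simp add: zeta_def cis_mult ring_distribs add_divide_distrib)

lemma zeta_0 [simp]: "zeta N 0 = 1"
  by (simp add: zeta_def)

lemma norm_zeta [simp]: "cmod (zeta N x) = 1"
  by (simp add: zeta_def)

lemma cnj_zeta: "cnj (zeta N x) = zeta N (- x)"
  by (simp add: zeta_def cis_cnj)

lemma zeta_power: "zeta N x ^ j = zeta N (x * int j)"
proof -
  have "zeta N x ^ j = cis (real j * (2 * pi * of_int x / of_nat N))" by (simp only: zeta_def Complex.DeMoivre)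
  also have "\<dots> = zeta N (x * int j)"
    unfolding zeta_def by (rule arg_cong[where f = cis]) (simp add: field_simps)
  finally show ?thesis .
qed

lemma zeta_diff: "zeta N (x - y) = zeta N x * cnj (zeta N y)"
  using zeta_add[of N x "-y"] by (simp add: cnj_zeta)

lemma zeta_double: "zeta (2 * N) (2 * x) = zeta N x"
  by (simp add: zeta_def mult.assoc)

lemma zeta_eq_1_iff:
  assumes "N > 0"
  shows "zeta N x = 1 \<longleftrightarrow> int N dvd x"
proof
  assume "int N dvd x"
  then obtain k where "x = int N * k" by blast
  then have "2 * pi * real_of_int x / real N = 2 * pi * of_int k" using assms by simp
  then show "zeta N x = 1" unfolding zeta_def by (simp add: cis_multiple_2pi)
next
  assume "zeta N x = 1"
  then have "cos (2 * pi * real_of_int x / real N) = 1" unfolding zeta_def by (metis cis.simps(1) one_complex.simps(1))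
  then obtain k :: int where "2 * pi * real_of_int x / real N = of_int k * 2 * pi" using cos_one_2pi_int by blast
  then have "real_of_int x = of_int k * real N" using assms by (simp add: field_simps)
  then have "x = k * int N" by (metis of_int_eq_iff of_int_mult of_int_of_nat_eq)
  then show "int N dvd x" by simp
qed

lemma zeta_cong:
  assumes "N > 0" "[x = y] (mod int N)"
  shows "zeta N x = zeta N y"
proof -
  have "zeta N (x - y) = 1" using assms by (simp add: zeta_eq_1_iff cong_iff_dvd_diff)
  then show ?thesis using zeta_add[of N "x - y" y] by simp
qed

lemma sum_zeta:
  assumes "N > 0"
  shows "(\<Sum>x\<in>{0..<int N}. zeta N (k * x)) = (if int N dvd k then of_nat N else 0)"
proof -
  have "(\<Sum>x\<in>{0..<int N}. zeta N (k * x)) = (\<Sum>j<N. zeta N k ^ j)"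
    by (simp add: sum_int_interval zeta_power)
  also have "\<dots> = (if int N dvd k then of_nat N else 0)"
  proof (cases "int N dvd k")
    case True
    then show ?thesis using assms by (simp add: zeta_eq_1_iff[THEN iffD2])
  next
    case False
    then have "zeta N k \<noteq> 1" using assms by (simp add: zeta_eq_1_iff)
    moreover have "zeta N k ^ N = 1" using assms by (simp add: zeta_power zeta_eq_1_iff)
    ultimately show ?thesis using False by (simp add: geometric_sum)
  qed
  finally show ?thesis .
qed

text \<open>Orthogonality of the additive characters: after squaring out, the sum over k leaves only
  the diagonal, because two representatives in one period are congruent only if they are
  equal.\<close>

lemma parseval_zeta:
  assumes "N > 0"
  shows "(\<Sum>k\<in>{0..<int N}. (cmod (\<Sum>j\<in>{0..<int N}. a j * zeta N (k * j)))\<^sup>2)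
       = real N * (\<Sum>j\<in>{0..<int N}. (cmod (a j))\<^sup>2)"
proof -
  let ?I = "{0..<int N}"
  have "complex_of_real (\<Sum>k\<in>?I. (cmod (\<Sum>j\<in>?I. a j * zeta N (k * j)))\<^sup>2)
     = (\<Sum>k\<in>?I. (\<Sum>i\<in>?I. a i * zeta N (k * i)) * (\<Sum>j\<in>?I. cnj (a j) * zeta N (k * - j)))"
    by (simp add: complex_norm_square cnj_zeta del: of_real_power)
  also have "\<dots> = (\<Sum>k\<in>?I. \<Sum>i\<in>?I. \<Sum>j\<in>?I. a i * cnj (a j) * zeta N ((i - j) * k))"
    unfolding sum_product
    by (intro sum.cong refl) (simp add: zeta_diff algebra_simps cnj_zeta)
  also have "\<dots> = (\<Sum>i\<in>?I. \<Sum>j\<in>?I. \<Sum>k\<in>?I. a i * cnj (a j) * zeta N ((i - j) * k))"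
    by (subst sum.swap) (intro sum.cong refl sum.swap)
  also have "\<dots> = (\<Sum>i\<in>?I. \<Sum>j\<in>?I. if j = i then a i * cnj (a j) * of_nat N else 0)"
  proof (intro sum.cong refl)
    fix i j assume ij: "i \<in> ?I" "j \<in> ?I"
    have "int N dvd i - j \<longleftrightarrow> j = i"
      using ij by (metis atLeastLessThan_iff mod_eq_dvd_iff mod_pos_pos_trivial)
    then show "(\<Sum>k\<in>?I. a i * cnj (a j) * zeta N ((i - j) * k)) = (if j = i then a i * cnj (a j) * of_nat N else 0)"
      unfolding sum_distrib_left[symmetric] sum_zeta[OF assms] by simp
  qed
  also have "\<dots> = (\<Sum>i\<in>?I. of_nat N * of_real ((cmod (a i))\<^sup>2))"
    by (simp add: complex_norm_square mult_ac del: of_real_power)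
  also have "\<dots> = complex_of_real (real N * (\<Sum>j\<in>?I. (cmod (a j))\<^sup>2))"
    by (simp add: sum_distrib_left)
  finally show ?thesis by (simp only: of_real_eq_iff)
qed

lemma poly_eq_sum_lessThan:
  fixes A :: "'a::comm_semiring_1 poly"
  assumes "\<And>j. j \<ge> N \<Longrightarrow> poly.coeff A j = 0"
  shows "poly A z = (\<Sum>j<N. poly.coeff A j * z ^ j)"
proof -
  have "poly A z = (\<Sum>j\<le>degree A. poly.coeff A j * z ^ j)" by (rule poly_altdef)
  also have "\<dots> = (\<Sum>j\<in>{..degree A} \<union> {..<N}. poly.coeff A j * z ^ j)"
    by (rule sum.mono_neutral_left) (auto simp: coeff_eq_0)
  also have "\<dots> = (\<Sum>j<N. poly.coeff A j * z ^ j)"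
    by (rule sum.mono_neutral_right) (auto simp: assms)
  finally show ?thesis .
qed

lemma poly_zeta:
  assumes "\<And>j. j \<ge> N \<Longrightarrow> poly.coeff A j = 0"
  shows "poly A (zeta M k) = (\<Sum>j\<in>{0..<int N}. poly.coeff A (nat j) * zeta M (k * j))"
  by (simp add: poly_eq_sum_lessThan[OF assms] sum_int_interval zeta_power)

lemma parseval_poly_zeta:
  assumes "\<And>j. j \<ge> N \<Longrightarrow> poly.coeff A j = 0" "N > 0"
  shows "(\<Sum>k\<in>{0..<int N}. (cmod (poly A (zeta N k)))\<^sup>2) = real N * (\<Sum>j<N. (cmod (poly.coeff A j))\<^sup>2)"
proof -
  have "(\<Sum>k\<in>{0..<int N}. (cmod (poly A (zeta N k)))\<^sup>2)
     = (\<Sum>k\<in>{0..<int N}. (cmod (\<Sum>j\<in>{0..<int N}. poly.coeff A (nat j) * zeta N (k * j)))\<^sup>2)"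
    by (intro sum.cong refl arg_cong[where f = "\<lambda>x. (cmod x)\<^sup>2"] poly_zeta assms(1))
  also have "\<dots> = real N * (\<Sum>j\<in>{0..<int N}. (cmod (poly.coeff A (nat j)))\<^sup>2)"
    by (rule parseval_zeta[OF assms(2)])
  finally show ?thesis by (simp add: sum_int_interval)
qed

lemma has_integral_cis_int:
  "((\<lambda>t. cis (of_int m * t)) has_integral (if m = 0 then 2 * pi else 0)) {0..2*pi}"
proof (cases "m = 0")
  case True
  then show ?thesis using has_integral_const_real[of "1::complex" 0 "2*pi"] by (simp add: scaleR_conv_of_real)
next
  case False
  have "((\<lambda>t. cis (of_int m * t)) has_integral
     (cis (of_int m * (2*pi)) / (\<i> * of_int m) - cis (of_int m * 0) / (\<i> * of_int m))) {0..2*pi}"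
  proof (rule fundamental_theorem_of_calculus)
    fix t assume "t \<in> {0..2*pi}"
    have "((\<lambda>t. exp (\<i> * of_int m * of_real t) / (\<i> * of_int m)) has_vector_derivative exp (\<i> * of_int m * of_real t)) (at t within {0..2*pi})"
      using False by (auto intro!: derivative_eq_intros has_vector_derivative_real_field simp: field_simps)
    moreover have "exp (\<i> * of_int m * of_real t) = cis (of_int m * t)" for t by (simp add: cis_conv_exp mult_ac)
    ultimately show "((\<lambda>t. cis (of_int m * t) / (\<i> * of_int m)) has_vector_derivative cis (of_int m * t)) (at t within {0..2*pi})"
      by simp
  qed simp
  moreover have "cis (of_int m * (2*pi)) = 1" using cis_multiple_2pi[of "of_int m"] by (simp add: mult_ac)
  ultimately show ?thesis using False by simp
qed

lemma parseval_poly_integral: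
  assumes "\<And>j. j \<ge> N \<Longrightarrow> poly.coeff A j = 0"
  shows "((\<lambda>t. (cmod (poly A (cis t)))\<^sup>2) has_integral (2 * pi * (\<Sum>j<N. (cmod (poly.coeff A j))\<^sup>2))) {0..2*pi}"
proof -
  let ?a = "poly.coeff A"
  have eq: "complex_of_real ((cmod (poly A (cis t)))\<^sup>2) = (\<Sum>i<N. \<Sum>j<N. ?a i * cnj (?a j) * cis (of_int (int i - int j) * t))" for t
  proof -
    have "complex_of_real ((cmod (poly A (cis t)))\<^sup>2) = (\<Sum>i<N. ?a i * cis t ^ i) * cnj (\<Sum>j<N. ?a j * cis t ^ j)"
      by (simp add: complex_norm_square poly_eq_sum_lessThan[OF assms] del: of_real_power)
    also have "\<dots> = (\<Sum>i<N. \<Sum>j<N. (?a i * cnj (?a j)) * (cis t ^ i * cnj (cis t ^ j)))"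
      unfolding cnj_sum sum_product by (intro sum.cong refl) (simp only: complex_cnj_mult mult_ac)
    also have "\<dots> = (\<Sum>i<N. \<Sum>j<N. ?a i * cnj (?a j) * cis (of_int (int i - int j) * t))"
    proof (intro sum.cong refl arg_cong2[where f = "(*)"])
      fix i j
      have "cis t ^ i * cnj (cis t ^ j) = cis (real i * t + - (real j * t))"
        by (simp only: Complex.DeMoivre cis_cnj cis_mult)
      also have "real i * t + - (real j * t) = of_int (int i - int j) * t" by (simp add: algebra_simps)
      finally show "cis t ^ i * cnj (cis t ^ j) = cis (of_int (int i - int j) * t)" .
    qed
    finally show ?thesis .
  qed
  have "((\<lambda>t. \<Sum>i<N. \<Sum>j<N. ?a i * cnj (?a j) * cis (of_int (int i - int j) * t)) has_integral
      (\<Sum>i<N. \<Sum>j<N. ?a i * cnj (?a j) * (if int i - int j = 0 then 2 * pi else 0))) {0..2*pi}"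
    by (intro has_integral_sum has_integral_mult_right has_integral_cis_int) auto
  also have "(\<Sum>i<N. \<Sum>j<N. ?a i * cnj (?a j) * (if int i - int j = 0 then 2 * pi else 0)) = (\<Sum>i<N. ?a i * cnj (?a i) * (2 * pi))"
    by (intro sum.cong refl) (simp add: if_distrib[of "\<lambda>x. _ * x"] if_distrib[of complex_of_real] cong: if_cong)
  also have "\<dots> = complex_of_real (2 * pi * (\<Sum>j<N. (cmod (?a j))\<^sup>2))"
    by (simp add: complex_norm_square sum_distrib_left mult_ac del: of_real_power)
  finally have "((\<lambda>t. complex_of_real ((cmod (poly A (cis t)))\<^sup>2)) has_integral complex_of_real (2 * pi * (\<Sum>j<N. (cmod (?a j))\<^sup>2))) {0..2*pi}"
    unfolding eq .
  from has_integral_Re[OF this] show ?thesis by simp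
qed

lemma Lnorm_2_power_4:
  assumes "\<And>j. j \<ge> N \<Longrightarrow> poly.coeff A j = 0"
  shows "Lnorm 2 A ^ 4 = (\<Sum>j<N. (cmod (poly.coeff A j))\<^sup>2)\<^sup>2"
proof -
  let ?S = "\<Sum>j<N. (cmod (poly.coeff A j))\<^sup>2"
  have "?S \<ge> 0" by (simp add: sum_nonneg)
  have "Lnorm 2 A = ?S powr (1/2)"
    unfolding Lnorm_def using integral_unique[OF parseval_poly_integral[OF assms]] by (simp add: field_simps)
  then have "Lnorm 2 A = sqrt ?S" using \<open>?S \<ge> 0\<close> by (simp add: powr_half_sqrt)
  then have "Lnorm 2 A ^ 4 = ((sqrt ?S)\<^sup>2)\<^sup>2" by simp
  then show ?thesis using \<open>?S \<ge> 0\<close> by simp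
qed

lemma coeff_square_eq_0:
  fixes A :: "'a::comm_semiring_1 poly"
  assumes "\<And>j. j \<ge> N \<Longrightarrow> poly.coeff A j = 0"
  shows "j \<ge> 2 * N \<Longrightarrow> poly.coeff (A * A) j = 0"
proof -
  assume j: "j \<ge> 2 * N"
  have "poly.coeff A i * poly.coeff A (j - i) = 0" for i
    using j assms[of i] assms[of "j - i"] by (cases "i \<ge> N") auto
  then show ?thesis unfolding coeff_mult by (simp only: sum.neutral_const)
qed

lemma Lnorm_4_power_4_coeff:
  assumes "\<And>j. j \<ge> N \<Longrightarrow> poly.coeff A j = 0"
  shows "Lnorm 4 A ^ 4 = (\<Sum>j<2*N. (cmod (poly.coeff (A * A) j))\<^sup>2)"
proof -
  let ?S = "\<Sum>j<2*N. (cmod (poly.coeff (A * A) j))\<^sup>2"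
  have S: "?S \<ge> 0" by (simp add: sum_nonneg)
  have "cmod (poly A z) powr 4 = (cmod (poly (A * A) z))\<^sup>2" for z
    by (simp add: norm_mult power2_eq_square power4_eq_xxxx mult_ac)
  then have "Lnorm 4 A = ?S powr (1/4)"
    unfolding Lnorm_def using integral_unique[OF parseval_poly_integral[OF coeff_square_eq_0[OF assms]]]
    by (simp add: field_simps)
  \<comment> \<open>The zero case is separate because the power law for \<open>powr\<close> is
    applied to a positive base; for base 0 both sides are 0.\<close>
  then show ?thesis using S by (cases "?S = 0") (simp_all add: powr_power)
qed

lemma Lnorm_4_power_4:
  assumes "\<And>j. j \<ge> N \<Longrightarrow> poly.coeff A j = 0" "N > 0"
  shows "Lnorm 4 A ^ 4 = (\<Sum>k\<in>{0..<int (2*N)}. cmod (poly A (zeta (2*N) k)) ^ 4) / (2 * real N)"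
proof -
  have "(\<Sum>k\<in>{0..<int (2*N)}. cmod (poly A (zeta (2*N) k)) ^ 4) = (\<Sum>k\<in>{0..<int (2*N)}. (cmod (poly (A * A) (zeta (2*N) k)))\<^sup>2)"
    by (simp add: norm_mult power2_eq_square power4_eq_xxxx mult_ac)
  also have "\<dots> = real (2*N) * Lnorm 4 A ^ 4"
  proof -
    have "(\<Sum>k\<in>{0..<int (2*N)}. (cmod (poly (A * A) (zeta (2*N) k)))\<^sup>2) = real (2*N) * (\<Sum>j<2*N. (cmod (poly.coeff (A * A) j))\<^sup>2)"
      by (rule parseval_poly_zeta[OF coeff_square_eq_0[OF assms(1)]]) (use assms(2) in auto)
    then show ?thesis by (simp only: Lnorm_4_power_4_coeff[of N A, OF assms(1)])
  qed
  finally show ?thesis using assms(2) by simp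
qed

lemma sum_even_odd:
  fixes F :: "int \<Rightarrow> 'a::comm_monoid_add"
  shows "(\<Sum>k\<in>{0..<int (2*N)}. F k) = (\<Sum>m\<in>{0..<int N}. F (2*m)) + (\<Sum>m\<in>{0..<int N}. F (2*m+1))"
proof -
  have "(\<Sum>k\<in>{0..<int (2*N)}. F k) = (\<Sum>k\<in>{k\<in>{0..<int (2*N)}. even k}. F k) + (\<Sum>k\<in>{k\<in>{0..<int (2*N)}. odd k}. F k)"
    by (subst sum.union_disjoint[symmetric]) (auto intro!: sum.cong finite_subset[of _ "{0..<int (2*N)}"])
  also have "(\<Sum>k\<in>{k\<in>{0..<int (2*N)}. even k}. F k) = (\<Sum>m\<in>{0..<int N}. F (2*m))"
    by (rule sum.reindex_bij_witness[of _ "\<lambda>m. 2*m" "\<lambda>k. k div 2"]) auto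
  also have "(\<Sum>k\<in>{k\<in>{0..<int (2*N)}. odd k}. F k) = (\<Sum>m\<in>{0..<int N}. F (2*m+1))"
    by (rule sum.reindex_bij_witness[of _ "\<lambda>m. 2*m+1" "\<lambda>k. k div 2"]) auto
  finally show ?thesis .
qed

section \<open>Gauss sums of the Jacobi symbol\<close>

locale odd_squarefree =
  fixes n :: nat
  assumes n_gt_1: "n > 1" and odd_n: "odd n" and sqfree: "squarefree n"
begin

abbreviation "Res \<equiv> {0..<int n}"

definition J :: "int \<Rightarrow> complex" where "J x = of_int (Jacobi x n)"

definition G :: complex where "G = (\<Sum>x\<in>Res. J x * zeta n x)"

lemma n_pos: "n > 0" and n_pos_int: "int n > 0"
  using n_gt_1 by auto

lemma J_mod: "J (x mod int n) = J x"
  by (simp add: J_def Jacobi_mod)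

lemma J_mult: "J (x * y) = J x * J y"
  by (simp add: J_def Jacobi_mult odd_n)

lemma J_eq_0_iff: "J x = 0 \<longleftrightarrow> \<not> coprime x (int n)"
  by (simp add: J_def Jacobi_eq_0_iff n_pos)

lemma J_square: "coprime x (int n) \<Longrightarrow> J x * J x = 1"
  using Jacobi_values[of x n] Jacobi_eq_0_iff[of n x] n_pos by (auto simp: J_def)

lemma J_1: "J 1 = 1"
  using J_square[of 1] J_mult[of 1 1] by simp

lemma zeta_mult_mod: "zeta n (k * (x mod int n)) = zeta n (k * x)"
  by (intro zeta_cong n_pos cong_mult) (auto simp: cong_def)

lemma prime_divisor_cases:
  assumes "prime p" "p dvd n"
  obtains m where "n = p * m" "m > 0" "coprime p m" "p > 2"
proof -
  obtain m where m: "n = p * m" using assms by blast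
  have "coprime p m"
  proof -
    have "\<not> p dvd m"
    proof
      assume "p dvd m"
      then have "p ^ 2 dvd n" using m by (auto simp: power2_eq_square)
      then show False using sqfree assms(1) unfolding squarefree_def by (metis not_prime_unit)
    qed
    then show ?thesis using assms(1) prime_imp_coprime by blast
  qed
  moreover have "odd p" using assms odd_n by auto
  then have "p > 2" using prime_ge_2_nat[OF assms(1)] by (cases "p = 2") auto
  moreover have "m > 0" using m n_pos by (cases m) auto
  ultimately show ?thesis using that m by blast
qed

text \<open>For k prime to n the substitution of k x for x pulls out the symbol. Otherwise the sum
  has to vanish: some unit d has symbol -1 but leaves the additive character at k unchanged, so the
  sum equals its own negative. Square-freeness is what provides such a d.\<close>

lemma Gauss_sum: "(\<Sum>x\<in>Res. J x * zeta n (k * x)) = J k * G"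
proof (cases "coprime k (int n)")
  case True
  have "J k * (\<Sum>x\<in>Res. J x * zeta n (k * x)) = (\<Sum>x\<in>Res. J (k * x + 0) * zeta n (1 * (k * x + 0)))"
    by (simp add: J_mult sum_distrib_left mult_ac)
  also have "\<dots> = (\<Sum>x\<in>Res. J x * zeta n (1 * x))"
    by (rule sum_periodic_affine[OF n_pos_int True, where F = "\<lambda>x. J x * zeta n (1 * x)"])
       (simp only: J_mod zeta_mult_mod)
  finally have "J k * (\<Sum>x\<in>Res. J x * zeta n (k * x)) = G" by (simp add: G_def)
  then have "J k * G = (J k * J k) * (\<Sum>x\<in>Res. J x * zeta n (k * x))" by (simp only: mult.assoc)
  then show ?thesis using J_square[OF True] by simp
next
  case False
  have "gcd k (int n) \<noteq> 1" using False by (simp add: coprime_iff_gcd_eq_1)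
  then have "nat (gcd k (int n)) \<noteq> 1" by auto
  then obtain p where p: "prime p" "p dvd nat (gcd k (int n))" using prime_factor_nat by blast
  then have pg: "int p dvd gcd k (int n)" by (metis gcd_ge_0_int int_dvd_int_iff nat_0_le)
  then have pk: "int p dvd k" and "p dvd n" by auto
  then obtain m where m: "n = p * m" "m > 0" "coprime p m" "p > 2" using prime_divisor_cases p(1) by blast
  obtain v where v: "Legendre v (int p) = -1" using ex_quadratic_nonresidue p(1) m(4) by blast
  \<comment> \<open>A nonresidue modulo a common prime p of k and n, and 1 modulo n/p. The first
    condition makes the symbol -1; the second, with p dividing k, makes n divide k (d - 1).\<close>
  obtain d where d: "[d = v] (mod int p)" "[d = 1] (mod int m)"
    using binary_chinese_remainder_int[of "int p" "int m" v 1] m(3) by auto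
  have "Jacobi d m = Jacobi 1 m" using d(2) by (metis Jacobi_mod cong_def)
  moreover have "Jacobi 1 m = 1"
  proof -
    have "odd m" using odd_n m by auto
    then have "Jacobi 1 m = Jacobi 1 m * Jacobi 1 m" using Jacobi_mult[of m 1 1] by simp
    moreover have "Jacobi 1 m \<noteq> 0" using Jacobi_eq_0_iff[of m 1] m(2) by simp
    ultimately show ?thesis by simp
  qed
  moreover have "Legendre d (int p) = -1" using v d(1) by (metis Legendre_mod cong_def)
  ultimately have Jd: "J d = -1" using Jacobi_prime_mult[OF p(1) m(2)] by (simp add: J_def flip: m(1))
  then have cd: "coprime d (int n)" using J_eq_0_iff[of d] by auto
  have kd: "zeta n (k * (d * x)) = zeta n (k * x)" for x
  proof (rule zeta_cong[OF n_pos])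
    have "int p * int m dvd k * (d - 1)" using pk d(2) by (intro mult_dvd_mono) (auto simp: cong_iff_dvd_diff)
    then have "int n dvd k * (d - 1) * x" using m(1) by simp
    then show "[k * (d * x) = k * x] (mod int n)" by (simp add: cong_iff_dvd_diff algebra_simps)
  qed
  have "(\<Sum>x\<in>Res. J x * zeta n (k * x)) = (\<Sum>x\<in>Res. J (d * x + 0) * zeta n (k * (d * x + 0)))"
    by (rule sum_periodic_affine[OF n_pos_int cd, where F = "\<lambda>x. J x * zeta n (k * x)", symmetric])
       (simp only: J_mod zeta_mult_mod)
  also have "\<dots> = - (\<Sum>x\<in>Res. J x * zeta n (k * x))"
    by (simp add: J_mult Jd kd sum_negf)
  finally have "(\<Sum>x\<in>Res. J x * zeta n (k * x)) = 0" by simp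
  then show ?thesis using J_eq_0_iff False by simp
qed

lemma norm_J: "(cmod (J x))\<^sup>2 = (if coprime x (int n) then 1 else 0)"
  using Jacobi_values[of x n] Jacobi_eq_0_iff[of n x] n_pos by (auto simp: J_def)

text \<open>By \<open>Gauss_sum\<close> the discrete Fourier transform of J is G times J itself.
  Parseval then compares the same positive sum of squares on both sides.\<close>

lemma norm_G: "(cmod G)\<^sup>2 = real n"
proof -
  let ?S = "\<Sum>x\<in>Res. (cmod (J x))\<^sup>2"
  have "(cmod (J 1))\<^sup>2 \<le> ?S" using n_gt_1 by (intro member_le_sum) auto
  then have "?S > 0" by (simp add: J_1)
  have "(cmod G)\<^sup>2 * ?S = (\<Sum>k\<in>Res. (cmod (\<Sum>x\<in>Res. J x * zeta n (k * x)))\<^sup>2)"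
    unfolding Gauss_sum by (simp add: norm_mult power_mult_distrib sum_distrib_left mult_ac)
  also have "\<dots> = real n * ?S" by (rule parseval_zeta[OF n_pos])
  finally show ?thesis using \<open>?S > 0\<close> by simp
qed

end

section \<open>The interpolation kernel\<close>

text \<open>Up to pi/3 the difference is nondecreasing, since cos is at least 1/2 there. Beyond that
  y/2 is at most pi/4, which is already below sin(pi/3).\<close>

lemma sin_ge_half:
  assumes "0 \<le> y" "y \<le> pi / 2"
  shows "y / 2 \<le> sin y"
proof (cases "y \<le> pi / 3")
  case True
  have "sin 0 - 0 / 2 \<le> sin y - y / 2"
  proof (rule DERIV_nonneg_imp_nondecreasing[OF assms(1)])
    fix x assume x: "0 \<le> x" "x \<le> y"
    have "((\<lambda>x. sin x - x / 2) has_real_derivative cos x - 1 / 2) (at x)"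
      by (auto intro!: derivative_eq_intros)
    moreover have "cos x \<ge> cos (pi / 3)" using x True by (intro cos_monotone_0_pi_le) auto
    ultimately show "\<exists>d. ((\<lambda>x. sin x - x / 2) has_real_derivative d) (at x) \<and> 0 \<le> d"
      by (auto simp: cos_60)
  qed
  then show ?thesis by simp
next
  case False
  have "y / 2 \<le> pi / 4" using assms by simp
  also have "\<dots> \<le> 173/100/2" using pi_approx by simp
  also have "(173/100::real) \<le> sqrt 3" by (rule real_le_rsqrt) (simp add: power2_eq_square)
  then have "173/100/2 \<le> sin (pi / 3)" by (simp add: sin_60)
  also have "sin (pi / 3) \<le> sin y" using False assms by (intro sin_monotone_2pi_le) auto
  finally show ?thesis .
qed

text \<open>A crude bound chosen for its shape: it is symmetric about 1/2, and its reciprocal splits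
  into the partial fractions 1/x + 1/(1 - x).\<close>

lemma sin_pi_ge:
  assumes "0 \<le> x" "x \<le> 1"
  shows "x * (1 - x) \<le> sin (pi * x)"
proof -
  have *: "x * (1 - x) \<le> sin (pi * x)" if "0 \<le> x" "x \<le> 1/2" for x
  proof -
    have "x * (1 - x) \<le> x" using that by (simp add: mult_left_le)
    also have "x \<le> pi * x / 2" using mult_right_mono[of 2 pi x] that pi_gt3 by simp
    also have "\<dots> \<le> sin (pi * x)" using that by (intro sin_ge_half) auto
    finally show ?thesis .
  qed
  show ?thesis
  proof (cases "x \<le> 1/2")
    case False
    have "(1 - x) * (1 - (1 - x)) \<le> sin (pi * (1 - x))" using False assms by (intro *) auto
    also have "sin (pi * (1 - x)) = sin (pi * x)" by (simp add: right_diff_distrib sin_diff)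
    finally show ?thesis by (simp add: mult_ac)
  qed (use * assms in auto)
qed

lemma norm_one_minus_cis: "cmod (1 - cis t) = 2 * \<bar>sin (t / 2)\<bar>"
proof -
  have "(cmod (1 - cis t))\<^sup>2 = (1 - cos t)\<^sup>2 + (sin t)\<^sup>2" by (simp add: cmod_power2)
  also have "\<dots> = 2 - 2 * cos t" using sin_cos_squared_add[of t] by (simp add: power2_diff)
  also have "\<dots> = (2 * \<bar>sin (t / 2)\<bar>)\<^sup>2" using cos_double_sin[of "t/2"] by (simp add: power_mult_distrib)
  finally show ?thesis by (rule power2_eq_imp_eq) auto
qed

context odd_squarefree
begin

text \<open>Half-integer Dirichlet kernel: interpolates a polynomial of degree less than \<open>n\<close> from the
  \<open>n\<close>-th roots of unity to the remaining \<open>2n\<close>-th roots of unity.\<close>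
definition W :: "int \<Rightarrow> complex" where
  "W u = (\<Sum>j\<in>Res. zeta (2*n) ((2*u+1) * j)) / of_nat n"

text \<open>The phase carries the rotation by s. It is invisible in absolute values and enters the
  main term only through the sum of squares of the weights.\<close>

definition w :: "int \<Rightarrow> int \<Rightarrow> complex" where
  "w s u = zeta n (s * u) * W u"

lemma norm_w: "cmod (w s u) = cmod (W u)"
  by (simp add: w_def norm_mult)

lemma zeta_2n_cong: "[x = y] (mod int n) \<Longrightarrow> zeta (2*n) (2*x) = zeta (2*n) (2*y)"
  using zeta_double zeta_cong n_pos by simp

lemma W_mod: "W (u mod int n) = W u"
proof -
  have "zeta (2*n) ((2*(u mod int n)+1) * j) = zeta (2*n) ((2*u+1) * j)" for j
  proof -
    have "zeta (2*n) (2*((u mod int n) * j)) = zeta (2*n) (2*(u*j))"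
      by (rule zeta_2n_cong) (auto simp: cong_def mod_mult_left_eq)
    then have "zeta (2*n) (2*((u mod int n) * j)) * zeta (2*n) j = zeta (2*n) (2*(u*j)) * zeta (2*n) j" by simp
    then show ?thesis by (simp add: zeta_add[symmetric] algebra_simps)
  qed
  then show ?thesis by (simp add: W_def)
qed

lemma W_eq_dft: "W u = (\<Sum>j\<in>Res. (zeta (2*n) j / of_nat n) * zeta n (u * j))"
proof -
  have "zeta (2*n) ((2*u+1) * j) = zeta (2*n) j * zeta n (u * j)" for j
    unfolding zeta_double[of n "u*j", symmetric] by (simp add: zeta_add[symmetric] algebra_simps)
  then show ?thesis unfolding W_def sum_divide_distrib by simp
qed

lemma sum_norm_W_2: "(\<Sum>u\<in>Res. (cmod (W u))\<^sup>2) = 1"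
proof -
  have "(\<Sum>u\<in>Res. (cmod (W u))\<^sup>2) = real n * (\<Sum>j\<in>Res. (cmod (zeta (2*n) j / of_nat n))\<^sup>2)"
    unfolding W_eq_dft by (rule parseval_zeta[OF n_pos])
  also have "\<dots> = 1" using n_pos by (simp add: norm_divide power2_eq_square)
  finally show ?thesis .
qed

text \<open>\<open>W u\<close> is a geometric sum with ratio z and z^n = -1, so its modulus is
  exactly 1/(n sin(pi x)) with x = (2u+1)/(2n). The bound then follows from
  \<open>sin_pi_ge\<close>: the two terms measure the distance of u to the two ends of the
  period.\<close>

lemma norm_W_le:
  assumes "u \<in> Res"
  shows "cmod (W u) \<le> 2 / (2 * real_of_int u + 1) + 2 / (2 * real_of_int (int n - 1 - u) + 1)"
proof -
  define x where "x = (2 * real_of_int u + 1) / (2 * real n)"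
  have x: "0 < x" "x < 1"
  proof -
    have "real_of_int u \<le> real n - 1" using assms by auto
    then show "x < 1" using n_pos by (simp add: x_def field_simps)
    show "0 < x" using assms n_pos by (simp add: x_def field_simps)
  qed
  define z where "z = zeta (2*n) (2*u+1)"
  have z1: "z \<noteq> 1"
  proof -
    have "\<not> int (2*n) dvd 2*u+1"
      by (metis dvd_trans dvd_triv_left even_plus_one_iff dvd_mult_left of_nat_mult of_nat_numeral)
    then show ?thesis unfolding z_def using n_pos zeta_eq_1_iff[of "2*n" "2*u+1"] by simp
  qed
  have zn: "z ^ n = -1"
  proof -
    have "z ^ n = zeta (2*n) (2*(u * int n)) * zeta (2*n) (int n)"
      unfolding z_def by (simp add: zeta_power zeta_add[symmetric] algebra_simps)
    also have "zeta (2*n) (2*(u * int n)) = 1" unfolding zeta_double using n_pos by (simp add: zeta_eq_1_iff)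
    also have "zeta (2*n) (int n) = -1" using n_pos by (simp add: zeta_def)
    finally show ?thesis by simp
  qed
  have "W u = (\<Sum>j<n. z ^ j) / of_nat n"
    unfolding W_def z_def by (simp add: sum_int_interval zeta_power)
  also have "(\<Sum>j<n. z ^ j) = 2 / (1 - z)"
    using z1 by (simp add: sum_gp_strict zn)
  finally have "cmod (W u) = 2 / cmod (1 - z) / real n" by (simp add: norm_divide norm_mult)
  also have "cmod (1 - z) = 2 * sin (pi * x)"
  proof -
    have "2 * pi * real_of_int (2*u+1) / real (2*n) / 2 = pi * x" using n_pos by (simp add: x_def field_simps)
    then have "cmod (1 - z) = 2 * \<bar>sin (pi * x)\<bar>"
      unfolding z_def zeta_def norm_one_minus_cis by (simp only:)
    moreover have "sin (pi * x) \<ge> 0" using sin_pi_ge[of x] x by (smt (verit) mult_nonneg_nonneg)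
    ultimately show ?thesis by simp
  qed
  finally have "cmod (W u) = 1 / (real n * sin (pi * x))" by (simp add: mult_ac)
  also have "\<dots> \<le> 1 / (real n * (x * (1 - x)))"
    using sin_pi_ge[of x] x n_pos by (intro divide_left_mono mult_left_mono mult_pos_pos) (auto intro: less_le_trans[of 0 "x * (1 - x)"])
  also have "\<dots> = 1 / (real n * x) + 1 / (real n * (1 - x))"
    using x n_pos by (simp add: field_simps)
  also have "real n * x = (2 * real_of_int u + 1) / 2" using n_pos by (simp add: x_def field_simps)
  also have "real n * (1 - x) = (2 * real_of_int (int n - 1 - u) + 1) / 2" using n_pos by (simp add: x_def field_simps)
  finally show ?thesis by simp
qed

text \<open>Summing over u forces i + j to be t or t + n. Adding n to the argument of a 2n-th root
  of unity changes its sign, so the t + 1 indices i up to t count positively and the other n - t - 1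
  negatively, for a total of 2t + 2 - n.\<close>

lemma sum_w_square:
  fixes s :: int
  defines "t \<equiv> (- (2 * s)) mod int n"
  shows "cmod (\<Sum>u\<in>Res. (w s u)\<^sup>2) = \<bar>2 * real_of_int t + 2 - real n\<bar> / real n"
proof -
  have t: "t \<in> Res" using n_pos by (simp add: t_def)
  have "(\<Sum>u\<in>Res. (w s u)\<^sup>2) = (\<Sum>u\<in>Res. \<Sum>i\<in>Res. \<Sum>j\<in>Res. (zeta (2*n) (i + j) / (of_nat n)\<^sup>2) * zeta n ((2 * s + i + j) * u))"
  proof (intro sum.cong refl)
    fix u
    have "(w s u)\<^sup>2 = zeta n (2 * s * u) * ((\<Sum>i\<in>Res. (zeta (2*n) i / of_nat n) * zeta n (u * i)) * (\<Sum>j\<in>Res. (zeta (2*n) j / of_nat n) * zeta n (u * j)))"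
      unfolding w_def W_eq_dft by (simp add: power2_eq_square zeta_add[symmetric] mult_ac)
    also have "\<dots> = (\<Sum>i\<in>Res. \<Sum>j\<in>Res. (zeta (2*n) (i + j) / (of_nat n)\<^sup>2) * zeta n ((2 * s + i + j) * u))"
      unfolding sum_product unfolding sum_distrib_left
      by (intro sum.cong refl) (simp add: zeta_add ring_distribs power2_eq_square mult_ac)
    finally show "(w s u)\<^sup>2 = (\<Sum>i\<in>Res. \<Sum>j\<in>Res. (zeta (2*n) (i + j) / (of_nat n)\<^sup>2) * zeta n ((2 * s + i + j) * u))" .
  qed
  also have "\<dots> = (\<Sum>i\<in>Res. \<Sum>j\<in>Res. \<Sum>u\<in>Res. (zeta (2*n) (i + j) / (of_nat n)\<^sup>2) * zeta n ((2 * s + i + j) * u))"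
    by (subst sum.swap) (intro sum.cong refl sum.swap)
  also have "\<dots> = (\<Sum>i\<in>Res. \<Sum>j\<in>Res. if j = (t - i) mod int n then zeta (2*n) (i + j) / of_nat n else 0)"
  proof (intro sum.cong refl)
    fix i j assume ij: "i \<in> Res" "j \<in> Res"
    have "int n dvd 2 * s + i + j \<longleftrightarrow> j = (t - i) mod int n"
    proof -
      have "int n dvd 2 * s + i + j \<longleftrightarrow> [j = - (2 * s) - i] (mod int n)" by (simp add: cong_iff_dvd_diff algebra_simps)
      also have "\<dots> \<longleftrightarrow> j = (- (2 * s) - i) mod int n" using ij by (simp add: cong_def)
      also have "(- (2 * s) - i) mod int n = (t - i) mod int n" by (simp only: t_def mod_diff_left_eq)
      finally show ?thesis .
    qed
    then show "(\<Sum>u\<in>Res. (zeta (2*n) (i + j) / (of_nat n)\<^sup>2) * zeta n ((2 * s + i + j) * u))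
       = (if j = (t - i) mod int n then zeta (2*n) (i + j) / of_nat n else 0)"
      unfolding sum_distrib_left[symmetric] sum_zeta[OF n_pos] using n_pos by (simp add: power2_eq_square)
  qed
  also have "\<dots> = (\<Sum>i\<in>Res. zeta (2*n) (i + (t - i) mod int n) / of_nat n)"
    using n_pos by simp
  also have "\<dots> = (\<Sum>i\<in>Res. (if i \<le> t then 1 else -1) * zeta (2*n) t / of_nat n)"
  proof (intro sum.cong refl)
    fix i assume i: "i \<in> Res"
    show "zeta (2*n) (i + (t - i) mod int n) / of_nat n = (if i \<le> t then 1 else -1) * zeta (2*n) t / of_nat n"
    proof (cases "i \<le> t")
      case True
      then have "(t - i) mod int n = t - i" using i t by simp
      then show ?thesis using True by simp
    next
      case False
      have "(t - i) mod int n = (t - i + int n) mod int n" by simp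
      also have "\<dots> = t - i + int n" using False i t by (intro mod_pos_pos_trivial) auto
      finally have "(t - i) mod int n = t - i + int n" .
      then have "zeta (2*n) (i + (t - i) mod int n) = zeta (2*n) t * zeta (2*n) (int n)" by (simp add: zeta_add[symmetric])
      also have "zeta (2*n) (int n) = -1" using n_pos by (simp add: zeta_def)
      finally show ?thesis using False by simp
    qed
  qed
  also have "\<dots> = zeta (2*n) t / of_nat n * (\<Sum>i\<in>Res. if i \<le> t then 1 else -1)"
    by (simp add: sum_distrib_left mult_ac)
  also have "(\<Sum>i\<in>Res. if i \<le> t then 1 else -1) = complex_of_real (2 * real_of_int t + 2 - real n)"
  proof -
    have "(\<Sum>i\<in>Res. if i \<le> t then 1 else (-1::complex)) = (\<Sum>i\<in>{0..t}. 1) + (\<Sum>i\<in>{t+1..<int n}. -1)"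
    proof -
      have "Res = {0..t} \<union> {t+1..<int n}" using t by auto
      then have "(\<Sum>i\<in>Res. if i \<le> t then 1 else (-1::complex)) = (\<Sum>i\<in>{0..t}. if i \<le> t then 1 else -1) + (\<Sum>i\<in>{t+1..<int n}. if i \<le> t then 1 else -1)"
        by (simp only:) (rule sum.union_disjoint, auto)
      then show ?thesis by simp
    qed
    also have "\<dots> = complex_of_real (2 * real_of_int t + 2 - real n)" using t by simp
    finally show ?thesis .
  qed
  finally show ?thesis using n_pos by (simp add: norm_mult norm_divide del: of_real_diff of_real_add of_real_mult)
qed

text \<open>The norm of 1 + z + ... + z^(n-1) is computed in two ways: from the coefficients of its
  square, and from its values at the 2n-th roots of unity. Those values are n at 1, zero at the
  other n-th roots, and n times the kernel at the rest, so the kernel sum can be solved for.\<close>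

lemma sum_norm_W_4: "(\<Sum>u\<in>Res. cmod (W u) ^ 4) = 1 / 3 + 2 / (3 * (real n)\<^sup>2)"
proof -
  define B :: "complex poly" where "B = (\<Sum>j<n. Polynomial.monom 1 j)"
  have cB: "poly.coeff B j = (if j < n then 1 else 0)" for j
    unfolding B_def by (simp add: coeff_sum)
  then have cB0: "\<And>j. j \<ge> n \<Longrightarrow> poly.coeff B j = 0" by simp
  have cBB: "poly.coeff (B * B) t = of_nat (if t < n then t + 1 else 2*n - 1 - t)" if "t < 2*n" for t
  proof -
    have "poly.coeff (B * B) t = (\<Sum>i\<le>t. if i < n \<and> t - i < n then 1 else 0)"
      unfolding coeff_mult cB by (intro sum.cong) auto
    also have "\<dots> = of_nat (card {i. i \<le> t \<and> i < n \<and> t - i < n})"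
      by (simp add: sum.If_cases Int_def)
    also have "{i. i \<le> t \<and> i < n \<and> t - i < n} = (if t < n then {0..<t+1} else {t + 1 - n..<n})"
      using that by auto
    finally show ?thesis using that by auto
  qed
  \<comment> \<open>The coefficients of the square form the triangle 1, 2, ..., n, ..., 2, 1
    followed by a zero at index 2n - 1, which explains the two sums of consecutive squares.\<close>
  have noncoprimes: "Lnorm 4 B ^ 4 = (2 * real n ^ 3 + real n) / 3"
  proof -
    have "Lnorm 4 B ^ 4 = (\<Sum>t<2*n. (cmod (poly.coeff (B * B) t))\<^sup>2)" by (rule Lnorm_4_power_4_coeff[OF cB0])
    also have "\<dots> = (\<Sum>t<2*n. (real (if t < n then t + 1 else 2*n - 1 - t))\<^sup>2)"
      by (intro sum.cong refl) (simp add: cBB del: of_nat_Suc)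
    also have "\<dots> = (\<Sum>t<n. (real (t + 1))\<^sup>2) + (\<Sum>t<n. (real (n - 1 - t))\<^sup>2)"
    proof -
      have "(\<Sum>t<2*n. (real (if t < n then t + 1 else 2*n - 1 - t))\<^sup>2) =
        (\<Sum>t<n. (real (if t < n then t + 1 else 2*n - 1 - t))\<^sup>2) + (\<Sum>t\<in>{n..<2*n}. (real (if t < n then t + 1 else 2*n - 1 - t))\<^sup>2)"
        by (subst sum.union_disjoint[symmetric]) (auto intro!: sum.cong)
      also have "(\<Sum>t\<in>{n..<2*n}. (real (if t < n then t + 1 else 2*n - 1 - t))\<^sup>2) = (\<Sum>t<n. (real (n - 1 - t))\<^sup>2)"
        by (rule sum.reindex_bij_witness[of _ "\<lambda>t. t + n" "\<lambda>t. t - n"]) auto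
      finally show ?thesis by simp
    qed
    also have "(\<Sum>t<n. (real (n - 1 - t))\<^sup>2) = (\<Sum>t<n. (real t)\<^sup>2)"
      by (rule sum.reindex_bij_witness[of _ "\<lambda>t. n - 1 - t" "\<lambda>t. n - 1 - t"]) auto
    also have "(\<Sum>t<m. (real (t + 1))\<^sup>2) + (\<Sum>t<m. (real t)\<^sup>2) = (2 * real m ^ 3 + real m) / 3" for m
      by (induction m) (auto simp: field_simps power2_eq_square power3_eq_cube)
    finally show ?thesis .
  qed
  have "Lnorm 4 B ^ 4 = (\<Sum>k\<in>{0..<int (2*n)}. cmod (poly B (zeta (2*n) k)) ^ 4) / (2 * real n)"
    by (rule Lnorm_4_power_4[OF cB0 n_pos])
  also have "(\<Sum>k\<in>{0..<int (2*n)}. cmod (poly B (zeta (2*n) k)) ^ 4) =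
     (\<Sum>m\<in>Res. cmod (poly B (zeta (2*n) (2*m))) ^ 4) + (\<Sum>m\<in>Res. cmod (poly B (zeta (2*n) (2*m+1))) ^ 4)"
    by (rule sum_even_odd)
  also have "(\<Sum>m\<in>Res. cmod (poly B (zeta (2*n) (2*m))) ^ 4) = real n ^ 4"
  proof -
    have "poly B (zeta (2*n) (2*m)) = (if m = 0 then of_nat n else 0)" if "m \<in> Res" for m
    proof -
      have "poly B (zeta (2*n) (2*m)) = (\<Sum>j\<in>Res. zeta n (m * j))"
        by (subst poly_zeta[of n]) (auto simp: cB mult.assoc zeta_double intro!: sum.cong)
      also have "\<dots> = (if m = 0 then of_nat n else 0)"
        unfolding sum_zeta[OF n_pos] using that zdvd_not_zless[of m "int n"] by auto
      finally show ?thesis .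
    qed
    then have "(\<Sum>m\<in>Res. cmod (poly B (zeta (2*n) (2*m))) ^ 4) = (\<Sum>m\<in>Res. if m = 0 then real n ^ 4 else 0)"
      by (intro sum.cong) auto
    then show ?thesis using n_pos by simp
  qed
  also have "(\<Sum>m\<in>Res. cmod (poly B (zeta (2*n) (2*m+1))) ^ 4) = real n ^ 4 * (\<Sum>u\<in>Res. cmod (W u) ^ 4)"
  proof -
    have "poly B (zeta (2*n) (2*m+1)) = of_nat n * W m" for m
      using n_pos by (subst poly_zeta[of n]) (auto simp: cB W_def intro!: sum.cong)
    then show ?thesis by (simp add: norm_mult power_mult_distrib sum_distrib_left)
  qed
  finally have "(2 * real n ^ 3 + real n) / 3 = (real n ^ 4 + real n ^ 4 * (\<Sum>u\<in>Res. cmod (W u) ^ 4)) / (2 * real n)"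
    unfolding noncoprimes .
  moreover have "X = 1 / 3 + 2 / (3 * N\<^sup>2)" if eq: "(2 * N ^ 3 + N) / 3 = (N ^ 4 + N ^ 4 * X) / (2 * N)" and N: "N > 0" for N X :: real
  proof -
    have "N\<^sup>2 * (N\<^sup>2 + 2 - 3 * N\<^sup>2 * X) = 0"
      using eq N by (simp add: field_simps power2_eq_square power3_eq_cube power4_eq_xxxx)
    then have "N\<^sup>2 + 2 - 3 * N\<^sup>2 * X = 0" using N by (simp only: mult_eq_0_iff power_eq_0_iff) auto
    then show ?thesis using N by (simp add: field_simps)
  qed
  ultimately show ?thesis using n_pos by simp
qed

end

section \<open>Fourth moments\<close>

text \<open>These are the coincidences that make the product of the four shifted factors a perfect
  square, so that its symbol is 0 or 1.\<close>

definition paired :: "'a \<Rightarrow> 'a \<Rightarrow> 'a \<Rightarrow> 'a \<Rightarrow> bool" where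
  "paired a b c d \<longleftrightarrow> (a = b \<and> c = d) \<or> (a = c \<and> b = d) \<or> (a = d \<and> b = c)"

text \<open>Inclusion and exclusion over the three pairings: any two of them hold together only if
  all four indices agree, and then the sum of the three indicators is 3 instead of 1, whence the
  term -2. The pairings of a weight with a conjugate weight give squared sums of moduli; the pairing
  a = b, c = d gives the sum of squares of the weights.\<close>

lemma sum_quad_paired:
  fixes w :: "'a \<Rightarrow> complex"
  assumes fin: "finite R"
  shows "(\<Sum>a\<in>R. \<Sum>b\<in>R. \<Sum>c\<in>R. \<Sum>d\<in>R. w a * w b * cnj (w c) * cnj (w d) * of_real (of_bool (paired a b c d)))
     = of_real (2 * (\<Sum>a\<in>R. (cmod (w a))\<^sup>2)\<^sup>2 + (cmod (\<Sum>a\<in>R. (w a)\<^sup>2))\<^sup>2 - 2 * (\<Sum>a\<in>R. cmod (w a) ^ 4))"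
proof -
  let ?q = "\<lambda>a b c d. w a * w b * cnj (w c) * cnj (w d)"
  have ind: "complex_of_real (of_bool (paired a b c d)) = of_bool (c = a) * of_bool (d = b) + of_bool (d = a) * of_bool (c = b)
      + of_bool (b = a) * of_bool (d = c) - 2 * (of_bool (b = a) * of_bool (c = a) * of_bool (d = a))" for a b c d :: 'a
    unfolding paired_def by auto
  have n2: "w a * cnj (w a) = of_real ((cmod (w a))\<^sup>2)" for a by (simp add: complex_norm_square del: of_real_power)
  have S1: "(\<Sum>a\<in>R. \<Sum>b\<in>R. \<Sum>c\<in>R. \<Sum>d\<in>R. ?q a b c d * (of_bool (c = a) * of_bool (d = b))) = of_real ((\<Sum>a\<in>R. (cmod (w a))\<^sup>2)\<^sup>2)"
  proof -
    have "(\<Sum>a\<in>R. \<Sum>b\<in>R. \<Sum>c\<in>R. \<Sum>d\<in>R. ?q a b c d * (of_bool (c = a) * of_bool (d = b))) = (\<Sum>a\<in>R. \<Sum>b\<in>R. (w a * cnj (w a)) * (w b * cnj (w b)))"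
      using fin by (intro sum.cong refl) (simp add: of_bool_def if_distrib[of "\<lambda>x. _ * x"] mult_ac cong: if_cong)
    then show ?thesis unfolding n2 by (simp add: power2_eq_square sum_product del: of_real_power)
  qed
  have S2: "(\<Sum>a\<in>R. \<Sum>b\<in>R. \<Sum>c\<in>R. \<Sum>d\<in>R. ?q a b c d * (of_bool (d = a) * of_bool (c = b))) = of_real ((\<Sum>a\<in>R. (cmod (w a))\<^sup>2)\<^sup>2)"
  proof -
    have "(\<Sum>a\<in>R. \<Sum>b\<in>R. \<Sum>c\<in>R. \<Sum>d\<in>R. ?q a b c d * (of_bool (d = a) * of_bool (c = b))) = (\<Sum>a\<in>R. \<Sum>b\<in>R. (w a * cnj (w a)) * (w b * cnj (w b)))"
      using fin by (intro sum.cong refl) (simp add: of_bool_def if_distrib[of "\<lambda>x. _ * x"] mult_ac cong: if_cong)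
    then show ?thesis unfolding n2 by (simp add: power2_eq_square sum_product del: of_real_power)
  qed
  have S3: "(\<Sum>a\<in>R. \<Sum>b\<in>R. \<Sum>c\<in>R. \<Sum>d\<in>R. ?q a b c d * (of_bool (b = a) * of_bool (d = c))) = of_real ((cmod (\<Sum>a\<in>R. (w a)\<^sup>2))\<^sup>2)"
  proof -
    have "(\<Sum>a\<in>R. \<Sum>b\<in>R. \<Sum>c\<in>R. \<Sum>d\<in>R. ?q a b c d * (of_bool (b = a) * of_bool (d = c)))
       = (\<Sum>a\<in>R. \<Sum>c\<in>R. \<Sum>b\<in>R. \<Sum>d\<in>R. ?q a b c d * (of_bool (b = a) * of_bool (d = c)))"
      by (intro sum.cong refl sum.swap)
    also have "\<dots> = (\<Sum>a\<in>R. \<Sum>c\<in>R. (w a)\<^sup>2 * cnj ((w c)\<^sup>2))"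
      using fin by (intro sum.cong refl) (simp add: of_bool_def if_distrib[of "\<lambda>x. _ * x"] power2_eq_square mult_ac cong: if_cong)
    also have "\<dots> = (\<Sum>a\<in>R. (w a)\<^sup>2) * cnj (\<Sum>a\<in>R. (w a)\<^sup>2)" by (simp add: sum_product)
    finally show ?thesis by (simp add: complex_norm_square del: of_real_power)
  qed
  have S4: "(\<Sum>a\<in>R. \<Sum>b\<in>R. \<Sum>c\<in>R. \<Sum>d\<in>R. ?q a b c d * (of_bool (b = a) * of_bool (c = a) * of_bool (d = a))) = of_real (\<Sum>a\<in>R. cmod (w a) ^ 4)"
  proof -
    have "(\<Sum>a\<in>R. \<Sum>b\<in>R. \<Sum>c\<in>R. \<Sum>d\<in>R. ?q a b c d * (of_bool (b = a) * of_bool (c = a) * of_bool (d = a))) = (\<Sum>a\<in>R. (w a * cnj (w a)) * (w a * cnj (w a)))"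
    proof (intro sum.cong refl)
      fix a assume a: "a \<in> R"
      have delta: "(\<Sum>b\<in>R. of_bool (b = a) * f b) = f a" for f :: "'a \<Rightarrow> complex"
        using fin a by (simp add: of_bool_def if_distrib[of "\<lambda>x. x * _"] cong: if_cong)
      have "(\<Sum>b\<in>R. \<Sum>c\<in>R. \<Sum>d\<in>R. ?q a b c d * (of_bool (b = a) * of_bool (c = a) * of_bool (d = a)))
        = (\<Sum>b\<in>R. of_bool (b = a) * (\<Sum>c\<in>R. of_bool (c = a) * (\<Sum>d\<in>R. of_bool (d = a) * ?q a b c d)))"
        unfolding sum_distrib_left by (simp only: mult_ac)
      then show "(\<Sum>b\<in>R. \<Sum>c\<in>R. \<Sum>d\<in>R. ?q a b c d * (of_bool (b = a) * of_bool (c = a) * of_bool (d = a))) = (w a * cnj (w a)) * (w a * cnj (w a))"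
        unfolding delta by (simp only: mult_ac)
    qed
    then show ?thesis unfolding n2 by (simp add: power2_eq_square power4_eq_xxxx mult_ac)
  qed
  have "(\<Sum>a\<in>R. \<Sum>b\<in>R. \<Sum>c\<in>R. \<Sum>d\<in>R. ?q a b c d * of_real (of_bool (paired a b c d)))
    = (\<Sum>a\<in>R. \<Sum>b\<in>R. \<Sum>c\<in>R. \<Sum>d\<in>R. ?q a b c d * (of_bool (c = a) * of_bool (d = b)))
    + (\<Sum>a\<in>R. \<Sum>b\<in>R. \<Sum>c\<in>R. \<Sum>d\<in>R. ?q a b c d * (of_bool (d = a) * of_bool (c = b)))
    + (\<Sum>a\<in>R. \<Sum>b\<in>R. \<Sum>c\<in>R. \<Sum>d\<in>R. ?q a b c d * (of_bool (b = a) * of_bool (d = c)))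
    - 2 * (\<Sum>a\<in>R. \<Sum>b\<in>R. \<Sum>c\<in>R. \<Sum>d\<in>R. ?q a b c d * (of_bool (b = a) * of_bool (c = a) * of_bool (d = a)))"
    unfolding ind sum_distrib_left sum.distrib[symmetric] sum_subtractf[symmetric]
    by (intro sum.cong refl) (simp only: ring_distribs mult_ac)
  also have "\<dots> = of_real (2 * (\<Sum>a\<in>R. (cmod (w a))\<^sup>2)\<^sup>2 + (cmod (\<Sum>a\<in>R. (w a)\<^sup>2))\<^sup>2 - 2 * (\<Sum>a\<in>R. cmod (w a) ^ 4))"
    unfolding S1 S2 S3 S4 by simp
  finally show ?thesis .
qed

text \<open>The two variables outside a given pair sum freely to H^2, and all six pairs give the
  same value after renaming and exchanging the sums.\<close>

lemma sum_quad_pair_weight: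
  fixes v :: "'a \<Rightarrow> real" and R :: "'a set" and T :: "'a \<Rightarrow> 'a \<Rightarrow> real"
  defines "K \<equiv> \<Sum>a\<in>R. \<Sum>b\<in>R. v a * v b * T a b" and "H \<equiv> \<Sum>a\<in>R. v a"
  defines "q \<equiv> \<lambda>a b c d. v a * v b * v c * v d"
  shows "(\<Sum>a\<in>R. \<Sum>b\<in>R. \<Sum>c\<in>R. \<Sum>d\<in>R. q a b c d * (T a b + T a c + T a d + T b c + T b d + T c d)) = 6 * (H\<^sup>2 * K)"
proof -
  have HK: "H\<^sup>2 * K = (\<Sum>a\<in>R. \<Sum>b\<in>R. \<Sum>c\<in>R. \<Sum>d\<in>R. q a b c d * T a b)"
  proof -
    have "H\<^sup>2 * K = K * (\<Sum>c\<in>R. \<Sum>d\<in>R. v c * v d)" by (simp add: H_def power2_eq_square sum_product)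
    also have "\<dots> = (\<Sum>a\<in>R. \<Sum>b\<in>R. \<Sum>c\<in>R. \<Sum>d\<in>R. q a b c d * T a b)"
      unfolding K_def sum_distrib_right unfolding sum_distrib_left
      by (intro sum.cong refl) (simp only: q_def mult_ac)
    finally show ?thesis .
  qed
  have ac: "(\<Sum>a\<in>R. \<Sum>b\<in>R. \<Sum>c\<in>R. \<Sum>d\<in>R. q a b c d * T a c) = H\<^sup>2 * K"
  proof -
    have "(\<Sum>a\<in>R. \<Sum>b\<in>R. \<Sum>c\<in>R. \<Sum>d\<in>R. q a b c d * T a c) = (\<Sum>a\<in>R. \<Sum>c\<in>R. \<Sum>b\<in>R. \<Sum>d\<in>R. q a b c d * T a c)"
      by (intro sum.cong refl sum.swap)
    then show ?thesis unfolding HK by (simp only: q_def mult_ac)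
  qed
  have ad: "(\<Sum>a\<in>R. \<Sum>b\<in>R. \<Sum>c\<in>R. \<Sum>d\<in>R. q a b c d * T a d) = H\<^sup>2 * K"
  proof -
    have "(\<Sum>a\<in>R. \<Sum>b\<in>R. \<Sum>c\<in>R. \<Sum>d\<in>R. q a b c d * T a d) = (\<Sum>a\<in>R. \<Sum>b\<in>R. \<Sum>d\<in>R. \<Sum>c\<in>R. q a b c d * T a d)"
      by (intro sum.cong refl sum.swap)
    then show ?thesis unfolding ac[symmetric] by (simp only: q_def mult_ac)
  qed
  have bc: "(\<Sum>a\<in>R. \<Sum>b\<in>R. \<Sum>c\<in>R. \<Sum>d\<in>R. q a b c d * T b c) = H\<^sup>2 * K"
  proof -
    have "(\<Sum>a\<in>R. \<Sum>b\<in>R. \<Sum>c\<in>R. \<Sum>d\<in>R. q a b c d * T b c) = (\<Sum>b\<in>R. \<Sum>a\<in>R. \<Sum>c\<in>R. \<Sum>d\<in>R. q a b c d * T b c)"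
      by (rule sum.swap)
    then show ?thesis unfolding ac[symmetric] by (simp only: q_def mult_ac)
  qed
  have bd: "(\<Sum>a\<in>R. \<Sum>b\<in>R. \<Sum>c\<in>R. \<Sum>d\<in>R. q a b c d * T b d) = H\<^sup>2 * K"
  proof -
    have "(\<Sum>a\<in>R. \<Sum>b\<in>R. \<Sum>c\<in>R. \<Sum>d\<in>R. q a b c d * T b d) = (\<Sum>b\<in>R. \<Sum>a\<in>R. \<Sum>c\<in>R. \<Sum>d\<in>R. q a b c d * T b d)"
      by (rule sum.swap)
    then show ?thesis unfolding ad[symmetric] by (simp only: q_def mult_ac)
  qed
  have cd: "(\<Sum>a\<in>R. \<Sum>b\<in>R. \<Sum>c\<in>R. \<Sum>d\<in>R. q a b c d * T c d) = H\<^sup>2 * K"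
  proof -
    have "(\<Sum>a\<in>R. \<Sum>b\<in>R. \<Sum>c\<in>R. \<Sum>d\<in>R. q a b c d * T c d) = (\<Sum>a\<in>R. \<Sum>c\<in>R. \<Sum>b\<in>R. \<Sum>d\<in>R. q a b c d * T c d)"
      by (intro sum.cong refl sum.swap)
    then show ?thesis unfolding bd[symmetric] by (simp only: q_def mult_ac)
  qed
  show ?thesis unfolding ring_distribs sum.distrib ac ad bc bd cd HK[symmetric] by simp
qed

text \<open>The error splits into a uniform part \<eta>, multiplied by the fourth power of the
  absolute sum of the weights, and a part carried by exceptional pairs. The latter allows a trivial
  bound on quadruples without power saving, provided the weights rarely meet exceptional
  pairs.\<close>

lemma sum_quad_approx:
  fixes w :: "'a \<Rightarrow> complex" and E :: "'a \<Rightarrow> 'a \<Rightarrow> 'a \<Rightarrow> 'a \<Rightarrow> real" and T :: "'a \<Rightarrow> 'a \<Rightarrow> real"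
  assumes fin: "finite R"
    and E: "\<And>a b c d. a \<in> R \<Longrightarrow> b \<in> R \<Longrightarrow> c \<in> R \<Longrightarrow> d \<in> R \<Longrightarrow>
      \<bar>E a b c d - of_bool (paired a b c d)\<bar> \<le> \<eta> + (T a b + T a c + T a d + T b c + T b d + T c d)"
  defines "H \<equiv> \<Sum>a\<in>R. cmod (w a)" and "K \<equiv> \<Sum>a\<in>R. \<Sum>b\<in>R. cmod (w a) * cmod (w b) * T a b"
  shows "cmod ((\<Sum>a\<in>R. \<Sum>b\<in>R. \<Sum>c\<in>R. \<Sum>d\<in>R. w a * w b * cnj (w c) * cnj (w d) * of_real (E a b c d))
     - of_real (2 * (\<Sum>a\<in>R. (cmod (w a))\<^sup>2)\<^sup>2 + (cmod (\<Sum>a\<in>R. (w a)\<^sup>2))\<^sup>2 - 2 * (\<Sum>a\<in>R. cmod (w a) ^ 4)))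
     \<le> \<eta> * H ^ 4 + 6 * (H\<^sup>2 * K)"
proof -
  let ?q = "\<lambda>a b c d. w a * w b * cnj (w c) * cnj (w d)"
  let ?v = "\<lambda>a b c d. cmod (w a) * cmod (w b) * cmod (w c) * cmod (w d)"
  let ?T = "\<lambda>a b c d. T a b + T a c + T a d + T b c + T b d + T c d"
  have "(\<Sum>a\<in>R. \<Sum>b\<in>R. \<Sum>c\<in>R. \<Sum>d\<in>R. ?q a b c d * of_real (E a b c d))
     - of_real (2 * (\<Sum>a\<in>R. (cmod (w a))\<^sup>2)\<^sup>2 + (cmod (\<Sum>a\<in>R. (w a)\<^sup>2))\<^sup>2 - 2 * (\<Sum>a\<in>R. cmod (w a) ^ 4))
    = (\<Sum>a\<in>R. \<Sum>b\<in>R. \<Sum>c\<in>R. \<Sum>d\<in>R. ?q a b c d * of_real (E a b c d - of_bool (paired a b c d)))"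
    unfolding sum_quad_paired[OF fin, symmetric] sum_subtractf[symmetric] by (simp only: of_real_diff right_diff_distrib)
  also have "cmod \<dots> \<le> (\<Sum>a\<in>R. \<Sum>b\<in>R. \<Sum>c\<in>R. \<Sum>d\<in>R. ?v a b c d * (\<eta> + ?T a b c d))"
  proof (intro sum_norm_le)
    fix a b c d assume "a \<in> R" "b \<in> R" "c \<in> R" "d \<in> R"
    then show "cmod (?q a b c d * of_real (E a b c d - of_bool (paired a b c d))) \<le> ?v a b c d * (\<eta> + ?T a b c d)"
      unfolding norm_mult complex_mod_cnj norm_of_real by (intro mult_left_mono E) auto
  qed
  also have "\<dots> = (\<Sum>a\<in>R. \<Sum>b\<in>R. \<Sum>c\<in>R. \<Sum>d\<in>R. ?v a b c d * \<eta>) + (\<Sum>a\<in>R. \<Sum>b\<in>R. \<Sum>c\<in>R. \<Sum>d\<in>R. ?v a b c d * ?T a b c d)"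
    by (simp only: distrib_left[of _ \<eta>] sum.distrib)
  also have "(\<Sum>a\<in>R. \<Sum>b\<in>R. \<Sum>c\<in>R. \<Sum>d\<in>R. ?v a b c d * \<eta>) = \<eta> * H ^ 4"
  proof -
    have "\<eta> * H ^ 4 = \<eta> * (H * (H * (H * H)))" by (simp only: power4_eq_xxxx mult.assoc)
    also have "\<dots> = (\<Sum>a\<in>R. \<Sum>b\<in>R. \<Sum>c\<in>R. \<Sum>d\<in>R. ?v a b c d * \<eta>)"
      unfolding H_def sum_product unfolding sum_distrib_left by (simp only: mult_ac)
    finally show ?thesis by simp
  qed
  also have "(\<Sum>a\<in>R. \<Sum>b\<in>R. \<Sum>c\<in>R. \<Sum>d\<in>R. ?v a b c d * ?T a b c d) = 6 * (H\<^sup>2 * K)"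
    unfolding H_def K_def by (rule sum_quad_pair_weight)
  finally show ?thesis .
qed

section \<open>Weighted counts of congruent pairs\<close>

definition odd_recip :: "int \<Rightarrow> real" where
  "odd_recip x = 1 / (2 * real_of_int x + 1)"

lemma odd_recip_nonneg: "x \<ge> 0 \<Longrightarrow> odd_recip x \<ge> 0"
  by (simp add: odd_recip_def)

lemma sum_reflect:
  fixes F :: "int \<Rightarrow> 'a::comm_monoid_add"
  shows "(\<Sum>x\<in>{0..<int N}. F (int N - 1 - x)) = (\<Sum>x\<in>{0..<int N}. F x)"
  by (rule sum.reindex_bij_witness[of _ "\<lambda>x. int N - 1 - x" "\<lambda>x. int N - 1 - x"]) auto

lemma sum_odd_recip_le: "(\<Sum>x\<in>{0..<int N}. odd_recip x) \<le> harm N"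
proof -
  have "(\<Sum>x\<in>{0..<int N}. odd_recip x) = (\<Sum>k<N. odd_recip (int k))" by (rule sum_int_interval)
  also have "\<dots> \<le> (\<Sum>k<N. inverse (of_nat (Suc k)))"
    by (intro sum_mono) (simp add: odd_recip_def field_simps)
  finally show ?thesis by (simp add: harm_altdef)
qed

lemma sum_recip_multiples: "(\<Sum>q\<in>{1..N}. 1 / (2 * (real q * P))) = harm N / (2 * P)"
  unfolding harm_def sum_divide_distrib by (intro sum.cong refl) (simp add: field_simps)

text \<open>By symmetry let a < b. Then b = a + q P with q \<ge> 1, so the reciprocal of 2b + 1 is
  at most 1/(2qP), and summing over q gives a harmonic number over 2P. Excluding a = b is essential,
  since the diagonal has no decay in P.\<close>

lemma sum_odd_recip_pairs_le:
  assumes "P > 0"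
  shows "(\<Sum>a\<in>{0..<int N}. \<Sum>b\<in>{0..<int N}. odd_recip a * odd_recip b * of_bool (a \<noteq> b \<and> P dvd a - b)) \<le> (harm N)\<^sup>2 / P"
proof -
  let ?I = "{0..<int N}"
  have inner: "(\<Sum>b\<in>?I. odd_recip b * of_bool (a < b \<and> P dvd a - b)) \<le> harm N / (2 * real_of_int P)" if a: "a \<in> ?I" for a
  proof -
    have "(\<Sum>b\<in>?I. odd_recip b * of_bool (a < b \<and> P dvd a - b)) = (\<Sum>b\<in>{b\<in>?I. a < b \<and> P dvd a - b}. odd_recip b)"
      by (rule sum.mono_neutral_cong_right) auto
    also have "\<dots> \<le> (\<Sum>q\<in>{1..N}. 1 / (2 * (real q * real_of_int P)))"
    proof (rule sum_le_included[where i = "\<lambda>q. a + int q * P"])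
      show "\<forall>b\<in>{b \<in> ?I. a < b \<and> P dvd a - b}. \<exists>q\<in>{1..N}. a + int q * P = b \<and> odd_recip b \<le> 1 / (2 * (real q * real_of_int P))"
      proof
        fix b assume b: "b \<in> {b \<in> ?I. a < b \<and> P dvd a - b}"
        then have "P dvd b - a" by (simp add: dvd_diff_commute)
        then obtain k where k: "b - a = P * k" by blast
        have "0 < P * k" using b k by simp
        then have "k > 0" using assms by (simp add: zero_less_mult_iff)
        have "1 * k \<le> P * k" using assms \<open>k > 0\<close> by (intro mult_right_mono) auto
        then have "k \<le> int N" using k a b by auto
        define q where "q = nat k"
        have q: "int q = k" "q \<in> {1..N}" using \<open>k > 0\<close> \<open>k \<le> int N\<close> by (auto simp: q_def)
        have "b = a + int q * P" using k q by (simp add: mult_ac)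
        moreover have "odd_recip b \<le> 1 / (2 * (real q * real_of_int P))"
          unfolding odd_recip_def \<open>b = a + int q * P\<close> using a assms q(2) by (intro frac_le) auto
        ultimately show "\<exists>q\<in>{1..N}. a + int q * P = b \<and> odd_recip b \<le> 1 / (2 * (real q * real_of_int P))" using q(2) by metis
      qed
    qed (use assms in \<open>auto intro: finite_subset[of _ ?I]\<close>)
    finally show ?thesis unfolding sum_recip_multiples .
  qed
  define A where "A = (\<Sum>a\<in>?I. \<Sum>b\<in>?I. odd_recip a * (odd_recip b * of_bool (a < b \<and> P dvd a - b)))"
  have "A = (\<Sum>a\<in>?I. odd_recip a * (\<Sum>b\<in>?I. odd_recip b * of_bool (a < b \<and> P dvd a - b)))"
    unfolding A_def by (simp only: sum_distrib_left)
  also have "\<dots> \<le> (\<Sum>a\<in>?I. odd_recip a * (harm N / (2 * real_of_int P)))"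
    by (intro sum_mono mult_left_mono inner) (auto simp: odd_recip_nonneg)
  also have "\<dots> \<le> harm N * (harm N / (2 * real_of_int P))"
    unfolding sum_distrib_right[symmetric] using assms by (intro mult_right_mono sum_odd_recip_le) (auto simp: harm_nonneg)
  finally have A: "A \<le> (harm N)\<^sup>2 / P / 2" by (simp add: power2_eq_square mult_ac)
  have "(\<Sum>a\<in>?I. \<Sum>b\<in>?I. odd_recip a * odd_recip b * of_bool (a \<noteq> b \<and> P dvd a - b))
      = A + (\<Sum>a\<in>?I. \<Sum>b\<in>?I. odd_recip b * (odd_recip a * of_bool (b < a \<and> P dvd b - a)))"
    unfolding A_def sum.distrib[symmetric]
    by (intro sum.cong refl) (auto simp: dvd_diff_commute)
  also have "(\<Sum>a\<in>?I. \<Sum>b\<in>?I. odd_recip b * (odd_recip a * of_bool (b < a \<and> P dvd b - a))) = A"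
    unfolding A_def by (rule sum.swap)
  finally show ?thesis using A by simp
qed

text \<open>Partial fractions: $\frac{1}{(2a+1)(2b+1)} = \frac{1}{2(a+b+1)}\bigl(\frac{1}{2a+1}+\frac{1}{2b+1}\bigr)$.\<close>
lemma sum_odd_recip_antipairs_le:
  assumes "P \<ge> 2"
  shows "(\<Sum>a\<in>{0..<int N}. \<Sum>b\<in>{0..<int N}. odd_recip a * odd_recip b * of_bool (P dvd a + b + 1)) \<le> (harm N)\<^sup>2 / P"
proof -
  let ?I = "{0..<int N}"
  have inner: "(\<Sum>b\<in>?I. 1 / (2 * real_of_int (a + b + 1)) * of_bool (P dvd a + b + 1)) \<le> harm N / (2 * real_of_int P)" if a: "a \<in> ?I" for a
  proof -
    have "(\<Sum>b\<in>?I. 1 / (2 * real_of_int (a + b + 1)) * of_bool (P dvd a + b + 1))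
        = (\<Sum>b\<in>{b\<in>?I. P dvd a + b + 1}. 1 / (2 * real_of_int (a + b + 1)))"
      by (rule sum.mono_neutral_cong_right) auto
    also have "\<dots> \<le> (\<Sum>q\<in>{1..N}. 1 / (2 * (real q * real_of_int P)))"
    proof (rule sum_le_included[where i = "\<lambda>q. int q * P - a - 1"])
      show "\<forall>b\<in>{b \<in> ?I. P dvd a + b + 1}. \<exists>q\<in>{1..N}. int q * P - a - 1 = b \<and>
          1 / (2 * real_of_int (a + b + 1)) \<le> 1 / (2 * (real q * real_of_int P))"
      proof
        fix b assume b: "b \<in> {b \<in> ?I. P dvd a + b + 1}"
        then obtain k where k: "a + b + 1 = P * k" by blast
        have "0 < P * k" using a b k[symmetric] by auto
        then have "k > 0" using assms by (simp add: zero_less_mult_iff)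
        \<comment> \<open>Since a + b + 1 can be as large as 2N - 1, it takes P \<ge> 2 to keep the
          quotient k at most N.\<close>
        have "2 * k \<le> P * k" using assms \<open>k > 0\<close> by (intro mult_right_mono) auto
        then have "k \<le> int N" using k a b by auto
        define q where "q = nat k"
        have q: "int q = k" "q \<in> {1..N}" using \<open>k > 0\<close> \<open>k \<le> int N\<close> by (auto simp: q_def)
        have e: "a + b + 1 = int q * P" using k q by (simp add: mult_ac)
        then have "1 / (2 * real_of_int (a + b + 1)) = 1 / (2 * (real q * real_of_int P))" by simp
        then show "\<exists>q\<in>{1..N}. int q * P - a - 1 = b \<and> 1 / (2 * real_of_int (a + b + 1)) \<le> 1 / (2 * (real q * real_of_int P))"
          using q(2) e by (intro bexI[of _ q]) auto
      qed
    qed (use assms in \<open>auto intro: finite_subset[of _ ?I]\<close>)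
    finally show ?thesis unfolding sum_recip_multiples .
  qed
  define A where "A = (\<Sum>a\<in>?I. \<Sum>b\<in>?I. odd_recip a * (1 / (2 * real_of_int (a + b + 1)) * of_bool (P dvd a + b + 1)))"
  have "A = (\<Sum>a\<in>?I. odd_recip a * (\<Sum>b\<in>?I. 1 / (2 * real_of_int (a + b + 1)) * of_bool (P dvd a + b + 1)))"
    unfolding A_def by (simp only: sum_distrib_left)
  also have "\<dots> \<le> (\<Sum>a\<in>?I. odd_recip a * (harm N / (2 * real_of_int P)))"
    by (intro sum_mono mult_left_mono inner) (auto simp: odd_recip_nonneg)
  also have "\<dots> \<le> harm N * (harm N / (2 * real_of_int P))"
    unfolding sum_distrib_right[symmetric] using assms by (intro mult_right_mono sum_odd_recip_le) (auto simp: harm_nonneg)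
  finally have A: "A \<le> (harm N)\<^sup>2 / P / 2" by (simp add: power2_eq_square mult_ac)
  have pf: "odd_recip a * odd_recip b = odd_recip a * (1 / (2 * real_of_int (a + b + 1))) + odd_recip b * (1 / (2 * real_of_int (b + a + 1)))"
    if "a \<in> ?I" "b \<in> ?I" for a b
  proof -
    have "2 * real_of_int a + 1 > 0" "2 * real_of_int b + 1 > 0" "real_of_int a + real_of_int b + 1 > 0" using that by auto
    then show ?thesis unfolding odd_recip_def by (simp add: divide_simps) (simp add: algebra_simps)
  qed
  have "(\<Sum>a\<in>?I. \<Sum>b\<in>?I. odd_recip a * odd_recip b * of_bool (P dvd a + b + 1))
      = A + (\<Sum>a\<in>?I. \<Sum>b\<in>?I. odd_recip b * (1 / (2 * real_of_int (b + a + 1)) * of_bool (P dvd b + a + 1)))"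
    unfolding A_def sum.distrib[symmetric]
    by (intro sum.cong refl) (simp add: pf add_ac)
  also have "(\<Sum>a\<in>?I. \<Sum>b\<in>?I. odd_recip b * (1 / (2 * real_of_int (b + a + 1)) * of_bool (P dvd b + a + 1))) = A"
    unfolding A_def by (rule sum.swap)
  finally show ?thesis using A by simp
qed

text \<open>The weights may peak at both ends of the period, so the product of two bounds has four
  parts. Parts from the same end reduce by reflection to pairs with a congruent to b. For opposite
  ends the reflection of one index, with P dividing N, turns the congruence into P dividing a + b +
  1. Each part is at most harm^2 / P, and 2 * 2 * 4 = 16.\<close>

lemma sum_kernel_pairs_le:
  fixes v :: "int \<Rightarrow> real" and P :: int
  assumes P: "P \<ge> 2" "P dvd int N"
    and v: "\<And>u. u \<in> {0..<int N} \<Longrightarrow> 0 \<le> v u \<and> v u \<le> 2 * odd_recip u + 2 * odd_recip (int N - 1 - u)"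
  shows "(\<Sum>a\<in>{0..<int N}. \<Sum>b\<in>{0..<int N}. v a * v b * of_bool (a \<noteq> b \<and> P dvd a - b)) \<le> 16 * (harm N)\<^sup>2 / P"
proof -
  let ?I = "{0..<int N}"
  let ?l = odd_recip and ?r = "\<lambda>u. odd_recip (int N - 1 - u)"
  let ?c = "\<lambda>a b. of_bool (a \<noteq> b \<and> P dvd a - b) :: real"
  have nn: "?l u \<ge> 0" "?r u \<ge> 0" if "u \<in> ?I" for u using that by (auto intro: odd_recip_nonneg)
  have P0: "P > 0" using P by simp
  have LL: "(\<Sum>a\<in>?I. \<Sum>b\<in>?I. ?l a * ?l b * ?c a b) \<le> (harm N)\<^sup>2 / P" by (rule sum_odd_recip_pairs_le[OF P0])
  have RR: "(\<Sum>a\<in>?I. \<Sum>b\<in>?I. ?r a * ?r b * ?c a b) \<le> (harm N)\<^sup>2 / P"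
  proof -
    have "(\<Sum>a\<in>?I. \<Sum>b\<in>?I. ?r a * ?r b * ?c a b) = (\<Sum>a\<in>?I. \<Sum>b\<in>?I. ?l a * ?r b * ?c (int N - 1 - a) b)"
      using sum_reflect[of "\<lambda>a. \<Sum>b\<in>?I. ?l a * ?r b * ?c (int N - 1 - a) b" N] by simp
    also have "\<dots> = (\<Sum>a\<in>?I. \<Sum>b\<in>?I. ?l a * ?l b * ?c (int N - 1 - a) (int N - 1 - b))"
      using sum_reflect[of "\<lambda>b. ?l _ * ?l b * ?c (int N - 1 - _) (int N - 1 - b)" N] by simp
    also have "\<dots> = (\<Sum>a\<in>?I. \<Sum>b\<in>?I. ?l a * ?l b * ?c a b)"
      by (intro sum.cong refl) (auto simp: dvd_diff_commute)
    finally show ?thesis using LL by simp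
  qed
  have LR: "(\<Sum>a\<in>?I. \<Sum>b\<in>?I. ?l a * ?r b * ?c a b) \<le> (harm N)\<^sup>2 / P"
  proof -
    have "(\<Sum>a\<in>?I. \<Sum>b\<in>?I. ?l a * ?r b * ?c a b) = (\<Sum>a\<in>?I. \<Sum>b\<in>?I. ?l a * ?l b * ?c a (int N - 1 - b))"
      using sum_reflect[of "\<lambda>b. ?l _ * ?l b * ?c _ (int N - 1 - b)" N] by simp
    also have "\<dots> \<le> (\<Sum>a\<in>?I. \<Sum>b\<in>?I. ?l a * ?l b * of_bool (P dvd a + b + 1))"
    proof (intro sum_mono mult_left_mono)
      fix a b assume "a \<in> ?I" "b \<in> ?I"
      then show "0 \<le> ?l a * ?l b" using nn by simp
      have "P dvd a + b + 1" if "P dvd a - (int N - 1 - b)"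
      proof -
        have "P dvd (a - (int N - 1 - b)) + int N" using that P(2) by (rule dvd_add)
        then show ?thesis by (simp add: algebra_simps)
      qed
      then show "?c a (int N - 1 - b) \<le> of_bool (P dvd a + b + 1)" by auto
    qed
    also have "\<dots> \<le> (harm N)\<^sup>2 / P" by (rule sum_odd_recip_antipairs_le[OF P(1)])
    finally show ?thesis .
  qed
  have RL: "(\<Sum>a\<in>?I. \<Sum>b\<in>?I. ?r a * ?l b * ?c a b) \<le> (harm N)\<^sup>2 / P"
  proof -
    have "(\<Sum>a\<in>?I. \<Sum>b\<in>?I. ?r a * ?l b * ?c a b) = (\<Sum>b\<in>?I. \<Sum>a\<in>?I. ?r a * ?l b * ?c a b)" by (rule sum.swap)
    also have "\<dots> = (\<Sum>a\<in>?I. \<Sum>b\<in>?I. ?l a * ?r b * ?c a b)"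
      by (intro sum.cong refl) (auto simp: dvd_diff_commute)
    finally show ?thesis using LR by simp
  qed
  have alg: "(2 * x + 2 * x') * (2 * y + 2 * y') * c = 4 * (x * y * c + x * y' * c + x' * y * c + x' * y' * c)" for x x' y y' c :: real
    by (simp add: algebra_simps)
  have "(\<Sum>a\<in>?I. \<Sum>b\<in>?I. v a * v b * ?c a b) \<le> (\<Sum>a\<in>?I. \<Sum>b\<in>?I. (2 * ?l a + 2 * ?r a) * (2 * ?l b + 2 * ?r b) * ?c a b)"
    by (intro sum_mono mult_right_mono mult_mono) (use v nn in \<open>auto intro!: add_nonneg_nonneg\<close>)
  also have "\<dots> = 4 * ((\<Sum>a\<in>?I. \<Sum>b\<in>?I. ?l a * ?l b * ?c a b) + (\<Sum>a\<in>?I. \<Sum>b\<in>?I. ?l a * ?r b * ?c a b)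
     + (\<Sum>a\<in>?I. \<Sum>b\<in>?I. ?r a * ?l b * ?c a b) + (\<Sum>a\<in>?I. \<Sum>b\<in>?I. ?r a * ?r b * ?c a b))"
    unfolding sum.distrib[symmetric] sum_distrib_left by (intro sum.cong refl alg)
  also have "\<dots> \<le> 4 * ((harm N)\<^sup>2 / P + (harm N)\<^sup>2 / P + (harm N)\<^sup>2 / P + (harm N)\<^sup>2 / P)"
    using LL LR RL RR by (intro mult_left_mono add_mono) auto
  finally show ?thesis by simp
qed

context odd_squarefree
begin

section \<open>Correlations of four shifts of the Jacobi symbol\<close>

definition E :: "int \<Rightarrow> int \<Rightarrow> int \<Rightarrow> int \<Rightarrow> real" where
  "E a b c d = (\<Sum>m\<in>Res. real_of_int (Jacobi ((m - a) * (m - b) * (m - c) * (m - d)) n)) / real n"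

definition T :: "int \<Rightarrow> int \<Rightarrow> real" where
  "T a b = of_bool (a \<noteq> b \<and> (\<exists>P\<in>prime_factors n. int P dvd a - b))"

text \<open>This is n - phi(n): the number of zeros of the symbol in a period, and so also the
  number of nonzero coefficients of every V.\<close>

definition noncoprimes :: nat where "noncoprimes = card {x \<in> Res. \<not> coprime x (int n)}"

lemma abs_Jacobi_le: "\<bar>real_of_int (Jacobi x k)\<bar> \<le> 1"
  using Jacobi_values[of x k] by auto

lemma E_le_1: "\<bar>E a b c d\<bar> \<le> 1"
proof -
  have "\<bar>\<Sum>m\<in>Res. real_of_int (Jacobi ((m - a) * (m - b) * (m - c) * (m - d)) n)\<bar> \<le> (\<Sum>m\<in>Res. 1)"
    by (rule order_trans[OF sum_abs]) (intro sum_mono abs_Jacobi_le)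
  then show ?thesis using n_pos by (simp add: E_def)
qed

lemma coprime_mod_n: "coprime (x mod int n) (int n) \<longleftrightarrow> coprime x (int n)"
  using n_pos by (simp add: coprime_iff_gcd_eq_1 gcd_mod_left)

lemma sum_not_coprime_shift: "(\<Sum>m\<in>Res. of_bool (\<not> coprime (m - x) (int n))) = real noncoprimes"
proof -
  have "(\<Sum>m\<in>Res. of_bool (\<not> coprime (m + - x) (int n))) = (\<Sum>m\<in>Res. of_bool (\<not> coprime m (int n)) :: real)"
    by (rule sum_periodic_shift[OF n_pos_int]) (simp add: coprime_mod_n)
  also have "\<dots> = real noncoprimes" by (simp add: noncoprimes_def of_bool_def sum.If_cases Int_def)
  finally show ?thesis by simp
qed

text \<open>The symbol of a product of two squares is 1 unless m - x or m - y shares a factor with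
  n, and each exception occurs for \<open>noncoprimes\<close> values of m.\<close>

lemma E_paired: "\<bar>E x x y y - 1\<bar> \<le> 2 * real noncoprimes / real n"
proof -
  let ?j = "\<lambda>m. real_of_int (Jacobi ((m - x) * (m - x) * (m - y) * (m - y)) n)"
  let ?u = "\<lambda>m z. of_bool (\<not> coprime (m - z) (int n)) :: real"
  have sq: "real_of_int (Jacobi z n * Jacobi z n) = of_bool (coprime z (int n))" for z
    using Jacobi_values[of z n] Jacobi_eq_0_iff[of n z] n_pos by auto
  have j: "?j m = of_bool (coprime (m - x) (int n)) * of_bool (coprime (m - y) (int n))" for m
    unfolding sq[symmetric] Jacobi_mult[OF odd_n] by simp
  have "E x x y y - 1 = (\<Sum>m\<in>Res. ?j m - 1) / real n"
    unfolding E_def using n_pos by (simp add: sum_subtractf field_simps)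
  then have "\<bar>E x x y y - 1\<bar> = \<bar>\<Sum>m\<in>Res. ?j m - 1\<bar> / real n" by simp
  also have "\<dots> \<le> (\<Sum>m\<in>Res. ?u m x + ?u m y) / real n"
    by (intro divide_right_mono order_trans[OF sum_abs] sum_mono) (auto simp: j)
  also have "(\<Sum>m\<in>Res. ?u m x + ?u m y) = 2 * real noncoprimes"
    unfolding sum.distrib sum_not_coprime_shift by simp
  finally show ?thesis .
qed

lemma E_commute: "E a b c d = E a c b d" "E a b c d = E a d b c"
  by (simp_all add: E_def mult_ac)

text \<open>The complete sum factors into one over P and one over the cofactor. The cofactor is
  bounded trivially. Without collisions distinct shifts remain distinct modulo P, so they stay
  unpaired there and the saving P^(3/4) / P applies.\<close>

lemma E_generic:
  assumes P: "P \<in> prime_factors n" and abcd: "\<not> paired a b c d"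
    and T: "T a b = 0" "T a c = 0" "T a d = 0" "T b c = 0" "T b d = 0" "T c d = 0"
  shows "\<bar>E a b c d\<bar> \<le> 5 * real P powr (-1/4)"
proof -
  have "prime P" "P dvd n" using P by auto
  then obtain m where m: "n = P * m" "m > 0" "coprime P m" "P > 2" by (rule prime_divisor_cases)
  interpret op: odd_prime P by unfold_locales (use \<open>prime P\<close> m in auto)
  have im: "x = y" if "[x = y] (mod int P)" "T x y = 0" for x y
  proof (rule ccontr)
    assume "x \<noteq> y"
    moreover have "int P dvd x - y" using that(1) by (simp add: cong_iff_dvd_diff)
    ultimately have "x \<noteq> y \<and> (\<exists>P\<in>prime_factors n. int P dvd x - y)" using P by blast
    then have "T x y = 1" by (simp add: T_def)
    then show False using that(2) by simp
  qed
  let ?f = "\<lambda>x. (x - a) * (x - b) * (x - c) * (x - d)"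
  have "(\<Sum>x\<in>Res. real_of_int (Jacobi (?f x) n)) = (\<Sum>x\<in>{0..<int P * int m}. op.chi (?f x) * real_of_int (Jacobi (?f x) m))"
    using Jacobi_prime_mult[OF \<open>prime P\<close> m(2)] by (simp add: op.chi_def m(1))
  also have "\<dots> = (\<Sum>x\<in>{0..<int P}. op.chi (?f x)) * (\<Sum>x\<in>{0..<int m}. real_of_int (Jacobi (?f x) m))"
  proof (rule sum_periodic_crt)
    show "op.chi (?f (x mod int P)) = op.chi (?f x)" for x
      by (intro op.chi_cong cong_mult cong_diff) (auto simp: cong_def)
    show "real_of_int (Jacobi (?f (x mod int m)) m) = real_of_int (Jacobi (?f x) m)" for x
    proof -
      have "[?f (x mod int m) = ?f x] (mod int m)" by (intro cong_mult cong_diff) (auto simp: cong_def)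
      then show ?thesis by (metis Jacobi_mod cong_def)
    qed
  qed (use m in auto)
  finally have "\<bar>\<Sum>x\<in>Res. real_of_int (Jacobi (?f x) n)\<bar> =
     \<bar>\<Sum>x\<in>{0..<int P}. op.chi (?f x)\<bar> * \<bar>\<Sum>x\<in>{0..<int m}. real_of_int (Jacobi (?f x) m)\<bar>" by (simp add: abs_mult)
  also have "\<dots> \<le> (5 * real P powr (3/4)) * real m"
  proof (intro mult_mono)
    show "\<bar>\<Sum>x\<in>{0..<int P}. op.chi (?f x)\<bar> \<le> 5 * real P powr (3/4)"
      by (rule op.sum_chi_quartic) (use abcd im T in \<open>auto simp: paired_def\<close>)
    have "\<bar>\<Sum>x\<in>{0..<int m}. real_of_int (Jacobi (?f x) m)\<bar> \<le> (\<Sum>x\<in>{0..<int m}. 1)"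
      by (rule order_trans[OF sum_abs]) (intro sum_mono abs_Jacobi_le)
    then show "\<bar>\<Sum>x\<in>{0..<int m}. real_of_int (Jacobi (?f x) m)\<bar> \<le> real m" by simp
  qed auto
  finally have "\<bar>E a b c d\<bar> \<le> (5 * real P powr (3/4)) * real m / real n"
    unfolding E_def using n_pos by (simp add: divide_right_mono)
  also have "\<dots> = 5 * (real P powr (3/4) / real P)" using m by simp
  also have "real P powr (3/4) / real P = real P powr (-1/4)"
    using m powr_diff[of "real P" "3/4" 1] by simp
  finally show ?thesis .
qed

lemma E_approx:
  assumes P: "P \<in> prime_factors n"
  shows "\<bar>E a b c d - of_bool (paired a b c d)\<bar> \<le> (2 * real noncoprimes / real n + 5 * real P powr (-1/4))
     + (T a b + T a c + T a d + T b c + T b d + T c d)"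
proof -
  have T0: "T x y \<ge> 0" for x y by (simp add: T_def)
  have T1: "T x y = 0 \<or> T x y = 1" for x y unfolding T_def of_bool_def by presburger
  have p0: "real P powr (-1/4) \<ge> 0" by simp
  have N: "2 * real noncoprimes / real n \<ge> 0" by simp
  show ?thesis
  proof (cases "paired a b c d")
    case True
    then have "\<bar>E a b c d - 1\<bar> \<le> 2 * real noncoprimes / real n"
      unfolding paired_def using E_paired E_commute by metis
    moreover have "of_bool (paired a b c d) = (1::real)" using True by simp
    ultimately show ?thesis using T0[of a b] T0[of a c] T0[of a d] T0[of b c] T0[of b d] T0[of c d] p0 by linarith
  next
    case np: False
    have z: "of_bool (paired a b c d) = (0::real)" using np by simp
    show ?thesis
    proof (cases "T a b = 0 \<and> T a c = 0 \<and> T a d = 0 \<and> T b c = 0 \<and> T b d = 0 \<and> T c d = 0")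
      case True
      then have "\<bar>E a b c d\<bar> \<le> 5 * real P powr (-1/4)" using E_generic[OF P np] by blast
      then show ?thesis using z True N by linarith
    next
      case False
      \<comment> \<open>With at least one collision the right-hand side is at least 1, which already
        dominates the trivial bound on E.\<close>
      then have "T a b + T a c + T a d + T b c + T b d + T c d \<ge> 1"
        using T0[of a b] T0[of a c] T0[of a d] T0[of b c] T0[of b d] T0[of c d]
          T1[of a b] T1[of a c] T1[of a d] T1[of b c] T1[of b d] T1[of c d] by linarith
      then show ?thesis using E_le_1[of a b c d] z N p0 by linarith
    qed
  qed
qed

lemma sum_norm_w_le: "(\<Sum>u\<in>Res. cmod (w s u)) \<le> 4 * harm n"
proof -
  have "(\<Sum>u\<in>Res. cmod (w s u)) \<le> (\<Sum>u\<in>Res. 2 * odd_recip u + 2 * odd_recip (int n - 1 - u))"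
    unfolding norm_w odd_recip_def using norm_W_le by (intro sum_mono) auto
  also have "\<dots> = 2 * (\<Sum>u\<in>Res. odd_recip u) + 2 * (\<Sum>u\<in>Res. odd_recip (int n - 1 - u))"
    by (simp add: sum.distrib sum_distrib_left)
  also have "(\<Sum>u\<in>Res. odd_recip (int n - 1 - u)) = (\<Sum>u\<in>Res. odd_recip u)" by (rule sum_reflect)
  finally show ?thesis using sum_odd_recip_le[of n] by simp
qed

text \<open>A union bound over the prime factors reduces T to congruence modulo one prime. With at
  most two primes, each at least p, the constant is 2 * 16.\<close>

lemma sum_norm_w_T_le:
  assumes "p > 0" "\<And>P. P \<in> prime_factors n \<Longrightarrow> p \<le> P" "card (prime_factors n) \<le> 2"
  shows "(\<Sum>a\<in>Res. \<Sum>b\<in>Res. cmod (w s a) * cmod (w s b) * T a b) \<le> 32 * (harm n)\<^sup>2 / real p"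
proof -
  have "(\<Sum>a\<in>Res. \<Sum>b\<in>Res. cmod (w s a) * cmod (w s b) * T a b)
     \<le> (\<Sum>a\<in>Res. \<Sum>b\<in>Res. \<Sum>P\<in>prime_factors n. cmod (W a) * cmod (W b) * of_bool (a \<noteq> b \<and> int P dvd a - b))"
  proof (intro sum_mono)
    fix a b
    have "T a b \<le> (\<Sum>P\<in>prime_factors n. of_bool (a \<noteq> b \<and> int P dvd a - b))"
    proof (cases "a \<noteq> b \<and> (\<exists>P\<in>prime_factors n. int P dvd a - b)")
      case True
      then obtain P where "P \<in> prime_factors n" "int P dvd a - b" "a \<noteq> b" by blast
      then have "T a b \<le> of_bool (a \<noteq> b \<and> int P dvd a - b)" by (simp add: T_def)
      also have "\<dots> \<le> (\<Sum>P\<in>prime_factors n. of_bool (a \<noteq> b \<and> int P dvd a - b))"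
        using \<open>P \<in> prime_factors n\<close> by (intro member_le_sum) auto
      finally show ?thesis .
    next
      case False
      then have "T a b = 0" by (simp add: T_def)
      then show ?thesis by (simp add: sum_nonneg)
    qed
    then have "cmod (W a) * cmod (W b) * T a b \<le> cmod (W a) * cmod (W b) * (\<Sum>P\<in>prime_factors n. of_bool (a \<noteq> b \<and> int P dvd a - b))"
      by (intro mult_left_mono) auto
    then show "cmod (w s a) * cmod (w s b) * T a b \<le> (\<Sum>P\<in>prime_factors n. cmod (W a) * cmod (W b) * of_bool (a \<noteq> b \<and> int P dvd a - b))"
      unfolding norm_w sum_distrib_left .
  qed
  also have "\<dots> = (\<Sum>a\<in>Res. \<Sum>P\<in>prime_factors n. \<Sum>b\<in>Res. cmod (W a) * cmod (W b) * of_bool (a \<noteq> b \<and> int P dvd a - b))"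
    by (intro sum.cong refl sum.swap)
  also have "\<dots> = (\<Sum>P\<in>prime_factors n. \<Sum>a\<in>Res. \<Sum>b\<in>Res. cmod (W a) * cmod (W b) * of_bool (a \<noteq> b \<and> int P dvd a - b))"
    by (rule sum.swap)
  also have "\<dots> \<le> (\<Sum>P\<in>prime_factors n. 16 * (harm n)\<^sup>2 / real p)"
  proof (rule sum_mono)
    fix P assume P: "P \<in> prime_factors n"
    then have "prime P" "P dvd n" by auto
    have "(\<Sum>a\<in>Res. \<Sum>b\<in>Res. cmod (W a) * cmod (W b) * of_bool (a \<noteq> b \<and> int P dvd a - b)) \<le> 16 * (harm n)\<^sup>2 / real_of_int (int P)"
    proof (rule sum_kernel_pairs_le)
      show "2 \<le> int P" using prime_ge_2_nat[OF \<open>prime P\<close>] by simp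
      show "int P dvd int n" using \<open>P dvd n\<close> by simp
      show "0 \<le> cmod (W u) \<and> cmod (W u) \<le> 2 * odd_recip u + 2 * odd_recip (int n - 1 - u)" if "u \<in> Res" for u
        using norm_W_le[OF that] by (simp add: odd_recip_def)
    qed
    also have "\<dots> \<le> 16 * (harm n)\<^sup>2 / real p"
      using assms(1) assms(2)[OF P] by (intro divide_left_mono) auto
    finally show "(\<Sum>a\<in>Res. \<Sum>b\<in>Res. cmod (W a) * cmod (W b) * of_bool (a \<noteq> b \<and> int P dvd a - b)) \<le> 16 * (harm n)\<^sup>2 / real p" .
  qed
  also have "\<dots> = real (card (prime_factors n)) * (16 * (harm n)\<^sup>2 / real p)" by simp
  also have "\<dots> \<le> 2 * (16 * (harm n)\<^sup>2 / real p)"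
    using assms(3) by (intro mult_right_mono) auto
  finally show ?thesis by simp
qed

end

section \<open>The norm of the character polynomial\<close>

lemma coeff_rotation:
  "poly.coeff (rotation n r A) j = (if j < n then poly.coeff A (nat ((int j + \<lfloor>real n * r\<rfloor>) mod int n)) else 0)"
  by (simp add: rotation_def coeff_sum)

text \<open>The difference between the harmonic number and the logarithm is decreasing and equals 1
  at the start.\<close>

lemma harm_le_ln:
  assumes "n > 0"
  shows "harm n \<le> 1 + ln (real n)"
proof -
  obtain m where m: "n = Suc m" using assms by (cases n) auto
  have "harm (Suc m) - ln (real (Suc m)) \<le> harm (Suc 0) - ln (real (Suc 0))"
    using decseq_harm_diff_ln by (rule decseqD) simp
  then show ?thesis by (simp add: m harm_expand)
qed

context odd_squarefree
begin

lemma coeff_char_poly: "poly.coeff (char_poly n) j = (if j < n then J (int j) else 0)"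
proof -
  have "poly.coeff (char_poly n) j = (if j \<in> {1..n-1} then of_int (Jacobi (int j) n) else 0)"
    by (simp add: char_poly_def coeff_sum)
  moreover have "Jacobi 0 n = 0" using Jacobi_eq_0_iff[of n 0] n_gt_1 by simp
  ultimately show ?thesis using n_pos by (cases "j = 0") (auto simp: J_def)
qed

lemma nat_mod_less: "nat (x mod int n) < n"
  using n_pos by (simp add: nat_less_iff)

lemma coeff_rotation_char_poly:
  "poly.coeff (rotation n r (char_poly n)) j = (if j < n then J (int j + \<lfloor>real n * r\<rfloor>) else 0)"
  using nat_mod_less n_pos by (simp add: coeff_rotation coeff_char_poly J_mod)

lemma poly_rotation_char_poly:
  "poly (rotation n r (char_poly n)) (zeta M k) = (\<Sum>j\<in>Res. J (j + \<lfloor>real n * r\<rfloor>) * zeta M (k * j))"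
  by (subst poly_zeta[of n]) (auto simp: coeff_rotation_char_poly intro!: sum.cong)

text \<open>At an n-th root of unity the cyclic shift of the coefficients only contributes a
  unimodular factor, and the rest is a Gauss sum.\<close>

lemma norm_rotation_at_even_root:
  "cmod (poly (rotation n r (char_poly n)) (zeta (2*n) (2*m))) = cmod (J m) * cmod G"
proof -
  define s where "s = \<lfloor>real n * r\<rfloor>"
  have "poly (rotation n r (char_poly n)) (zeta (2*n) (2*m)) = (\<Sum>j\<in>Res. J (j + s) * zeta n (m * j))"
    unfolding poly_rotation_char_poly s_def by (simp add: mult.assoc zeta_double)
  also have "\<dots> = zeta n (- (m * s)) * (\<Sum>j\<in>Res. J (j + s) * zeta n (m * (j + s)))"
    unfolding sum_distrib_left by (intro sum.cong refl) (simp add: ring_distribs zeta_add cnj_zeta[symmetric] mult_ac complex_norm_square[symmetric])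
  also have "(\<Sum>j\<in>Res. J (j + s) * zeta n (m * (j + s))) = (\<Sum>j\<in>Res. J j * zeta n (m * j))"
    by (rule sum_periodic_shift[OF n_pos_int]) (simp add: J_mod zeta_mult_mod)
  finally show ?thesis by (simp add: Gauss_sum norm_mult)
qed

text \<open>Multiplying by G lets each J(j + s) G be replaced by its Fourier expansion. After
  exchanging the sums, the inner sum over j is n times the kernel at k + m. A final shift by m,
  allowed by periodicity, centres the kernel.\<close>

lemma rotation_at_odd_root:
  defines "s \<equiv> \<lambda>r. \<lfloor>real n * r\<rfloor>"
  shows "poly (rotation n r (char_poly n)) (zeta (2*n) (2*m+1)) * G
    = of_nat n * zeta n (- (s r * m)) * (\<Sum>u\<in>Res. w (s r) u * J (u - m))"
proof -
  let ?s = "s r"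
  have "poly (rotation n r (char_poly n)) (zeta (2*n) (2*m+1)) * G = (\<Sum>j\<in>Res. zeta (2*n) ((2*m+1) * j) * (J (j + ?s) * G))"
    unfolding poly_rotation_char_poly s_def sum_distrib_right by (intro sum.cong refl) (simp only: mult_ac)
  also have "\<dots> = (\<Sum>j\<in>Res. \<Sum>k\<in>Res. zeta (2*n) ((2*m+1) * j) * (J k * zeta n ((j + ?s) * k)))"
    unfolding Gauss_sum[symmetric] by (simp only: sum_distrib_left)
  also have "\<dots> = (\<Sum>k\<in>Res. \<Sum>j\<in>Res. zeta (2*n) ((2*m+1) * j) * (J k * zeta n ((j + ?s) * k)))"
    by (rule sum.swap)
  also have "\<dots> = (\<Sum>k\<in>Res. of_nat n * (J k * zeta n (?s * k) * W (k + m)))"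
  proof (intro sum.cong refl)
    fix k
    have "(\<Sum>j\<in>Res. zeta (2*n) ((2*m+1) * j) * (J k * zeta n ((j + ?s) * k))) = (\<Sum>j\<in>Res. (J k * zeta n (?s * k)) * zeta (2*n) ((2*(k+m)+1) * j))"
    proof (intro sum.cong refl)
      fix j
      have "zeta n ((j + ?s) * k) = zeta n (?s * k) * zeta (2*n) (2 * (j * k))"
        unfolding zeta_double by (simp add: zeta_add[symmetric] algebra_simps)
      moreover have "zeta (2*n) ((2*m+1) * j) * zeta (2*n) (2 * (j * k)) = zeta (2*n) ((2*(k+m)+1) * j)"
        by (simp add: zeta_add[symmetric] algebra_simps)
      ultimately show "zeta (2*n) ((2*m+1) * j) * (J k * zeta n ((j + ?s) * k)) = (J k * zeta n (?s * k)) * zeta (2*n) ((2*(k+m)+1) * j)"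
        by (simp add: mult_ac)
    qed
    also have "\<dots> = of_nat n * (J k * zeta n (?s * k) * W (k + m))"
      unfolding W_def sum_distrib_left[symmetric] using n_pos by simp
    finally show "(\<Sum>j\<in>Res. zeta (2*n) ((2*m+1) * j) * (J k * zeta n ((j + ?s) * k))) = of_nat n * (J k * zeta n (?s * k) * W (k + m))" .
  qed
  also have "\<dots> = of_nat n * (\<Sum>k\<in>Res. J ((k + m) - m) * zeta n (?s * ((k + m) - m)) * W (k + m))"
    by (simp add: sum_distrib_left)
  also have "(\<Sum>k\<in>Res. J ((k + m) - m) * zeta n (?s * ((k + m) - m)) * W (k + m)) = (\<Sum>u\<in>Res. J (u - m) * zeta n (?s * (u - m)) * W u)"
  proof (rule sum_periodic_shift[OF n_pos_int])
    fix u
    have "J (u mod int n - m) = J (u - m)" by (metis J_mod mod_diff_left_eq)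
    moreover have "zeta n (?s * (u mod int n - m)) = zeta n (?s * (u - m))"
      by (intro zeta_cong n_pos cong_mult cong_diff) (auto simp: cong_def)
    ultimately show "J (u mod int n - m) * zeta n (?s * (u mod int n - m)) * W (u mod int n) = J (u - m) * zeta n (?s * (u - m)) * W u"
      by (simp add: W_mod)
  qed
  also have "\<dots> = zeta n (- (?s * m)) * (\<Sum>u\<in>Res. w ?s u * J (u - m))"
    unfolding sum_distrib_left
    by (intro sum.cong refl) (simp add: w_def right_diff_distrib zeta_diff cnj_zeta mult_ac)
  finally show ?thesis by (simp add: mult.assoc)
qed

lemma norm_rotation_at_odd_root:
  "cmod (poly (rotation n r (char_poly n)) (zeta (2*n) (2*m+1))) ^ 4
   = (real n)\<^sup>2 * cmod (\<Sum>u\<in>Res. w \<lfloor>real n * r\<rfloor> u * J (u - m)) ^ 4"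
proof -
  \<comment> \<open>Raising |A| |G| = n |y| to the fourth power and using |G|^2 = n turns n^4 into
    n^2 without division by G.\<close>
  have alg: "x ^ 4 * (g\<^sup>2)\<^sup>2 = N\<^sup>2 * (N\<^sup>2 * y ^ 4)" if "x * g = N * y" for x g N y :: real
  proof -
    have "x ^ 4 * (g\<^sup>2)\<^sup>2 = (x * g) ^ 4" by (simp add: power_mult_distrib)
    also have "\<dots> = N\<^sup>2 * (N\<^sup>2 * y ^ 4)" unfolding that by (simp add: power_mult_distrib flip: power_add mult.assoc)
    finally show ?thesis .
  qed
  have "cmod (poly (rotation n r (char_poly n)) (zeta (2*n) (2*m+1))) * cmod G
     = real n * cmod (\<Sum>u\<in>Res. w \<lfloor>real n * r\<rfloor> u * J (u - m))"
    using arg_cong[OF rotation_at_odd_root[of r m], of cmod] by (simp add: norm_mult)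
  then have "cmod (poly (rotation n r (char_poly n)) (zeta (2*n) (2*m+1))) ^ 4 * ((cmod G)\<^sup>2)\<^sup>2
     = (real n)\<^sup>2 * ((real n)\<^sup>2 * cmod (\<Sum>u\<in>Res. w \<lfloor>real n * r\<rfloor> u * J (u - m)) ^ 4)"
    by (rule alg)
  then have "(real n)\<^sup>2 * cmod (poly (rotation n r (char_poly n)) (zeta (2*n) (2*m+1))) ^ 4
     = (real n)\<^sup>2 * ((real n)\<^sup>2 * cmod (\<Sum>u\<in>Res. w \<lfloor>real n * r\<rfloor> u * J (u - m)) ^ 4)"
    unfolding norm_G by (simp only: mult.commute)
  moreover have "(real n)\<^sup>2 \<noteq> 0" using n_pos by simp
  ultimately show ?thesis by (rule mult_left_cancel[THEN iffD1, rotated])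
qed

definition Q :: "int \<Rightarrow> complex" where
  "Q s = (\<Sum>a\<in>Res. \<Sum>b\<in>Res. \<Sum>c\<in>Res. \<Sum>d\<in>Res. w s a * w s b * cnj (w s c) * cnj (w s d) * of_real (E a b c d))"

text \<open>The symbol is real, so conjugation only touches the weights. The sum over m then acts on
  the product of four symbols alone and yields n times their correlation.\<close>

lemma sum_fourth_powers: "complex_of_real (\<Sum>m\<in>Res. cmod (\<Sum>u\<in>Res. w s u * J (u - m)) ^ 4) = of_nat n * Q s"
proof -
  let ?q = "\<lambda>a b c d. w s a * w s b * cnj (w s c) * cnj (w s d)"
  let ?j = "\<lambda>m a b c d. complex_of_real (real_of_int (Jacobi ((m - a) * (m - b) * (m - c) * (m - d)) n))"
  have "complex_of_real (cmod (\<Sum>u\<in>Res. w s u * J (u - m)) ^ 4) = (\<Sum>a\<in>Res. \<Sum>b\<in>Res. \<Sum>c\<in>Res. \<Sum>d\<in>Res. ?q a b c d * ?j m a b c d)" for m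
  proof -
    let ?S = "\<Sum>u\<in>Res. w s u * J (u - m)"
    have cS: "cnj ?S = (\<Sum>u\<in>Res. cnj (w s u) * J (u - m))" by (simp add: J_def)
    have "complex_of_real (cmod ?S ^ 4) = (of_real ((cmod ?S)\<^sup>2))\<^sup>2" by simp
    also have "\<dots> = ?S * (?S * (cnj ?S * cnj ?S))" unfolding complex_norm_square by (simp only: power2_eq_square mult_ac)
    also have "\<dots> = (\<Sum>a\<in>Res. \<Sum>b\<in>Res. \<Sum>c\<in>Res. \<Sum>d\<in>Res. (w s a * J (a - m)) * ((w s b * J (b - m)) * ((cnj (w s c) * J (c - m)) * (cnj (w s d) * J (d - m)))))"
      unfolding cS sum_product unfolding sum_distrib_left ..
    also have "\<dots> = (\<Sum>a\<in>Res. \<Sum>b\<in>Res. \<Sum>c\<in>Res. \<Sum>d\<in>Res. ?q a b c d * ?j m a b c d)"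
    proof (intro sum.cong refl)
      fix a b c d
      \<comment> \<open>Four sign changes cancel, so the value of the symbol at -1 never
        enters.\<close>
      have "(m - a) * (m - b) * (m - c) * (m - d) = (a - m) * (b - m) * (c - m) * (d - m)" by (simp add: algebra_simps)
      then have "?j m a b c d = J (a - m) * J (b - m) * J (c - m) * J (d - m)"
        by (simp only: J_def of_real_of_int_eq Jacobi_mult[OF odd_n] of_int_mult of_real_mult)
      then show "(w s a * J (a - m)) * ((w s b * J (b - m)) * ((cnj (w s c) * J (c - m)) * (cnj (w s d) * J (d - m)))) = ?q a b c d * ?j m a b c d"
        by (simp only: mult_ac)
    qed
    finally show ?thesis .
  qed
  then have "complex_of_real (\<Sum>m\<in>Res. cmod (\<Sum>u\<in>Res. w s u * J (u - m)) ^ 4) = (\<Sum>m\<in>Res. \<Sum>a\<in>Res. \<Sum>b\<in>Res. \<Sum>c\<in>Res. \<Sum>d\<in>Res. ?q a b c d * ?j m a b c d)"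
    by simp
  also have "\<dots> = (\<Sum>a\<in>Res. \<Sum>m\<in>Res. \<Sum>b\<in>Res. \<Sum>c\<in>Res. \<Sum>d\<in>Res. ?q a b c d * ?j m a b c d)" by (rule sum.swap)
  also have "\<dots> = (\<Sum>a\<in>Res. \<Sum>b\<in>Res. \<Sum>m\<in>Res. \<Sum>c\<in>Res. \<Sum>d\<in>Res. ?q a b c d * ?j m a b c d)" by (intro sum.cong refl sum.swap)
  also have "\<dots> = (\<Sum>a\<in>Res. \<Sum>b\<in>Res. \<Sum>c\<in>Res. \<Sum>m\<in>Res. \<Sum>d\<in>Res. ?q a b c d * ?j m a b c d)" by (intro sum.cong refl sum.swap)
  also have "\<dots> = (\<Sum>a\<in>Res. \<Sum>b\<in>Res. \<Sum>c\<in>Res. \<Sum>d\<in>Res. \<Sum>m\<in>Res. ?q a b c d * ?j m a b c d)" by (intro sum.cong refl sum.swap)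
  also have "\<dots> = (\<Sum>a\<in>Res. \<Sum>b\<in>Res. \<Sum>c\<in>Res. \<Sum>d\<in>Res. of_nat n * (?q a b c d * of_real (E a b c d)))"
  proof (intro sum.cong refl)
    fix a b c d
    have "(\<Sum>m\<in>Res. ?j m a b c d) = of_nat n * of_real (E a b c d)" using n_pos by (simp add: E_def)
    then show "(\<Sum>m\<in>Res. ?q a b c d * ?j m a b c d) = of_nat n * (?q a b c d * of_real (E a b c d))"
      unfolding sum_distrib_left[symmetric] by (simp only: mult_ac)
  qed
  also have "\<dots> = of_nat n * Q s" unfolding Q_def sum_distrib_left ..
  finally show ?thesis .
qed

lemma sum_norm_J_4: "(\<Sum>m\<in>Res. cmod (J m) ^ 4) = real n - real noncoprimes"
proof -
  have "cmod (J m) ^ 4 = ((cmod (J m))\<^sup>2)\<^sup>2" for m by simp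
  then have "cmod (J m) ^ 4 = 1 - of_bool (\<not> coprime (m - 0) (int n))" for m unfolding norm_J by simp
  then have "(\<Sum>m\<in>Res. cmod (J m) ^ 4) = (\<Sum>m\<in>Res. 1 - of_bool (\<not> coprime (m - 0) (int n)))" by simp
  then show ?thesis unfolding sum_subtractf sum_not_coprime_shift by simp
qed

lemma Lnorm_4_char_poly:
  "complex_of_real (Lnorm 4 (rotation n r (char_poly n)) ^ 4 / (real n)\<^sup>2)
    = of_real ((real n - real noncoprimes) / (2 * real n)) + Q \<lfloor>real n * r\<rfloor> / 2"
proof -
  let ?A = "rotation n r (char_poly n)" and ?s = "\<lfloor>real n * r\<rfloor>"
  let ?X = "\<Sum>m\<in>Res. cmod (\<Sum>u\<in>Res. w ?s u * J (u - m)) ^ 4"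
  have "Lnorm 4 ?A ^ 4 = (\<Sum>k\<in>{0..<int (2*n)}. cmod (poly ?A (zeta (2*n) k)) ^ 4) / (2 * real n)"
    by (rule Lnorm_4_power_4[OF _ n_pos]) (simp add: coeff_rotation)
  also have "(\<Sum>k\<in>{0..<int (2*n)}. cmod (poly ?A (zeta (2*n) k)) ^ 4)
     = (\<Sum>m\<in>Res. cmod (poly ?A (zeta (2*n) (2*m))) ^ 4) + (\<Sum>m\<in>Res. cmod (poly ?A (zeta (2*n) (2*m+1))) ^ 4)"
    by (rule sum_even_odd)
  also have "(\<Sum>m\<in>Res. cmod (poly ?A (zeta (2*n) (2*m))) ^ 4) = (\<Sum>m\<in>Res. cmod (J m) ^ 4) * ((cmod G)\<^sup>2)\<^sup>2"
    unfolding norm_rotation_at_even_root by (simp add: power_mult_distrib sum_distrib_right)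
  also have "\<dots> = (real n - real noncoprimes) * (real n)\<^sup>2" unfolding sum_norm_J_4 norm_G ..
  also have "(\<Sum>m\<in>Res. cmod (poly ?A (zeta (2*n) (2*m+1))) ^ 4) = (real n)\<^sup>2 * ?X"
    unfolding norm_rotation_at_odd_root by (simp add: sum_distrib_left)
  also have "((real n - real noncoprimes) * (real n)\<^sup>2 + (real n)\<^sup>2 * ?X) / (2 * real n)
      = (real n)\<^sup>2 * ((real n - real noncoprimes) / (2 * real n) + ?X / (2 * real n))"
    by (simp only: add_divide_distrib ring_distribs times_divide_eq_right mult_ac)
  finally have "Lnorm 4 ?A ^ 4 / (real n)\<^sup>2 = (real n - real noncoprimes) / (2 * real n) + ?X / (2 * real n)"
    using n_pos by simp
  then have "complex_of_real (Lnorm 4 ?A ^ 4 / (real n)\<^sup>2) = complex_of_real ((real n - real noncoprimes) / (2 * real n) + ?X / (2 * real n))"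
    by (rule arg_cong)
  also have "\<dots> = of_real ((real n - real noncoprimes) / (2 * real n)) + of_real ?X / (2 * of_nat n)"
    by simp
  also have "of_real ?X / (2 * of_nat n) = Q ?s / 2" unfolding sum_fourth_powers using n_pos by simp
  finally show ?thesis .
qed

lemma Lnorm_4_char_poly_approx:
  fixes r :: real and p :: nat
  defines "t \<equiv> (- (2 * \<lfloor>real n * r\<rfloor>)) mod int n"
  assumes p: "p \<in> prime_factors n" "\<And>P. P \<in> prime_factors n \<Longrightarrow> p \<le> P" "card (prime_factors n) \<le> 2"
  shows "\<bar>Lnorm 4 (rotation n r (char_poly n)) ^ 4 / (real n)\<^sup>2
      - (7 / 6 + ((2 * real_of_int t + 2 - real n) / real n)\<^sup>2 / 2 - 2 / (3 * (real n)\<^sup>2))\<bar>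
    \<le> real noncoprimes / real n + (2 * real noncoprimes / real n + 5 * real p powr (-1/4)) * (4 * harm n) ^ 4
        + 6 * ((4 * harm n)\<^sup>2 * (32 * (harm n)\<^sup>2 / real p))"
proof -
  define s where "s = \<lfloor>real n * r\<rfloor>"
  define \<eta> where "\<eta> = 2 * real noncoprimes / real n + 5 * real p powr (-1/4)"
  define H where "H = (\<Sum>a\<in>Res. cmod (w s a))"
  define K where "K = (\<Sum>a\<in>Res. \<Sum>b\<in>Res. cmod (w s a) * cmod (w s b) * T a b)"
  define M where "M = 2 * (\<Sum>a\<in>Res. (cmod (w s a))\<^sup>2)\<^sup>2 + (cmod (\<Sum>a\<in>Res. (w s a)\<^sup>2))\<^sup>2 - 2 * (\<Sum>a\<in>Res. cmod (w s a) ^ 4)"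
  define L where "L = Lnorm 4 (rotation n r (char_poly n)) ^ 4 / (real n)\<^sup>2"
  have p0: "p > 0" using p(1) by (auto intro: prime_gt_0_nat)
  \<comment> \<open>The first 2 is twice the squared unit mass of the kernel, the square comes from
    \<open>sum_w_square\<close>, and the last term is twice the fourth moment of the kernel. Half of
    this plus 1/2 is the main term.\<close>
  have M: "M = 2 + ((2 * real_of_int t + 2 - real n) / real n)\<^sup>2 - 2 * (1 / 3 + 2 / (3 * (real n)\<^sup>2))"
    unfolding M_def sum_w_square t_def s_def norm_w sum_norm_W_2 sum_norm_W_4 by (simp add: power_divide)
  have "cmod (Q s - of_real M) \<le> \<eta> * H ^ 4 + 6 * (H\<^sup>2 * K)"
    unfolding Q_def M_def H_def K_def
  proof (rule sum_quad_approx)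
    show "\<bar>E a b c d - of_bool (paired a b c d)\<bar> \<le> \<eta> + (T a b + T a c + T a d + T b c + T b d + T c d)" for a b c d
      unfolding \<eta>_def by (rule E_approx[OF p(1)])
  qed simp
  also have "\<dots> \<le> \<eta> * (4 * harm n) ^ 4 + 6 * ((4 * harm n)\<^sup>2 * (32 * (harm n)\<^sup>2 / real p))"
  proof -
    have H: "0 \<le> H" "H \<le> 4 * harm n" unfolding H_def using sum_norm_w_le[of s] by (auto intro: sum_nonneg)
    have K: "K \<le> 32 * (harm n)\<^sup>2 / real p" unfolding K_def by (rule sum_norm_w_T_le[OF p0 p(2,3)])
    have K0: "0 \<le> K" unfolding K_def T_def by (intro sum_nonneg) auto
    have \<eta>: "0 \<le> \<eta>" unfolding \<eta>_def by simp
    show ?thesis by (intro add_mono mult_mono power_mono) (use H K K0 \<eta> in auto)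
  qed
  finally have QM: "cmod (Q s - of_real M) \<le> \<eta> * (4 * harm n) ^ 4 + 6 * ((4 * harm n)\<^sup>2 * (32 * (harm n)\<^sup>2 / real p))" .
  have "complex_of_real (L - (1 / 2 + M / 2)) = of_real (- (real noncoprimes / (2 * real n))) + (Q s - of_real M) / 2"
    unfolding of_real_diff L_def Lnorm_4_char_poly s_def[symmetric] using n_pos by (simp add: field_simps)
  then have "\<bar>L - (1 / 2 + M / 2)\<bar> \<le> cmod (of_real (- (real noncoprimes / (2 * real n)))) + cmod ((Q s - of_real M) / 2)"
    by (metis norm_of_real norm_triangle_ineq)
  also have "\<dots> = real noncoprimes / (2 * real n) + cmod (Q s - of_real M) / 2"
    by (simp add: norm_divide del: of_real_divide of_real_minus)
  also have "\<dots> \<le> real noncoprimes / real n + cmod (Q s - of_real M)"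
    by (intro add_mono divide_left_mono) (use n_pos in auto)
  finally have "\<bar>L - (1 / 2 + M / 2)\<bar> \<le> real noncoprimes / real n + (\<eta> * (4 * harm n) ^ 4 + 6 * ((4 * harm n)\<^sup>2 * (32 * (harm n)\<^sup>2 / real p)))"
    using QM by linarith
  moreover have "1 / 2 + M / 2 = 7 / 6 + ((2 * real_of_int t + 2 - real n) / real n)\<^sup>2 / 2 - 2 / (3 * (real n)\<^sup>2)"
    unfolding M by (simp add: field_simps)
  ultimately show ?thesis unfolding L_def \<eta>_def by (simp add: add.assoc)
qed

text \<open>A residue not prime to n is a multiple of one of at most two primes P, and each P has
  n/P multiples in a period.\<close>

lemma noncoprimes_le:
  assumes "p > 0" "\<And>P. P \<in> prime_factors n \<Longrightarrow> p \<le> P" "card (prime_factors n) \<le> 2"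
  shows "real noncoprimes \<le> 2 * real n / real p"
proof -
  have sub: "{x \<in> Res. \<not> coprime x (int n)} \<subseteq> (\<Union>P\<in>prime_factors n. {x \<in> Res. int P dvd x})"
  proof
    fix x assume x: "x \<in> {x \<in> Res. \<not> coprime x (int n)}"
    then have "Jacobi x n = 0" using Jacobi_eq_0_iff[OF n_pos] by simp
    then have "\<exists>P\<in>prime_factors n. int P dvd x"
      unfolding Jacobi_def by (auto simp: prod_mset_zero_iff Legendre_eq_0_iff image_iff)
    then show "x \<in> (\<Union>P\<in>prime_factors n. {x \<in> Res. int P dvd x})" using x by auto
  qed
  have card_P: "real (card {x \<in> Res. int P dvd x}) \<le> real n / real p" if P: "P \<in> prime_factors n" for P
  proof -
    have "prime P" "P dvd n" using P by auto
    then obtain m where m: "n = P * m" "m > 0" "coprime P m" "P > 2" by (rule prime_divisor_cases)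
    have "{x \<in> Res. int P dvd x} \<subseteq> (\<lambda>k. int P * k) ` {0..<int m}"
    proof
      fix x assume x: "x \<in> {x \<in> Res. int P dvd x}"
      then obtain k where k: "x = int P * k" by blast
      have "0 \<le> int P * k" "int P * k < int P * int m" using x k m(1) by auto
      then have "0 \<le> k" "k < int m" using m(4) by (auto simp: zero_le_mult_iff)
      then show "x \<in> (\<lambda>k. int P * k) ` {0..<int m}" using k by auto
    qed
    then have "card {x \<in> Res. int P dvd x} \<le> card ((\<lambda>k. int P * k) ` {0..<int m})" by (rule card_mono[rotated]) simp
    also have "\<dots> \<le> m" using card_image_le[of "{0..<int m}" "\<lambda>k. int P * k"] by simp
    finally have "real (card {x \<in> Res. int P dvd x}) \<le> real n / real P" using m by simp
    also have "\<dots> \<le> real n / real p" using assms(1) assms(2)[OF P] by (intro divide_left_mono) auto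
    finally show ?thesis .
  qed
  have "real noncoprimes \<le> real (card (\<Union>P\<in>prime_factors n. {x \<in> Res. int P dvd x}))"
    unfolding noncoprimes_def of_nat_le_iff by (rule card_mono[OF _ sub]) (rule finite_subset[of _ Res], auto)
  also have "\<dots> \<le> real (\<Sum>P\<in>prime_factors n. card {x \<in> Res. int P dvd x})"
    unfolding of_nat_le_iff by (rule card_UN_le) simp
  also have "\<dots> \<le> (\<Sum>P\<in>prime_factors n. real n / real p)" unfolding of_nat_sum by (intro sum_mono card_P)
  also have "\<dots> = real (card (prime_factors n)) * (real n / real p)" by simp
  also have "\<dots> \<le> 2 * (real n / real p)" using assms(3) by (intro mult_right_mono) auto
  finally show ?thesis by simp
qed

end

section \<open>Perturbation by V and the limit\<close>

text \<open>If |y| \<le> e |x|, the fourth power changes by a factor between (1 - e)^4 and (1 +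
  e)^4, and 15 = 4 + 6 + 4 + 1. Otherwise |x| is at most |y| / e, and both fourth powers are bounded
  in terms of y alone.\<close>

lemma norm_add_power_4:
  fixes x y :: "'a::real_normed_vector"
  assumes "0 < e" "e \<le> 1"
  shows "\<bar>norm (x + y) ^ 4 - norm x ^ 4\<bar> \<le> 15 * e * norm x ^ 4 + (1 + 1 / e) ^ 4 * norm y ^ 4"
proof -
  define a b z where "a = norm x" and "b = norm y" and "z = norm (x + y)"
  have nn: "0 \<le> a" "0 \<le> b" "0 \<le> z" by (simp_all add: a_def b_def z_def)
  have zu: "z \<le> a + b" unfolding a_def b_def z_def by (rule norm_triangle_ineq)
  have zl: "a - b \<le> z" unfolding a_def b_def z_def using norm_diff_ineq[of x y] by simp
  have pb: "0 \<le> (1 + 1 / e) ^ 4 * b ^ 4" "0 \<le> 15 * e * a ^ 4" using assms by auto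
  have "\<bar>z ^ 4 - a ^ 4\<bar> \<le> 15 * e * a ^ 4 + (1 + 1 / e) ^ 4 * b ^ 4"
  proof (cases "b \<le> e * a")
    case True
    have "z ^ 4 \<le> ((1 + e) * a) ^ 4" using True zu nn by (intro power_mono) (auto simp: algebra_simps)
    also have "\<dots> = (1 + e) ^ 4 * a ^ 4" by (simp add: power_mult_distrib)
    also have "(1 + e) ^ 4 \<le> 1 + 15 * e"
    proof -
      have "(1 + e) ^ 4 = 1 + 4 * e + 6 * e\<^sup>2 + 4 * e ^ 3 + e ^ 4" by (simp add: power4_eq_xxxx power3_eq_cube power2_eq_square algebra_simps)
      moreover have "e\<^sup>2 \<le> e" "e ^ 3 \<le> e" "e ^ 4 \<le> e"
        using assms power_decreasing[of 1 2 e] power_decreasing[of 1 3 e] power_decreasing[of 1 4 e] by auto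
      ultimately show ?thesis by linarith
    qed
    finally have u: "z ^ 4 \<le> (1 + 15 * e) * a ^ 4" by (simp add: mult_right_mono)
    have "(1 - e) * a \<le> z" using True zl by (simp add: algebra_simps)
    then have "((1 - e) * a) ^ 4 \<le> z ^ 4" using assms nn by (intro power_mono) auto
    moreover have "(1 - 4 * e) * a ^ 4 \<le> (1 - e) ^ 4 * a ^ 4"
      using Bernoulli_inequality[of "- e" 4] assms by (intro mult_right_mono) auto
    ultimately have l: "(1 - 4 * e) * a ^ 4 \<le> z ^ 4" by (simp add: power_mult_distrib)
    have "0 \<le> e * a ^ 4" using assms by simp
    then have "\<bar>z ^ 4 - a ^ 4\<bar> \<le> 15 * e * a ^ 4" using u l by (simp add: algebra_simps abs_le_iff)
    then show ?thesis using pb by linarith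
  next
    case False
    then have ab: "a \<le> b / e" using assms by (simp add: field_simps)
    have "a + b \<le> (1 + 1 / e) * b" using ab by (simp add: algebra_simps)
    then have "z ^ 4 \<le> ((1 + 1 / e) * b) ^ 4" "a ^ 4 \<le> ((1 + 1 / e) * b) ^ 4" using zu nn by (auto intro!: power_mono)
    moreover have "0 \<le> z ^ 4" "0 \<le> a ^ 4" by auto
    ultimately have "\<bar>z ^ 4 - a ^ 4\<bar> \<le> (1 + 1 / e) ^ 4 * b ^ 4" unfolding power_mult_distrib by linarith
    then show ?thesis using pb by linarith
  qed
  then show ?thesis by (simp add: a_def b_def z_def)
qed

lemma Lnorm_4_add:
  assumes A: "\<And>j. j \<ge> N \<Longrightarrow> poly.coeff A j = 0" and B: "\<And>j. j \<ge> N \<Longrightarrow> poly.coeff B j = 0"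
    and N: "N > 0" and e: "0 < e" "e \<le> 1"
  shows "\<bar>Lnorm 4 (A + B) ^ 4 - Lnorm 4 A ^ 4\<bar> \<le> 15 * e * Lnorm 4 A ^ 4 + (1 + 1 / e) ^ 4 * Lnorm 4 B ^ 4"
proof -
  let ?I = "{0..<int (2*N)}"
  let ?a = "\<lambda>k. poly A (zeta (2*N) k)" and ?b = "\<lambda>k. poly B (zeta (2*N) k)"
  have LA: "Lnorm 4 A ^ 4 = (\<Sum>k\<in>?I. cmod (?a k) ^ 4) / (2 * real N)" by (rule Lnorm_4_power_4[OF A N])
  have LB: "Lnorm 4 B ^ 4 = (\<Sum>k\<in>?I. cmod (?b k) ^ 4) / (2 * real N)" by (rule Lnorm_4_power_4[OF B N])
  have "Lnorm 4 (A + B) ^ 4 = (\<Sum>k\<in>?I. cmod (poly (A + B) (zeta (2*N) k)) ^ 4) / (2 * real N)"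
    by (rule Lnorm_4_power_4[OF _ N]) (simp add: A B)
  then have LAB: "Lnorm 4 (A + B) ^ 4 = (\<Sum>k\<in>?I. cmod (?a k + ?b k) ^ 4) / (2 * real N)" by simp
  have "\<bar>Lnorm 4 (A + B) ^ 4 - Lnorm 4 A ^ 4\<bar> = \<bar>\<Sum>k\<in>?I. cmod (?a k + ?b k) ^ 4 - cmod (?a k) ^ 4\<bar> / (2 * real N)"
    unfolding LAB LA using N by (simp only: diff_divide_distrib[symmetric] sum_subtractf[symmetric] abs_divide abs_mult abs_numeral abs_of_nat)
  also have "\<dots> \<le> (\<Sum>k\<in>?I. 15 * e * cmod (?a k) ^ 4 + (1 + 1 / e) ^ 4 * cmod (?b k) ^ 4) / (2 * real N)"
    by (intro divide_right_mono order_trans[OF sum_abs] sum_mono norm_add_power_4 e) auto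
  also have "\<dots> = 15 * e * Lnorm 4 A ^ 4 + (1 + 1 / e) ^ 4 * Lnorm 4 B ^ 4"
    unfolding LA LB sum.distrib sum_distrib_left[symmetric] add_divide_distrib by simp
  finally show ?thesis .
qed

context odd_squarefree
begin

lemma norm_coeff_V:
  assumes "V \<in> V_set n"
  shows "cmod (poly.coeff V (nat (x mod int n))) = of_bool (\<not> coprime x (int n))"
proof -
  have "coprime (nat (x mod int n)) n \<longleftrightarrow> coprime (int (nat (x mod int n))) (int n)" by (simp only: coprime_int_iff)
  also have "\<dots> \<longleftrightarrow> coprime x (int n)" using n_pos by (simp add: coprime_mod_n)
  finally show ?thesis using assms nat_mod_less[of x] by (force simp: V_set_def)
qed

text \<open>V is supported exactly on the zeros of the symbol, and this survives the common
  rotation. Hence all n coefficients of the sum have modulus 1.\<close>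

lemma Lnorm_2_char_poly_plus_V:
  assumes "V \<in> V_set n"
  shows "Lnorm 2 (rotation n r (char_poly n) + rotation n r V) ^ 4 = (real n)\<^sup>2"
proof -
  let ?A = "rotation n r (char_poly n) + rotation n r V"
  have "Lnorm 2 ?A ^ 4 = (\<Sum>j<n. (cmod (poly.coeff ?A j))\<^sup>2)\<^sup>2"
    by (rule Lnorm_2_power_4) (simp add: coeff_rotation)
  also have "(\<Sum>j<n. (cmod (poly.coeff ?A j))\<^sup>2) = (\<Sum>j<n. 1)"
  proof (intro sum.cong refl)
    fix j assume "j \<in> {..<n}"
    then have j: "j < n" by simp
    define x where "x = int j + \<lfloor>real n * r\<rfloor>"
    have c: "poly.coeff ?A j = J x + poly.coeff V (nat (x mod int n))"
      using j coeff_rotation_char_poly[of r j] by (simp add: coeff_rotation x_def)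
    show "(cmod (poly.coeff ?A j))\<^sup>2 = 1"
    proof (cases "coprime x (int n)")
      case True
      then have "poly.coeff V (nat (x mod int n)) = 0" using norm_coeff_V[OF assms, of x] by simp
      then show ?thesis using True norm_J[of x] by (simp add: c del: coeff_add)
    next
      case False
      then have "J x = 0" using J_eq_0_iff by simp
      then show ?thesis using False norm_coeff_V[OF assms, of x] by (simp add: c del: coeff_add)
    qed
  qed
  finally show ?thesis by simp
qed

text \<open>Two of the four factors are bounded by the number of nonzero coefficients, each of
  modulus 1, and Parseval evaluates the mean of the other two as that same number.\<close>

lemma Lnorm_4_V_le:
  assumes "V \<in> V_set n"
  shows "Lnorm 4 (rotation n r V) ^ 4 \<le> real noncoprimes ^ 3"
proof -
  let ?B = "rotation n r V" and ?s = "\<lfloor>real n * r\<rfloor>"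
  have B0: "poly.coeff ?B j = 0" if "j \<ge> n" for j using that by (simp add: coeff_rotation)
  have cB: "cmod (poly.coeff ?B j) = of_bool (\<not> coprime (int j - (- ?s)) (int n))" if "j < n" for j
    using that norm_coeff_V[OF assms, of "int j + ?s"] by (simp add: coeff_rotation)
  have sB: "(\<Sum>j<n. cmod (poly.coeff ?B j)) = real noncoprimes"
  proof -
    have "(\<Sum>j<n. cmod (poly.coeff ?B j)) = (\<Sum>j<n. of_bool (\<not> coprime (int j - (- ?s)) (int n)))"
      by (intro sum.cong) (auto simp: cB)
    also have "\<dots> = (\<Sum>x\<in>Res. of_bool (\<not> coprime (x - (- ?s)) (int n)))" by (rule sum_int_interval[symmetric])
    finally show ?thesis unfolding sum_not_coprime_shift .
  qed
  have sB2: "(\<Sum>j<2*n. (cmod (poly.coeff ?B j))\<^sup>2) = real noncoprimes"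
  proof -
    have "(\<Sum>j<2*n. (cmod (poly.coeff ?B j))\<^sup>2) = (\<Sum>j<n. (cmod (poly.coeff ?B j))\<^sup>2)"
      by (rule sum.mono_neutral_right) (auto simp: B0)
    also have "\<dots> = (\<Sum>j<n. cmod (poly.coeff ?B j))" by (intro sum.cong) (auto simp: cB)
    finally show ?thesis using sB by simp
  qed
  have bound: "cmod (poly ?B (zeta (2*n) k)) \<le> real noncoprimes" for k
  proof -
    have "poly ?B (zeta (2*n) k) = (\<Sum>j<n. poly.coeff ?B j * zeta (2*n) k ^ j)"
      by (rule poly_eq_sum_lessThan) (rule B0)
    then have "cmod (poly ?B (zeta (2*n) k)) \<le> (\<Sum>j<n. cmod (poly.coeff ?B j * zeta (2*n) k ^ j))" by (simp add: norm_sum)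
    then show ?thesis using sB by (simp add: norm_mult norm_power)
  qed
  have "Lnorm 4 ?B ^ 4 = (\<Sum>k\<in>{0..<int (2*n)}. cmod (poly ?B (zeta (2*n) k)) ^ 4) / (2 * real n)"
    by (rule Lnorm_4_power_4[OF B0 n_pos])
  also have "\<dots> \<le> (\<Sum>k\<in>{0..<int (2*n)}. (real noncoprimes)\<^sup>2 * (cmod (poly ?B (zeta (2*n) k)))\<^sup>2) / (2 * real n)"
  proof (intro divide_right_mono sum_mono)
    fix k
    have "cmod (poly ?B (zeta (2*n) k)) ^ 4 = (cmod (poly ?B (zeta (2*n) k)))\<^sup>2 * (cmod (poly ?B (zeta (2*n) k)))\<^sup>2"
      by (simp flip: power_add)
    also have "\<dots> \<le> (real noncoprimes)\<^sup>2 * (cmod (poly ?B (zeta (2*n) k)))\<^sup>2"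
      by (intro mult_right_mono power_mono bound) auto
    finally show "cmod (poly ?B (zeta (2*n) k)) ^ 4 \<le> (real noncoprimes)\<^sup>2 * (cmod (poly ?B (zeta (2*n) k)))\<^sup>2" .
  qed simp
  also have "(\<Sum>k\<in>{0..<int (2*n)}. (real noncoprimes)\<^sup>2 * (cmod (poly ?B (zeta (2*n) k)))\<^sup>2) = (real noncoprimes)\<^sup>2 * (real (2*n) * real noncoprimes)"
  proof -
    have "(\<Sum>k\<in>{0..<int (2*n)}. (cmod (poly ?B (zeta (2*n) k)))\<^sup>2) = real (2*n) * (\<Sum>j<2*n. (cmod (poly.coeff ?B j))\<^sup>2)"
      by (rule parseval_poly_zeta) (use B0 n_pos in auto)
    then show ?thesis unfolding sB2 sum_distrib_left[symmetric] by (simp only:)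
  qed
  also have "\<dots> / (2 * real n) = real noncoprimes ^ 3" using n_pos by (simp add: power2_eq_square power3_eq_cube)
  finally show ?thesis .
qed

lemma smallest_prime_factor:
  "smallest_prime_factor n \<in> prime_factors n" "P \<in> prime_factors n \<Longrightarrow> smallest_prime_factor n \<le> P"
proof -
  have "prime_factors n \<noteq> {}" using n_gt_1 by (simp add: prime_factorization_empty_iff)
  then show "smallest_prime_factor n \<in> prime_factors n" unfolding smallest_prime_factor_def by (intro Min_in) auto
  show "P \<in> prime_factors n \<Longrightarrow> smallest_prime_factor n \<le> P" unfolding smallest_prime_factor_def by (intro Min_le) auto
qed

text \<open>Three prime factors, each at least the smallest one, would have a product of at least
  its cube.\<close>

lemma card_prime_factors_le_2:
  assumes "n < smallest_prime_factor n ^ 3"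
  shows "card (prime_factors n) \<le> 2"
proof (rule ccontr)
  let ?p = "smallest_prime_factor n"
  assume "\<not> ?thesis"
  then have "3 \<le> card (prime_factors n)" by simp
  moreover have "?p \<ge> 1" using smallest_prime_factor(1) in_prime_factors_imp_prime prime_ge_1_nat by blast
  ultimately have "?p ^ 3 \<le> ?p ^ card (prime_factors n)" by (intro power_increasing) auto
  also have "\<dots> = (\<Prod>P\<in>prime_factors n. ?p)" by simp
  also have "\<dots> \<le> (\<Prod>P\<in>prime_factors n. P ^ multiplicity P n)"
  proof (intro prod_mono conjI)
    fix P assume P: "P \<in> prime_factors n"
    have "multiplicity P n \<ge> 1" using P by (auto simp: prime_factors_multiplicity)
    then have "P ^ 1 \<le> P ^ multiplicity P n" using prime_ge_1_nat[OF in_prime_factors_imp_prime[OF P]] by (intro power_increasing) auto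
    then show "?p \<le> P ^ multiplicity P n" using smallest_prime_factor(2)[OF P] by simp
  qed simp
  also have "\<dots> = n" using prod_prime_factors[of n] n_pos by simp
  finally show False using assms by simp
qed

end

section \<open>The limiting phase\<close>

text \<open>The fractional part jumps at integers, but its squared deviation from 1/2 does not.
  Writing it through the distance to a fixed nearby integer makes the continuity visible.\<close>

lemma fractional_part_square:
  fixes x :: real and k :: int
  assumes "\<bar>x - of_int k\<bar> \<le> 1"
  shows "(2 * (x - of_int \<lfloor>x\<rfloor>) - 1)\<^sup>2 = (1 - 2 * \<bar>x - of_int k\<bar>)\<^sup>2"
proof -
  consider "x = of_int k + 1" | "of_int k \<le> x" "x < of_int k + 1" | "of_int k - 1 \<le> x" "x < of_int k"
    using assms by linarith
  then show ?thesis
  proof cases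
    case 1
    then have "\<lfloor>x\<rfloor> = k + 1" by linarith
    then show ?thesis using 1 by simp
  next
    case 2
    then have "\<lfloor>x\<rfloor> = k" by linarith
    then show ?thesis using 2 by (simp add: power2_commute)
  next
    case 3
    then have "\<lfloor>x\<rfloor> = k - 1" by linarith
    then have "2 * (x - of_int \<lfloor>x\<rfloor>) - 1 = 1 - 2 * \<bar>x - of_int k\<bar>" using 3 by simp
    then show ?thesis by (simp only:)
  qed
qed

lemma floor_mult_div_tendsto: "((\<lambda>n. real_of_int \<lfloor>real n * r\<rfloor> / real n) \<longlongrightarrow> r) at_top"
proof (rule tendsto_sandwich)
  show "\<forall>\<^sub>F n in at_top. r - 1 / real n \<le> real_of_int \<lfloor>real n * r\<rfloor> / real n"
    using eventually_gt_at_top[of 0]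
  proof eventually_elim
    case (elim n)
    have "real n * r - 1 \<le> real_of_int \<lfloor>real n * r\<rfloor>" by linarith
    then have "(real n * r - 1) / real n \<le> real_of_int \<lfloor>real n * r\<rfloor> / real n" by (rule divide_right_mono) simp
    then show ?case using elim by (simp add: diff_divide_distrib)
  qed
  show "\<forall>\<^sub>F n in at_top. real_of_int \<lfloor>real n * r\<rfloor> / real n \<le> r"
    using eventually_gt_at_top[of 0]
  proof eventually_elim
    case (elim n)
    have "real_of_int \<lfloor>real n * r\<rfloor> / real n \<le> real n * r / real n" by (intro divide_right_mono) auto
    then show ?case using elim by simp
  qed
  show "((\<lambda>n. r - 1 / real n) \<longlongrightarrow> r) at_top" by real_asymp
qed simp

text \<open>t/n is the fractional part of a sequence tending to -2r. When 2r is an integer the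
  fractional part need not converge, but the squared expression does, by
  \<open>fractional_part_square\<close>.\<close>

lemma rotation_phase_tendsto:
  fixes r :: real
  defines "\<sigma> \<equiv> r - of_int \<lceil>r - 1/2\<rceil>"
  defines "t \<equiv> \<lambda>n. (- (2 * \<lfloor>real n * r\<rfloor>)) mod int n"
  shows "((\<lambda>n. ((2 * real_of_int (t n) + 2 - real n) / real n)\<^sup>2) \<longlongrightarrow> 16 * (\<bar>\<sigma>\<bar> - 1/4)\<^sup>2) at_top"
proof -
  \<comment> \<open>Chosen so that -2r - k = -2\<sigma>, which lies in the half-open interval from
    -1 (included) to 1 (excluded).\<close>
  define k where "k = - (2 * \<lceil>r - 1/2\<rceil>)"
  define x where "x = (\<lambda>n. - (2 * (real_of_int \<lfloor>real n * r\<rfloor> / real n)))"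
  define y where "y = (\<lambda>n. 2 * real_of_int (t n) / real n - 1)"
  have \<sigma>: "- 1 / 2 < \<sigma>" "\<sigma> \<le> 1 / 2" unfolding \<sigma>_def by linarith+
  have x: "(x \<longlongrightarrow> - (2 * r)) at_top" unfolding x_def by (intro tendsto_intros floor_mult_div_tendsto)
  have xk: "- (2 * r) - of_int k = - (2 * \<sigma>)" by (simp add: k_def \<sigma>_def)
  have "((\<lambda>n. x n - of_int k) \<longlongrightarrow> - (2 * \<sigma>)) at_top" using tendsto_diff[OF x tendsto_const[of "of_int k"]] xk by simp
  then have "\<forall>\<^sub>F n in at_top. x n - of_int k < 1" using \<sigma> by (intro order_tendstoD(2)) auto
  then have ev: "\<forall>\<^sub>F n in at_top. (y n)\<^sup>2 = (1 - 2 * \<bar>x n - of_int k\<bar>)\<^sup>2"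
    using eventually_gt_at_top[of 0]
  proof eventually_elim
    case (elim n)
    \<comment> \<open>For \<sigma> = 1/2 the limit is exactly -1, so convergence alone cannot give
      the lower bound. It comes from the floor rounding down, which keeps \<open>x n\<close> at or
      above -2r.\<close>
    have "real_of_int \<lfloor>real n * r\<rfloor> \<le> real n * r" by linarith
    then have "real_of_int \<lfloor>real n * r\<rfloor> / real n \<le> r" using elim by (simp add: field_simps)
    then have "x n \<ge> - (2 * r)" by (simp add: x_def)
    then have "x n - of_int k \<ge> -1" using xk \<sigma> by linarith
    then have abs: "\<bar>x n - of_int k\<bar> \<le> 1" using elim by linarith
    have xn: "x n = real_of_int (- (2 * \<lfloor>real n * r\<rfloor>)) / real_of_int (int n)" by (simp add: x_def)
    have "\<lfloor>x n\<rfloor> = (- (2 * \<lfloor>real n * r\<rfloor>)) div int n" unfolding xn by (rule floor_divide_of_int_eq)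
    then have "t n = - (2 * \<lfloor>real n * r\<rfloor>) - int n * \<lfloor>x n\<rfloor>" unfolding t_def by (simp add: minus_mult_div_eq_mod)
    then have "real_of_int (t n) = - (2 * real_of_int \<lfloor>real n * r\<rfloor>) - real n * real_of_int \<lfloor>x n\<rfloor>" by simp
    then have "real_of_int (t n) / real n = x n - of_int \<lfloor>x n\<rfloor>" using elim by (simp add: x_def field_simps)
    then have "y n = 2 * (x n - of_int \<lfloor>x n\<rfloor>) - 1" by (simp add: y_def)
    then show ?case using fractional_part_square[OF abs] by simp
  qed
  have "((\<lambda>n. (1 - 2 * \<bar>x n - of_int k\<bar>)\<^sup>2) \<longlongrightarrow> (1 - 2 * \<bar>- (2 * r) - of_int k\<bar>)\<^sup>2) at_top"
    by (intro tendsto_intros x)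
  then have y2: "((\<lambda>n. (y n)\<^sup>2) \<longlongrightarrow> (1 - 2 * \<bar>- (2 * r) - of_int k\<bar>)\<^sup>2) at_top"
    by (rule Lim_transform_eventually) (use ev in \<open>auto elim: eventually_mono\<close>)
  \<comment> \<open>The numerator has 2t + 2 - n rather than 2t - n, which adds 2/n to
    \<open>y n\<close>. The cross term and the square of this correction both tend to zero.\<close>
  have z: "((\<lambda>n. y n * (4 / real n)) \<longlongrightarrow> 0) at_top"
  proof (rule Lim_null_comparison)
    show "\<forall>\<^sub>F n in at_top. norm (y n * (4 / real n)) \<le> 4 / real n"
      using eventually_gt_at_top[of 0]
    proof eventually_elim
      case (elim n)
      have "0 \<le> t n" "t n < int n" using elim by (auto simp: t_def)
      then have "0 \<le> real_of_int (t n) / real n" "real_of_int (t n) / real n \<le> 1" by (auto simp: divide_le_eq_1)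
      then have "\<bar>y n\<bar> \<le> 1" unfolding y_def by linarith
      then have "\<bar>y n\<bar> * (4 / real n) \<le> 1 * (4 / real n)" by (intro mult_right_mono) auto
      then show ?case by (simp add: abs_mult)
    qed
    show "((\<lambda>n. 4 / real n) \<longlongrightarrow> 0) at_top" by real_asymp
  qed
  have z2: "((\<lambda>n. (2 / real n)\<^sup>2) \<longlongrightarrow> 0) at_top" by real_asymp
  have "((\<lambda>n. (y n)\<^sup>2 + y n * (4 / real n) + (2 / real n)\<^sup>2) \<longlongrightarrow> (1 - 2 * \<bar>- (2 * r) - of_int k\<bar>)\<^sup>2 + 0 + 0) at_top"
    by (intro tendsto_add y2 z z2)
  moreover have "(1 - 2 * \<bar>- (2 * r) - of_int k\<bar>)\<^sup>2 = 16 * (\<bar>\<sigma>\<bar> - 1/4)\<^sup>2"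
    unfolding xk by (simp add: power2_eq_square algebra_simps abs_mult)
  ultimately have "((\<lambda>n. (y n)\<^sup>2 + y n * (4 / real n) + (2 / real n)\<^sup>2) \<longlongrightarrow> 16 * (\<bar>\<sigma>\<bar> - 1/4)\<^sup>2) at_top" by simp
  moreover have "\<forall>\<^sub>F n in at_top. (y n)\<^sup>2 + y n * (4 / real n) + (2 / real n)\<^sup>2 = ((2 * real_of_int (t n) + 2 - real n) / real n)\<^sup>2"
    using eventually_gt_at_top[of 0]
  proof eventually_elim
    case (elim n)
    have "(2 * real_of_int (t n) + 2 - real n) / real n = y n + 2 / real n" using elim by (simp add: y_def field_simps)
    then show ?case by (simp add: power2_sum)
  qed
  ultimately show ?thesis by (rule Lim_transform_eventually)
qed

text \<open>The factor C e may blow up as e tends to 0, so e is fixed first, from the target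
  accuracy, and only then does n grow.\<close>

lemma tendsto_perturb:
  fixes X Y Z :: "'a \<Rightarrow> real" and C :: "real \<Rightarrow> real"
  assumes X: "(X \<longlongrightarrow> c) F" and Z: "(Z \<longlongrightarrow> 0) F" and c: "c > 0"
    and close: "\<And>e. 0 < e \<Longrightarrow> e \<le> 1 \<Longrightarrow> \<forall>\<^sub>F n in F. \<bar>Y n - X n\<bar> \<le> 15 * e * X n + C e * Z n"
  shows "(Y \<longlongrightarrow> c) F"
proof -
  have "((\<lambda>n. Y n - X n) \<longlongrightarrow> 0) F"
  proof (rule tendstoI)
    fix d :: real assume d: "d > 0"
    \<comment> \<open>With X eventually below c + 1, this makes 15 e X at most d/2; the other half
      of d is left for the term with Z.\<close>
    define e where "e = min 1 (d / (30 * (c + 1)))"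
    have e: "0 < e" "e \<le> 1" "e \<le> d / (30 * (c + 1))" using d c by (auto simp: e_def)
    have "((\<lambda>n. C e * Z n) \<longlongrightarrow> C e * 0) F" by (intro tendsto_intros Z)
    then have "\<forall>\<^sub>F n in F. C e * Z n < d / 2" using d by (intro order_tendstoD(2)) auto
    moreover have "\<forall>\<^sub>F n in F. X n < c + 1" using X by (rule order_tendstoD(2)) simp
    ultimately show "\<forall>\<^sub>F n in F. dist (Y n - X n) 0 < d" using close[OF e(1,2)]
    proof eventually_elim
      case (elim n)
      have "15 * e * X n \<le> 15 * e * (c + 1)" using elim e by (intro mult_left_mono) auto
      also have "\<dots> \<le> d / 2" using e(3) c by (simp add: field_simps)
      finally show ?case using elim by (simp add: dist_real_def)
    qed
  qed
  from tendsto_add[OF this X] show ?thesis by simp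
qed

text \<open>Finiteness, together with \<open>V_set_nonempty\<close>, ensures that \<open>Max\<close>
  and \<open>Min\<close> in the theorem are attained.\<close>

lemma finite_V_set: "finite (V_set n)"
proof (rule finite_subset)
  show "V_set n \<subseteq> (\<lambda>f. \<Sum>j<n. Polynomial.monom (f j) j) ` (PiE {..<n} (\<lambda>_. {0, -1, 1}))"
  proof
    fix V assume V: "V \<in> V_set n"
    have "V = (\<Sum>j<n. Polynomial.monom (restrict (poly.coeff V) {..<n} j) j)"
      using V by (intro poly_eqI) (auto simp: V_set_def coeff_sum not_less)
    moreover have "restrict (poly.coeff V) {..<n} \<in> PiE {..<n} (\<lambda>_. {0, -1, 1})"
      using V by (auto simp: V_set_def)
    ultimately show "V \<in> (\<lambda>f. \<Sum>j<n. Polynomial.monom (f j) j) ` (PiE {..<n} (\<lambda>_. {0, -1, 1}))" by blast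
  qed
  show "finite ((\<lambda>f. \<Sum>j<n. Polynomial.monom (f j) j) ` (PiE {..<n} (\<lambda>_. {0, -1, 1::complex})))"
    by (intro finite_imageI finite_PiE) auto
qed

lemma V_set_nonempty: "V_set n \<noteq> {}"
proof -
  have "(\<Sum>j<n. Polynomial.monom (of_bool (\<not> coprime j n)) j) \<in> V_set n"
    by (auto simp: V_set_def coeff_sum)
  then show ?thesis by blast
qed

text \<open>Eventually n^(1/3) < p, which yields n < p^3 and hence at most two prime factors. It
  also gives 1/p \<le> n^(-1/3) and p^(-1/4) \<le> n^(-1/12), so the error is of order n^(-1/12)
  log^4 n. The second claim is kept in terms of the given ratio, since a bound by n^(-1/3) alone
  would only show boundedness there.\<close>

lemma Lnorm_4_char_poly_tendsto:
  fixes S :: "nat set" and r :: real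
  assumes S: "\<And>n. n \<in> S \<Longrightarrow> n > 1 \<and> odd n \<and> squarefree n"
    and p: "((\<lambda>n. real n powr (1/3) / real (smallest_prime_factor n)) \<longlongrightarrow> 0) (inf at_top (principal S))"
  shows "((\<lambda>n. Lnorm 4 (rotation n r (char_poly n)) ^ 4 / (real n)\<^sup>2) \<longlongrightarrow>
      7 / 6 + 8 * (\<bar>r - of_int \<lceil>r - 1/2\<rceil>\<bar> - 1/4)\<^sup>2) (inf at_top (principal S))"
    and "\<forall>\<^sub>F n in inf at_top (principal S).
      real (odd_squarefree.noncoprimes n) ^ 3 / (real n)\<^sup>2 \<le> 8 * (real n powr (1/3) / real (smallest_prime_factor n)) ^ 3"
proof -
  let ?F = "inf at_top (principal S)"
  let ?\<sigma> = "r - of_int \<lceil>r - 1/2\<rceil>"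
  let ?p = smallest_prime_factor
  let ?X = "\<lambda>n. Lnorm 4 (rotation n r (char_poly n)) ^ 4 / (real n)\<^sup>2"
  let ?t = "\<lambda>n. (- (2 * \<lfloor>real n * r\<rfloor>)) mod int n"
  define main where "main = (\<lambda>n. 7 / 6 + ((2 * real_of_int (?t n) + 2 - real n) / real n)\<^sup>2 / 2 - 2 / (3 * (real n)\<^sup>2))"
  define err where "err = (\<lambda>n. 2 * real n powr (-1/3)
     + (4 * real n powr (-1/3) + 5 * real n powr (-1/12)) * (4 * (1 + ln (real n))) ^ 4
     + 6 * ((4 * (1 + ln (real n)))\<^sup>2 * (32 * (1 + ln (real n))\<^sup>2 * real n powr (-1/3))))"
  have evS: "\<forall>\<^sub>F n in ?F. n \<in> S" by (simp add: eventually_inf_principal)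
  have ev1: "\<forall>\<^sub>F n in ?F. real n powr (1/3) / real (?p n) < 1"
    using p by (rule order_tendstoD(2)) simp
  have good: "odd_squarefree n \<and> card (prime_factors n) \<le> 2 \<and> real n powr (1/3) \<le> real (?p n) \<and> ?p n > 0"
    if n: "n \<in> S" "real n powr (1/3) / real (?p n) < 1" for n
  proof -
    interpret odd_squarefree n using S[OF n(1)] by unfold_locales auto
    have p0: "?p n > 0" using smallest_prime_factor(1) in_prime_factors_imp_prime prime_gt_0_nat by blast
    have lt: "real n powr (1/3) < real (?p n)" using n(2) p0 by (simp add: field_simps)
    have "real n = (real n powr (1/3)) ^ 3" using n_pos by (simp add: powr_power)
    also have "\<dots> < real (?p n) ^ 3" by (rule power_strict_mono[OF lt]) auto
    finally have "n < ?p n ^ 3" by (simp flip: of_nat_power)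
    then have "card (prime_factors n) \<le> 2" by (rule card_prime_factors_le_2)
    then show ?thesis using lt p0 odd_squarefree_axioms by simp
  qed
  have bound: "norm (?X n - main n) \<le> err n"
    if n: "n \<in> S" "real n powr (1/3) / real (?p n) < 1" for n
  proof -
    note g = good[OF n]
    interpret odd_squarefree n using g by simp
    let ?h = "harm n :: real"
    have h: "0 \<le> ?h" "?h \<le> 1 + ln (real n)" using harm_le_ln[OF n_pos] by (auto simp: harm_nonneg)
    have ip: "1 / real (?p n) \<le> real n powr (-1/3)"
    proof -
      have "1 / real (?p n) \<le> 1 / real n powr (1/3)" using g n_pos by (intro frac_le) auto
      then show ?thesis by (simp add: powr_minus_divide)
    qed
    have N: "real noncoprimes / real n \<le> 2 * real n powr (-1/3)"
    proof -
      have "real noncoprimes / real n \<le> (2 * real n / real (?p n)) / real n"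
        using g smallest_prime_factor(2) by (intro divide_right_mono noncoprimes_le) auto
      also have "\<dots> = 2 * (1 / real (?p n))" using n_pos by simp
      finally show ?thesis using ip by linarith
    qed
    have q: "real (?p n) powr (-1/4) \<le> real n powr (-1/12)"
    proof -
      have "real (?p n) powr (-1/4) \<le> (real n powr (1/3)) powr (-1/4)"
        using g n_pos by (intro powr_mono2') auto
      then show ?thesis by (simp add: powr_powr)
    qed
    have "norm (?X n - main n) \<le> real noncoprimes / real n + (2 * real noncoprimes / real n + 5 * real (?p n) powr (-1/4)) * (4 * ?h) ^ 4
        + 6 * ((4 * ?h)\<^sup>2 * (32 * ?h\<^sup>2 / real (?p n)))"
      unfolding real_norm_def main_def
      using g by (intro Lnorm_4_char_poly_approx smallest_prime_factor) auto
    also have "\<dots> \<le> err n"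
    proof -
      have "32 * ?h\<^sup>2 / real (?p n) \<le> 32 * (1 + ln (real n))\<^sup>2 * real n powr (-1/3)"
      proof -
        have "32 * ?h\<^sup>2 * (1 / real (?p n)) \<le> 32 * (1 + ln (real n))\<^sup>2 * real n powr (-1/3)"
          using h ip by (intro mult_mono power_mono) auto
        then show ?thesis by simp
      qed
      moreover have "2 * real noncoprimes / real n \<le> 4 * real n powr (-1/3)" using N by simp
      ultimately show ?thesis unfolding err_def
        using h N q by (intro add_mono mult_mono power_mono) auto
    qed
    finally show ?thesis .
  qed
  have "\<forall>\<^sub>F n in ?F. norm (?X n - main n) \<le> err n"
    using evS ev1 by eventually_elim (rule bound)
  moreover have "(err \<longlongrightarrow> 0) ?F"
  \<comment> \<open>The error bound is by now a function of n alone, so its limit along all n may be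
    used.\<close>
  proof (rule tendsto_mono[OF inf_le1])
    show "(err \<longlongrightarrow> 0) at_top" unfolding err_def by real_asymp
  qed
  ultimately have "((\<lambda>n. ?X n - main n) \<longlongrightarrow> 0) ?F" by (rule Lim_null_comparison)
  moreover have "(main \<longlongrightarrow> 7 / 6 + 8 * (\<bar>?\<sigma>\<bar> - 1/4)\<^sup>2) ?F"
  proof (rule tendsto_mono[OF inf_le1])
    have "((\<lambda>n. 2 / (3 * (real n)\<^sup>2)) \<longlongrightarrow> 0) at_top" by real_asymp
    then have "(main \<longlongrightarrow> 7 / 6 + 16 * (\<bar>?\<sigma>\<bar> - 1/4)\<^sup>2 / 2 - 0) at_top"
      unfolding main_def by (intro tendsto_intros rotation_phase_tendsto) auto
    then show "(main \<longlongrightarrow> 7 / 6 + 8 * (\<bar>?\<sigma>\<bar> - 1/4)\<^sup>2) at_top" by simp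
  qed
  ultimately show "(?X \<longlongrightarrow> 7 / 6 + 8 * (\<bar>?\<sigma>\<bar> - 1/4)\<^sup>2) ?F"
    using tendsto_add[of "\<lambda>n. ?X n - main n" 0 ?F main] by simp
  show "\<forall>\<^sub>F n in ?F. real (odd_squarefree.noncoprimes n) ^ 3 / (real n)\<^sup>2 \<le> 8 * (real n powr (1/3) / real (?p n)) ^ 3"
    using evS ev1
  proof eventually_elim
    case (elim n)
    note g = good[OF elim]
    interpret odd_squarefree n using g by simp
    have "real noncoprimes ^ 3 / (real n)\<^sup>2 \<le> (2 * real n / real (?p n)) ^ 3 / (real n)\<^sup>2"
      using g smallest_prime_factor(2) by (intro divide_right_mono power_mono noncoprimes_le) auto
    also have "\<dots> = 8 * (real n / real (?p n) ^ 3)"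
      using n_pos by (simp add: power_divide power_mult_distrib power2_eq_square power3_eq_cube)
    also have "real n / real (?p n) ^ 3 = (real n powr (1/3) / real (?p n)) ^ 3"
      using n_pos by (simp add: power_divide powr_power)
    finally show ?case .
  qed
qed

text \<open>V is an arbitrary selection, one element for each n. Proving convergence for every
  selection takes the place of an estimate uniform over \<open>V_set n\<close>.\<close>

lemma merit_factor_tendsto:
  fixes S :: "nat set" and r :: real and V :: "nat \<Rightarrow> complex poly"
  assumes S: "\<And>n. n \<in> S \<Longrightarrow> n > 1 \<and> odd n \<and> squarefree n"
    and p: "((\<lambda>n. real n powr (1/3) / real (smallest_prime_factor n)) \<longlongrightarrow> 0) (inf at_top (principal S))"
    and V: "\<And>n. V n \<in> V_set n"
  shows "((\<lambda>n. merit_factor (rotation n r (char_poly n) + rotation n r (V n))) \<longlongrightarrow> f_lim r) (inf at_top (principal S))"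
proof -
  let ?F = "inf at_top (principal S)"
  define c where "c = 7 / 6 + 8 * (\<bar>r - of_int \<lceil>r - 1/2\<rceil>\<bar> - 1/4)\<^sup>2"
  define A B where "A = (\<lambda>n. rotation n r (char_poly n))" and "B = (\<lambda>n. rotation n r (V n))"
  let ?q = "\<lambda>n. real n powr (1/3) / real (smallest_prime_factor n)"
  have evS: "\<forall>\<^sub>F n in ?F. n \<in> S" by (simp add: eventually_inf_principal)
  have c: "c \<ge> 7 / 6" unfolding c_def by simp
  have Z: "((\<lambda>n. 8 * ?q n ^ 3) \<longlongrightarrow> 0) ?F" using tendsto_mult[OF tendsto_const[of 8] tendsto_power[OF p, of 3]] by simp
  have X: "((\<lambda>n. Lnorm 4 (A n) ^ 4 / (real n)\<^sup>2) \<longlongrightarrow> c) ?F"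
    unfolding A_def c_def by (rule Lnorm_4_char_poly_tendsto(1)[OF S p])
  have noncoprimes: "\<forall>\<^sub>F n in ?F. real (odd_squarefree.noncoprimes n) ^ 3 / (real n)\<^sup>2 \<le> 8 * ?q n ^ 3"
    by (rule Lnorm_4_char_poly_tendsto(2)[OF S p])
  have Y: "((\<lambda>n. Lnorm 4 (A n + B n) ^ 4 / (real n)\<^sup>2) \<longlongrightarrow> c) ?F"
  proof (rule tendsto_perturb[OF X Z, where C = "\<lambda>e. (1 + 1 / e) ^ 4"])
    fix e :: real assume e: "0 < e" "e \<le> 1"
    show "\<forall>\<^sub>F n in ?F. \<bar>Lnorm 4 (A n + B n) ^ 4 / (real n)\<^sup>2 - Lnorm 4 (A n) ^ 4 / (real n)\<^sup>2\<bar>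
       \<le> 15 * e * (Lnorm 4 (A n) ^ 4 / (real n)\<^sup>2) + (1 + 1 / e) ^ 4 * (8 * ?q n ^ 3)"
      using evS noncoprimes
    proof eventually_elim
      case (elim n)
      interpret odd_squarefree n using S[OF elim(1)] by unfold_locales auto
      have "\<bar>Lnorm 4 (A n + B n) ^ 4 - Lnorm 4 (A n) ^ 4\<bar> \<le> 15 * e * Lnorm 4 (A n) ^ 4 + (1 + 1 / e) ^ 4 * Lnorm 4 (B n) ^ 4"
        by (rule Lnorm_4_add[OF _ _ n_pos e]) (simp_all add: A_def B_def coeff_rotation)
      then have "\<bar>Lnorm 4 (A n + B n) ^ 4 - Lnorm 4 (A n) ^ 4\<bar> / (real n)\<^sup>2
         \<le> (15 * e * Lnorm 4 (A n) ^ 4 + (1 + 1 / e) ^ 4 * Lnorm 4 (B n) ^ 4) / (real n)\<^sup>2"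
        by (rule divide_right_mono) simp
      moreover have "(1 + 1 / e) ^ 4 * (Lnorm 4 (B n) ^ 4 / (real n)\<^sup>2) \<le> (1 + 1 / e) ^ 4 * (8 * ?q n ^ 3)"
      proof (rule mult_left_mono)
        have "Lnorm 4 (B n) ^ 4 / (real n)\<^sup>2 \<le> real noncoprimes ^ 3 / (real n)\<^sup>2"
          unfolding B_def by (intro divide_right_mono Lnorm_4_V_le V) simp
        then show "Lnorm 4 (B n) ^ 4 / (real n)\<^sup>2 \<le> 8 * ?q n ^ 3" using elim(2) by linarith
      qed (use e in simp)
      moreover have "\<bar>x / y\<^sup>2 - z / y\<^sup>2\<bar> = \<bar>x - z\<bar> / y\<^sup>2" for x y z :: real
        by (simp flip: diff_divide_distrib)
      ultimately show ?case by (simp add: add_divide_distrib)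
    qed
  qed (use c in simp)
  \<comment> \<open>Dividing by the square of n, which equals the fourth power of the 2-norm, turns
    the merit factor into 1/(Y - 1). The bound c \<ge> 7/6 keeps the limiting denominator away from
    zero.\<close>
  have "((\<lambda>n. 1 / (Lnorm 4 (A n + B n) ^ 4 / (real n)\<^sup>2 - 1)) \<longlongrightarrow> 1 / (c - 1)) ?F"
    by (intro tendsto_intros Y) (use c in auto)
  moreover have "\<forall>\<^sub>F n in ?F. 1 / (Lnorm 4 (A n + B n) ^ 4 / (real n)\<^sup>2 - 1) = merit_factor (A n + B n)"
    using evS
  proof eventually_elim
    case (elim n)
    interpret odd_squarefree n using S[OF elim] by unfold_locales auto
    have L2: "Lnorm 2 (A n + B n) ^ 4 = (real n)\<^sup>2" unfolding A_def B_def by (rule Lnorm_2_char_poly_plus_V[OF V])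
    have "Lnorm 4 (A n + B n) ^ 4 / (real n)\<^sup>2 - 1 = (Lnorm 4 (A n + B n) ^ 4 - (real n)\<^sup>2) / (real n)\<^sup>2"
      using n_pos by (simp add: diff_divide_distrib)
    then show ?case unfolding merit_factor_def L2 by simp
  qed
  ultimately have "((\<lambda>n. merit_factor (A n + B n)) \<longlongrightarrow> 1 / (c - 1)) ?F" by (rule Lim_transform_eventually)
  moreover have "1 / (c - 1) = f_lim r" by (simp add: c_def f_lim_def Let_def)
  ultimately show ?thesis unfolding A_def B_def by simp
qed

theorem theorem7:
  fixes S :: "nat set" and r :: real
  assumes "infinite S"
    and "\<And>n. n \<in> S \<Longrightarrow> n > 1 \<and> odd n \<and> squarefree n"
    and "((\<lambda>n. real n powr (1/3) / real (smallest_prime_factor n)) \<longlongrightarrow> 0) (inf at_top (principal S))"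
  shows "((\<lambda>n. Max ((\<lambda>V. merit_factor (rotation n r (char_poly n) + rotation n r V)) ` V_set n))
            \<longlongrightarrow> f_lim r) (inf at_top (principal S)) \<and>
         ((\<lambda>n. Min ((\<lambda>V. merit_factor (rotation n r (char_poly n) + rotation n r V)) ` V_set n))
            \<longlongrightarrow> f_lim r) (inf at_top (principal S))"
proof -
  define m where "m = (\<lambda>n V. merit_factor (rotation n r (char_poly n) + rotation n r V))"
  \<comment> \<open>Both extremes are values at some V, so a choice of V for each n reduces maximum
    and minimum alike to the convergence along a selection.\<close>
  have attained: "((\<lambda>n. g n) \<longlongrightarrow> f_lim r) (inf at_top (principal S))" if g: "\<And>n. g n \<in> m n ` V_set n" for g
  proof -
    have "\<forall>n. \<exists>V. V \<in> V_set n \<and> m n V = g n" using g by (metis imageE)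
    then obtain V where V: "\<And>n. V n \<in> V_set n" "\<And>n. m n (V n) = g n" by metis
    have "((\<lambda>n. m n (V n)) \<longlongrightarrow> f_lim r) (inf at_top (principal S))"
      unfolding m_def by (rule merit_factor_tendsto[OF assms(2,3) V(1)])
    then show ?thesis by (simp only: V(2))
  qed
  have "finite (m n ` V_set n)" "m n ` V_set n \<noteq> {}" for n
    using finite_V_set V_set_nonempty by auto
  then have "Max (m n ` V_set n) \<in> m n ` V_set n" "Min (m n ` V_set n) \<in> m n ` V_set n" for n
    by (auto intro: Max_in Min_in)
  then have "((\<lambda>n. Max (m n ` V_set n)) \<longlongrightarrow> f_lim r) (inf at_top (principal S))"
    "((\<lambda>n. Min (m n ` V_set n)) \<longlongrightarrow> f_lim r) (inf at_top (principal S))"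
    by (auto intro!: attained)
  then show ?thesis unfolding m_def by blast
qed

end
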